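(* Consider a fixed collection of $p$ predictors partitioned into $k$ blocks, with an $n\times p$ design $X$ whose columns are centered, columns in different blocks orthogonal, and $\lim_{n\to\infty}\frac1nX^TX=D$ for some positive definite $D$. Each of the $2^p$ models $\mathcal M_\gamma$ carries the block hyper-$g$ prior (hyperparameter $2<a\le4$) on its nonempty block intersections, and a fixed prior over models assigns positive probability to each model. Suppose the data are generated by a true model $\mathcal M_T:y=\alpha_T\mathbf 1+X_T\beta_T+\epsilon$, $\epsilon\sim N(0,\sigma^2I_n)$, and that for every model $\mathcal M_\gamma\not\supseteq\mathcal M_T$, $\lim_{n\to\infty}\frac1n\beta_T^TX_T^T(I-P_{X_\gamma})X_T\beta_T>0$. For a new predictor vector $x^*\in\mathbb R^p$, let $$\widehat y_n^*=E(\alpha\mid y_n)+\sum_{\gamma}\pi(\mathcal M_\gamma\mid y_n)\,x^{*T}E(\beta\mid y_n,\mathcal M_\gamma)$$ be the Bayesian model averaged prediction (with $E(\beta\mid y_n,\mathcal M_\gamma)$ padded with zeros for excluded predictors). Then $\widehat y_n^*\to\alpha_T+x^{*T}\beta_T$ in probability as $n\to\infty$ (prediction consistency under BMA).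
   Context: Block hyper-$g$ prior on blocks $X_1,\dots,X_m$: $\pi(\alpha,\sigma^2)\propto1/\sigma^2$; $\beta\mid g,\sigma^2\sim N(0,A\sigma^2)$ with $A$ block diagonal with blocks $g_i(X_i^TX_i)^{-1}$; $g_i$ independent with densities $\frac{a-2}{2}(1+g_i)^{-a/2}$, $g_i>0$. The response is centered. $P_{X_\gamma}$ denotes the projection onto the column space of the design of $\mathcal M_\gamma$; $\beta_T$ is padded with zeros outside $\mathcal M_T$. *)

theory Defs
  imports "HOL-Probability.Probability"
begin

(* Conventions.
   - Predictors are indexed by j < p; the design for sample size n is
     X n :: nat => nat => real, entry X n i j (row i < n, column j < p).
   - A model gamma is a subset of {..<p}.
   - The block structure is given by blk :: nat => nat, blk j < k;
     block b is {j<p. blk j = b}.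
   - Vectors indexed by a finite set S of naturals are functions nat => real. *)

definition det_on :: "nat set \<Rightarrow> (nat \<Rightarrow> nat \<Rightarrow> real) \<Rightarrow> real" where
  "det_on S M = (\<Sum>\<pi> \<in> {\<pi>. \<pi> permutes S}. of_int (sign \<pi>) * (\<Prod>i\<in>S. M i (\<pi> i)))"

definition mvn0_prec_density :: "nat set \<Rightarrow> (nat \<Rightarrow> nat \<Rightarrow> real) \<Rightarrow> (nat \<Rightarrow> real) \<Rightarrow> real" where
  "mvn0_prec_density S Q x =
     (2 * pi) powr (- real (card S) / 2) * sqrt (det_on S Q)
     * exp (- (\<Sum>i\<in>S. \<Sum>j\<in>S. x i * Q i j * x j) / 2)"

definition hyperg_density :: "real \<Rightarrow> real \<Rightarrow> real" where
  "hyperg_density a g = (if g > 0 then (a - 2) / 2 * (1 + g) powr (- a / 2) else 0)"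

definition model_blocks :: "nat \<Rightarrow> (nat \<Rightarrow> nat) \<Rightarrow> nat set \<Rightarrow> nat set" where
  "model_blocks k blk \<gamma> = {b. b < k \<and> (\<exists>j\<in>\<gamma>. blk j = b)}"

definition gram :: "(nat \<Rightarrow> nat \<Rightarrow> nat \<Rightarrow> real) \<Rightarrow> nat \<Rightarrow> nat \<Rightarrow> nat \<Rightarrow> real" where
  "gram X n j l = (\<Sum>i<n. X n i j * X n i l)"

text \<open>Precision matrix of the block hyper-g prior of beta_gamma given g and sigma^2:
  the covariance is A sigma^2 with A block diagonal with blocks g_b (X_b^T X_b)^{-1},
  hence the precision is block diagonal with blocks X_b^T X_b / (g_b sigma^2).\<close>
definition blockg_prec ::
  "(nat \<Rightarrow> nat \<Rightarrow> nat \<Rightarrow> real) \<Rightarrow> (nat \<Rightarrow> nat) \<Rightarrow> nat \<Rightarrow> (nat \<Rightarrow> real) \<Rightarrow> real \<Rightarrow> nat \<Rightarrow> nat \<Rightarrow> real" where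
  "blockg_prec X blk n g s j l =
     (if blk j = blk l then gram X n j l / (g (blk j) * s) else 0)"

text \<open>Parameter space of model gamma: (alpha, sigma^2, beta_gamma, g).\<close>
definition param_space :: "nat \<Rightarrow> (nat \<Rightarrow> nat) \<Rightarrow> nat set
    \<Rightarrow> (real \<times> real \<times> (nat \<Rightarrow> real) \<times> (nat \<Rightarrow> real)) measure" where
  "param_space k blk \<gamma> =
     (lborel :: real measure) \<Otimes>\<^sub>M (lborel :: real measure) \<Otimes>\<^sub>M
     (PiM \<gamma> (\<lambda>_. lborel :: real measure)) \<Otimes>\<^sub>M
     (PiM (model_blocks k blk \<gamma>) (\<lambda>_. lborel :: real measure))"

text \<open>Unnormalised joint density of (y, alpha, sigma^2, beta_gamma, g) under model gamma:
  likelihood N(alpha 1 + X_gamma beta_gamma, sigma^2 I_n), prior 1/sigma^2 on (alpha, sigma^2),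
  beta_gamma | g, sigma^2 ~ N(0, A sigma^2), g_b iid hyper-g(a).\<close>
definition joint_dens ::
  "real \<Rightarrow> nat \<Rightarrow> (nat \<Rightarrow> nat) \<Rightarrow> (nat \<Rightarrow> nat \<Rightarrow> nat \<Rightarrow> real) \<Rightarrow> nat \<Rightarrow> nat set \<Rightarrow> (nat \<Rightarrow> real)
     \<Rightarrow> real \<times> real \<times> (nat \<Rightarrow> real) \<times> (nat \<Rightarrow> real) \<Rightarrow> real" where
  "joint_dens a k blk X n \<gamma> y \<theta> =
     (case \<theta> of (\<alpha>, s, \<beta>, g) \<Rightarrow>
       if s > 0 \<and> (\<forall>b\<in>model_blocks k blk \<gamma>. g b > 0) then
         (\<Prod>i<n. normal_density (\<alpha> + (\<Sum>j\<in>\<gamma>. X n i j * \<beta> j)) (sqrt s) (y i))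
         * (1 / s)
         * mvn0_prec_density \<gamma> (blockg_prec X blk n g s) \<beta>
         * (\<Prod>b\<in>model_blocks k blk \<gamma>. hyperg_density a (g b))
       else 0)"

definition marg_lik where
  "marg_lik a k blk X n \<gamma> y =
     (\<integral>\<theta>. joint_dens a k blk X n \<gamma> y \<theta> \<partial>param_space k blk \<gamma>)"

definition post_model_prob where
  "post_model_prob a p k blk X prior n \<gamma> y =
     prior \<gamma> * marg_lik a k blk X n \<gamma> y
     / (\<Sum>\<gamma>'\<in>Pow {..<p}. prior \<gamma>' * marg_lik a k blk X n \<gamma>' y)"

definition post_mean_alpha where
  "post_mean_alpha a k blk X n \<gamma> y =
     (\<integral>\<theta>. fst \<theta> * joint_dens a k blk X n \<gamma> y \<theta> \<partial>param_space k blk \<gamma>)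
     / marg_lik a k blk X n \<gamma> y"

definition post_mean_beta where
  "post_mean_beta a k blk X n \<gamma> y j =
     (if j \<in> \<gamma> then
        (\<integral>\<theta>. fst (snd (snd \<theta>)) j * joint_dens a k blk X n \<gamma> y \<theta> \<partial>param_space k blk \<gamma>)
        / marg_lik a k blk X n \<gamma> y
      else 0)"

definition bma_alpha where
  "bma_alpha a p k blk X prior n y =
     (\<Sum>\<gamma>\<in>Pow {..<p}. post_model_prob a p k blk X prior n \<gamma> y * post_mean_alpha a k blk X n \<gamma> y)"

definition bma_pred where
  "bma_pred a p k blk X prior xs n y =
     bma_alpha a p k blk X prior n y
     + (\<Sum>\<gamma>\<in>Pow {..<p}. post_model_prob a p k blk X prior n \<gamma> y
          * (\<Sum>j<p. xs j * post_mean_beta a k blk X n \<gamma> y j))"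

text \<open>Squared norm of the residual (I - P_{X_gamma}) v, i.e. squared distance of v
  from the column space of X_gamma.\<close>
definition resid_ss :: "(nat \<Rightarrow> nat \<Rightarrow> nat \<Rightarrow> real) \<Rightarrow> nat \<Rightarrow> nat set \<Rightarrow> (nat \<Rightarrow> real) \<Rightarrow> real" where
  "resid_ss X n \<gamma> v = (INF c \<in> (UNIV :: (nat \<Rightarrow> real) set). \<Sum>i<n. (v i - (\<Sum>j\<in>\<gamma>. X n i j * c j))\<^sup>2)"

definition data_dist :: "(nat \<Rightarrow> nat \<Rightarrow> real) \<Rightarrow> real \<Rightarrow> nat \<Rightarrow> (nat \<Rightarrow> real) measure" where
  "data_dist \<mu> sig2 n = PiM {..<n} (\<lambda>i. density lborel (normal_density (\<mu> n i) (sqrt sig2)))"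

text \<open>Convergence in (outer) probability of Z_n to c under measures M_n.\<close>
definition conv_in_prob :: "(nat \<Rightarrow> 'a measure) \<Rightarrow> (nat \<Rightarrow> 'a \<Rightarrow> real) \<Rightarrow> real \<Rightarrow> bool" where
  "conv_in_prob M Z c \<longleftrightarrow>
     (\<forall>\<epsilon>>0. \<forall>\<delta>>0. eventually (\<lambda>n. \<exists>A\<in>sets (M n).
         {y\<in>space (M n). \<bar>Z n y - c\<bar> > \<epsilon>} \<subseteq> A \<and> measure (M n) A < \<delta>) sequentially)"

end

theory Submission
  imports Defs "Jordan_Normal_Form.Determinant"
begin

text \<open>
  The joint posterior of model, intercept and coefficients concentrates at the true
  \<open>(\<alpha>\<^sub>T, \<beta>\<^sub>T)\<close>; neither posterior model probabilities nor shrinkage factors have to be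
  computed. Let \<open>E\<close> be the mean squared noise and \<open>U\<close> the squared distance of the parameters
  from the truth. With high probability (Chebyshev) the noise is nearly orthogonal to the
  columns of the design, so the residual sum of squares is at least \<open>n (E - \<kappa> + c U / 2)\<close> in every
  model, and at most \<open>n (E + \<kappa>)\<close> close to the truth in the true model, with \<open>\<kappa>\<close> as small as
  desired. Integrating out \<open>\<sigma>\<^sup>2\<close> turns these bounds into the powers \<open>-n/2\<close> of the brackets, whereas
  priors and determinants only contribute bounded factors. Hence the weight of \<open>U > \<epsilon>\<close>, even
  after multiplication by \<open>1 + U\<close>, is exponentially small compared with the marginal likelihood of
  the true model, and the error of the averaged prediction is of order \<open>sqrt \<epsilon>\<close>.
\<close>

subsection \<open>Positive definite forms and determinants\<close>

text \<open>The marginal likelihoods have no convenient closed form under the hyper-g mixture, so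
  \<open>g\<close> is removed by inequalities. From above, the coefficients keep only their prior
  kernel, whose integral is bounded by a constant free of \<open>g\<close> and \<open>s\<close>;
  what remains of \<open>g\<close> has mass at most 1. From below, \<open>g\<close> is confined to
  \<open>[L, L + 1]\<close> with \<open>L\<close> so large that the prior exponent costs at most
  \<kappa>. Comparing every model with the true one suffices: a model lacking some \<open>j\<close>
  with \<open>\<beta>t j\<close> nonzero has U at least the square of \<open>\<beta>t j\<close>
  throughout, so it lies wholly in the bad region for small \<epsilon>; all other models predict
  nearly the same value near U = 0 and need not be told apart. The weight 1 + U is there because the
  intercept and the coefficients are unbounded: sqrt U is at most 1 + U, so one estimate gives both
  integrability and control of the posterior means. The two bounds carry different powers of the
  variance; the resulting quotient of inverse-gamma integrals is bounded uniformly in n without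
  asymptotics of the Gamma function.\<close>

abbreviation (input) quad :: "nat set \<Rightarrow> (nat \<Rightarrow> nat \<Rightarrow> real) \<Rightarrow> (nat \<Rightarrow> real) \<Rightarrow> real" where
  "quad S M v \<equiv> \<Sum>i\<in>S. \<Sum>j\<in>S. v i * M i j * v j"

lemma quad_extend:
  assumes "finite S" "\<gamma> \<subseteq> S" "\<And>j. j \<in> \<gamma> \<Longrightarrow> w j = v j" "\<And>j. j \<in> S - \<gamma> \<Longrightarrow> w j = 0"
  shows "quad \<gamma> M v = quad S M w"
proof -
  have "quad S M w = (\<Sum>i\<in>\<gamma>. \<Sum>j\<in>S. w i * M i j * w j)"
    by (rule sum.mono_neutral_right) (use assms in auto)
  also have "\<dots> = (\<Sum>i\<in>\<gamma>. \<Sum>j\<in>\<gamma>. w i * M i j * w j)"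
    by (intro sum.cong refl sum.mono_neutral_right) (use assms in auto)
  also have "\<dots> = quad \<gamma> M v" using assms by (intro sum.cong refl) auto
  finally show ?thesis ..
qed

text \<open>Conjugation by an enumeration of \<open>S\<close> preserves signs of permutations. This
  gives access to the kernel-vector criterion for matrices in \<open>det_on_nonzero\<close>.\<close>

lemma det_on_reindex:
  assumes e: "bij_betw e {0..<m} S" and S: "finite S"
  shows "det_on S M = Determinant.det (Matrix.mat m m (\<lambda>(i,j). M (e i) (e j)))"
proof -
  let ?P = "{\<pi>. \<pi> permutes {0..<m}}"
  let ?f = "map_permutation {0..<m} e"
  have inj: "inj_on e {0..<m}" and img: "e ` {0..<m} = S"
    using e by (auto simp: bij_betw_def)
  have b: "bij_betw ?f ?P {\<pi>. \<pi> permutes S}"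
  proof (rule bij_betw_byWitness[where f' = "map_permutation S (inv_into {0..<m} e)"])
    show "\<forall>a\<in>?P. map_permutation S (inv_into {0..<m} e) (?f a) = a"
      using map_permutation_compose_inv[OF e] inj by (auto simp: inv_into_f_f)
    have ie: "bij_betw (inv_into {0..<m} e) S {0..<m}" by (rule bij_betw_inv_into[OF e])
    show "\<forall>a\<in>{\<pi>. \<pi> permutes S}. ?f (map_permutation S (inv_into {0..<m} e) a) = a"
      using map_permutation_compose_inv[OF ie] by (auto simp: f_inv_into_f img)
    show "?f ` ?P \<subseteq> {\<pi>. \<pi> permutes S}" using map_permutation_permutes[OF e] by auto
    show "map_permutation S (inv_into {0..<m} e) ` {\<pi>. \<pi> permutes S} \<subseteq> ?P"
      using map_permutation_permutes[OF ie] by auto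
  qed
  have "det_on S M = (\<Sum>\<pi>\<in>?P. of_int (sign (?f \<pi>)) * (\<Prod>i\<in>S. M i (?f \<pi> i)))"
    unfolding det_on_def by (rule sum.reindex_bij_betw[OF b, symmetric])
  also have "\<dots> = (\<Sum>\<pi>\<in>?P. signof \<pi> * (\<Prod>i = 0..<m. M (e i) (e (\<pi> i))))"
  proof (intro sum.cong refl)
    fix \<pi> assume p: "\<pi> \<in> ?P"
    have s: "sign (?f \<pi>) = sign \<pi>"
      using evenperm_map_permutation[OF inj, of \<pi>] p by (auto simp: sign_def)
    have "(\<Prod>i\<in>S. M i (?f \<pi> i)) = (\<Prod>i\<in>{0..<m}. M (e i) (?f \<pi> (e i)))"
      by (rule prod.reindex_bij_betw[OF e, symmetric])
    also have "\<dots> = (\<Prod>i = 0..<m. M (e i) (e (\<pi> i)))"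
      by (intro prod.cong refl) (simp add: map_permutation_apply[OF inj])
    finally show "of_int (sign (?f \<pi>)) * (\<Prod>i\<in>S. M i (?f \<pi> i))
        = signof \<pi> * (\<Prod>i = 0..<m. M (e i) (e (\<pi> i)))"
      using s by simp
  qed
  also have "\<dots> = Determinant.det (Matrix.mat m m (\<lambda>(i,j). M (e i) (e j)))"
    unfolding det_def
    by (auto intro!: sum.cong prod.cong dest: permutes_in_image)
  finally show ?thesis .
qed

text \<open>A singular matrix has a nonzero kernel vector, and the quadratic form vanishes
  there.\<close>

lemma det_on_nonzero:
  assumes S: "finite S" and pd: "\<And>v. (\<exists>j\<in>S. v j \<noteq> 0) \<Longrightarrow> quad S M v > 0"
  shows "det_on S M \<noteq> 0"
proof
  assume z: "det_on S M = 0"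
  obtain e where e: "bij_betw e {0..<card S} S"
    using ex_bij_betw_nat_finite[OF S] by blast
  let ?m = "card S" and ?A = "Matrix.mat (card S) (card S) (\<lambda>(i,j). M (e i) (e j))"
  have A: "?A \<in> carrier_mat ?m ?m" by auto
  obtain v where v: "v \<in> carrier_vec ?m" "v \<noteq> 0\<^sub>v ?m" "?A *\<^sub>v v = 0\<^sub>v ?m"
    using z det_0_iff_vec_prod_zero_field[OF A] unfolding det_on_reindex[OF e S] by auto
  define w where "w j = vec_index v (inv_into {0..<?m} e j)" for j
  have inj: "inj_on e {0..<?m}" and img: "e ` {0..<?m} = S"
    using e by (auto simp: bij_betw_def)
  have we: "w (e i) = vec_index v i" if "i < ?m" for i
    unfolding w_def using inj that by (simp add: inv_into_f_f)
  have "\<exists>i<?m. vec_index v i \<noteq> 0"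
  proof (rule ccontr)
    assume "\<not> ?thesis"
    then have "v = 0\<^sub>v ?m" using v(1) by (intro eq_vecI) auto
    with v(2) show False by simp
  qed
  then obtain i where i: "i < ?m" "vec_index v i \<noteq> 0" by blast
  have pos: "quad S M w > 0"
    using i we img by (intro pd bexI[of _ "e i"]) auto
  have "(\<Sum>j\<in>S. M (e i) j * w j) = 0" if i: "i < ?m" for i
  proof -
    have "(\<Sum>j\<in>S. M (e i) j * w j) = (\<Sum>j = 0..<?m. M (e i) (e j) * w (e j))"
      by (rule sum.reindex_bij_betw[OF e, symmetric])
    also have "\<dots> = vec_index (?A *\<^sub>v v) i"
      using i v(1) by (simp add: scalar_prod_def we)
    also have "\<dots> = 0" using i by (simp add: v(3))
    finally show ?thesis .
  qed
  moreover have "\<exists>k<?m. i = e k" if "i \<in> S" for i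
  proof -
    from that have "i \<in> e ` {0..<?m}" by (simp only: img)
    then show ?thesis by auto
  qed
  ultimately have "(\<Sum>j\<in>S. M i j * w j) = 0" if "i \<in> S" for i
    using that by blast
  then have "quad S M w = 0"
    by (intro sum.neutral) (simp add: mult.assoc flip: sum_distrib_left)
  with pos show False by simp
qed

lemma det_on_tendsto:
  assumes "\<And>i j. i \<in> S \<Longrightarrow> j \<in> S \<Longrightarrow> ((\<lambda>x. M x i j) \<longlongrightarrow> N i j) F"
  shows "((\<lambda>x. det_on S (M x)) \<longlongrightarrow> det_on S N) F"
  unfolding det_on_def
  by (intro tendsto_sum tendsto_mult tendsto_const tendsto_prod assms) (auto dest: permutes_in_image)

lemma det_on_identity:
  assumes S: "finite S"
  shows "det_on S (\<lambda>i j. if i = j then 1 else 0) = 1"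
proof -
  have "det_on S (\<lambda>i j. if i = j then 1 else 0)
      = (\<Sum>\<pi>\<in>{\<pi>. \<pi> permutes S}. if \<pi> = id then 1 else 0)"
    unfolding det_on_def
  proof (intro sum.cong refl)
    fix \<pi> assume p: "\<pi> \<in> {\<pi>. \<pi> permutes S}"
    show "of_int (sign \<pi>) * (\<Prod>i\<in>S. if i = \<pi> i then 1 else 0) = (if \<pi> = id then 1 else (0::real))"
    proof (cases "\<pi> = id")
      case False
      then obtain i where "\<pi> i \<noteq> i" by (auto simp: fun_eq_iff)
      moreover from this have "i \<in> S" using p by (auto simp: permutes_def)
      ultimately have "(\<Prod>i\<in>S. if i = \<pi> i then 1 else (0::real)) = 0"
        using S by (intro prod_zero) (auto intro!: bexI[of _ i])
      then show ?thesis using False by simp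
    qed (simp add: sign_id)
  qed
  also have "\<dots> = 1"
    using S by (subst sum.delta) (auto simp: permutes_id finite_permutations)
  finally show ?thesis .
qed

text \<open>Positive definite matrices are connected to the identity by a segment of
  positive definite, hence nonsingular, matrices.\<close>
lemma det_on_pos:
  assumes S: "finite S" and pd: "\<And>v. (\<exists>j\<in>S. v j \<noteq> 0) \<Longrightarrow> quad S M v > 0"
  shows "det_on S M > 0"
proof (rule ccontr)
  assume "\<not> det_on S M > 0"
  let ?I = "\<lambda>i j :: nat. if i = j then 1 else (0::real)"
  define N where "N t i j = (1 - t) * ?I i j + t * M i j" for t i j
  have q: "quad S (N t) v = (1 - t) * (\<Sum>i\<in>S. (v i)\<^sup>2) + t * quad S M v" for t v
  proof -
    have "quad S (N t) v = (\<Sum>i\<in>S. \<Sum>j\<in>S. (1 - t) * (if i = j then (v i)\<^sup>2 else 0) + t * (v i * M i j * v j))"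
      unfolding N_def by (intro sum.cong refl) (auto simp: algebra_simps power2_eq_square)
    then show ?thesis
      using S by (simp add: sum.distrib flip: sum_distrib_left)
  qed
  have c: "continuous_on {0..1} (\<lambda>t. det_on S (N t))"
    unfolding det_on_def N_def by (intro continuous_intros)
  have "det_on S (N 0) = 1" unfolding N_def using det_on_identity[OF S] by simp
  moreover have "N 1 = M" unfolding N_def by (simp add: fun_eq_iff)
  ultimately obtain t where t: "0 \<le> t" "t \<le> 1" "det_on S (N t) = 0"
    using IVT2'[of "\<lambda>t. det_on S (N t)" 1 0 0] c \<open>\<not> det_on S M > 0\<close> by auto
  have "quad S (N t) v > 0" if v: "\<exists>j\<in>S. v j \<noteq> 0" for v
  proof -
    have "(\<Sum>i\<in>S. (v i)\<^sup>2) > 0"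
      using v S by (meson sum_pos2 zero_le_power2 zero_less_power2)
    then show ?thesis
      unfolding q using pd[OF v] t
      by (cases "t = 0") (auto intro: add_nonneg_pos)
  qed
  then show False using det_on_nonzero[OF S] t(3) by blast
qed

text \<open>A permutation visits every row and every column once, so each Leibniz term gets the same
  factor. With \<open>r j = sqrt (g (blk j) * s)\<close> this extracts \<open>g\<close> and
  \<open>s\<close> from the prior determinant; with \<open>r\<close> constantly
  \<open>sqrt (real n)\<close> it normalises the Gram matrix.\<close>

lemma det_on_scale:
  assumes S: "finite S"
  shows "det_on S (\<lambda>i j. M i j / (r i * r j)) = det_on S M / (\<Prod>i\<in>S. r i)\<^sup>2"
proof -
  have "(\<Prod>i\<in>S. M i (\<pi> i) / (r i * r (\<pi> i))) = (\<Prod>i\<in>S. M i (\<pi> i)) / (\<Prod>i\<in>S. r i)\<^sup>2"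
    if "\<pi> permutes S" for \<pi>
    using prod.permute[OF that, of r]
    by (simp add: prod_dividef prod.distrib power2_eq_square comp_def)
  then show ?thesis
    unfolding det_on_def sum_divide_distrib by (intro sum.cong refl) simp
qed

lemma det_on_cong:
  "(\<And>i j. i \<in> S \<Longrightarrow> j \<in> S \<Longrightarrow> M i j = N i j) \<Longrightarrow> det_on S M = det_on S N"
  unfolding det_on_def by (intro sum.cong prod.cong refl arg_cong2[where f = "(*)"]) (auto dest: permutes_in_image)

section \<open>Coercivity and perturbation of quadratic forms\<close>

text \<open>Minimum over the unit sphere, then homogeneity. The obstacle is compactness, since
  vectors are functions on all natural numbers.\<close>

lemma posdef_coercive:
  assumes pd: "\<And>v. (\<exists>j<p. v j \<noteq> 0) \<Longrightarrow> quad {..<p} D v > 0"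
  obtains c where "c > 0" "\<And>v. quad {..<p} D v \<ge> c * (\<Sum>j<p. (v j)\<^sup>2)"
proof -
  \<comment> \<open>Coordinates from \<open>p\<close> on are pinned to 0, so this is a product of
    compact sets and Tychonoff applies in the function space.\<close>
  define B where "B = (PiE UNIV (\<lambda>j. if j < p then {-1..1} else {0}) :: (nat \<Rightarrow> real) set)"
  define K where "K = B \<inter> {v. (\<Sum>j<p. (v j)\<^sup>2) = 1}"
  have "compact B"
    using compactin_PiE[of "\<lambda>_. euclidean :: real topology" UNIV "\<lambda>j. if j < p then {-1..1} else {0}"]
    unfolding B_def euclidean_product_topology compactin_euclidean_iff by auto
  moreover have "closed {v::nat \<Rightarrow> real. (\<Sum>j<p. (v j)\<^sup>2) = 1}"
    by (intro closed_Collect_eq continuous_intros continuous_on_product_coordinates)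
  ultimately have K: "compact K" unfolding K_def by (rule compact_Int_closed)
  have cq: "continuous_on K (quad {..<p} D)"
    by (intro continuous_intros continuous_on_subset[OF continuous_on_product_coordinates]) auto
  obtain c where c: "c > 0" "\<And>v. v \<in> K \<Longrightarrow> quad {..<p} D v \<ge> c"
  \<comment> \<open>The sphere is empty when \<open>p = 0\<close>; there is no minimum then and any
    positive constant serves.\<close>
  proof (cases "K = {}")
    case True
    then show ?thesis using that[of 1] by simp
  next
    case False
    obtain v0 where v0: "v0 \<in> K" "\<And>v. v \<in> K \<Longrightarrow> quad {..<p} D v0 \<le> quad {..<p} D v"
      using continuous_attains_inf[OF K False cq] by blast
    have "\<exists>j<p. v0 j \<noteq> 0"
    proof (rule ccontr)
      assume "\<not> ?thesis"
      then have "(\<Sum>j<p. (v0 j)\<^sup>2) = 0" by simp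
      with v0(1) show False by (simp add: K_def)
    qed
    from pd[OF this] v0 that show ?thesis by blast
  qed
  show ?thesis
  proof (rule that[OF c(1)])
    fix v :: "nat \<Rightarrow> real"
    define r where "r = sqrt (\<Sum>j<p. (v j)\<^sup>2)"
    have r2: "r\<^sup>2 = (\<Sum>j<p. (v j)\<^sup>2)" unfolding r_def by (simp add: sum_nonneg)
    show "quad {..<p} D v \<ge> c * (\<Sum>j<p. (v j)\<^sup>2)"
    proof (cases "r = 0")
      case True
      then have "v j = 0" if "j < p" for j
        using r2 that by (simp add: sum_nonneg_eq_0_iff)
      then show ?thesis by simp
    next
      case False
      then have r0: "r > 0" unfolding r_def by (simp add: sum_nonneg order_less_le)
      define w where "w j = (if j < p then v j / r else 0)" for j
      have w1: "(\<Sum>j<p. (w j)\<^sup>2) = 1"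
      proof -
        have "(\<Sum>j<p. (w j)\<^sup>2) = (\<Sum>j<p. (v j)\<^sup>2) / r\<^sup>2"
          unfolding w_def sum_divide_distrib by (intro sum.cong refl) (simp add: power_divide)
        then show ?thesis using r2[symmetric] r0 by (simp only:) simp
      qed
      have "\<bar>w j\<bar> \<le> 1" if "j < p" for j
      proof -
        have "(w j)\<^sup>2 \<le> (\<Sum>j<p. (w j)\<^sup>2)" using that by (intro member_le_sum) auto
        then show ?thesis using w1 abs_square_le_1 by metis
      qed
      then have "w j \<in> {-1..1}" if "j < p" for j using that by (fastforce simp: abs_le_iff)
      moreover have "w j = 0" if "\<not> j < p" for j using that by (simp add: w_def)
      ultimately have "w \<in> K" using w1 by (simp add: K_def B_def PiE_iff)
      then have "c \<le> quad {..<p} D w" by (rule c(2))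
      also have "quad {..<p} D w = quad {..<p} D v / r\<^sup>2"
        unfolding sum_divide_distrib w_def by (intro sum.cong refl) (simp add: power2_eq_square)
      finally show ?thesis using r0 by (simp add: field_simps flip: r2)
    qed
  qed
qed

text \<open>The product of two coordinates is at most the mean of their squares, and each coordinate
  meets \<open>p\<close> others. The crude factor \<open>p\<close> is harmless because the number of
  predictors is fixed.\<close>

lemma quad_diff_bound:
  assumes "\<And>i j. i < p \<Longrightarrow> j < p \<Longrightarrow> \<bar>M i j\<bar> \<le> d"
  shows "\<bar>quad {..<p} M v\<bar> \<le> d * real p * (\<Sum>j<p. (v j)\<^sup>2)"
proof -
  have "\<bar>quad {..<p} M v\<bar> \<le> (\<Sum>i<p. \<Sum>j<p. d * (((v i)\<^sup>2 + (v j)\<^sup>2) / 2))"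
  proof (rule order_trans[OF sum_abs], rule sum_mono, rule order_trans[OF sum_abs], rule sum_mono)
    fix i j assume ij: "i \<in> {..<p}" "j \<in> {..<p}"
    have "\<bar>v i\<bar> * \<bar>v j\<bar> \<le> ((v i)\<^sup>2 + (v j)\<^sup>2) / 2"
      using sum_squares_bound[of "\<bar>v i\<bar>" "\<bar>v j\<bar>"] by simp
    then have "\<bar>M i j\<bar> * (\<bar>v i\<bar> * \<bar>v j\<bar>) \<le> d * (((v i)\<^sup>2 + (v j)\<^sup>2) / 2)"
      using assms[of i j] ij by (intro mult_mono) auto
    then show "\<bar>v i * M i j * v j\<bar> \<le> d * (((v i)\<^sup>2 + (v j)\<^sup>2) / 2)"
      by (simp add: abs_mult mult.commute mult.left_commute)
  qed
  also have "\<dots> = d * real p * (\<Sum>j<p. (v j)\<^sup>2)"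
    by (simp add: sum.distrib add_divide_distrib distrib_left flip: sum_distrib_left sum_divide_distrib)
  finally show ?thesis .
qed

subsection \<open>The noise\<close>

lemma prob_space_data_dist:
  assumes "sig2 > 0" shows "prob_space (data_dist \<mu> sig2 n)"
  unfolding data_dist_def
  by (intro prob_space_PiM prob_space_normal_density) (use assms in simp)

text \<open>Independent centred summands are orthogonal, so the second moment of the weighted sum is
  \<open>V\<close> times the sum of squared weights. The function \<open>h\<close> is left free to
  cover both the linear noise terms (\<open>h x = x\<close>) and the squared noise
  (\<open>h x = x\<^sup>2 - sig2\<close>).\<close>

lemma chebyshev_data_dist:
  fixes f w :: "nat \<Rightarrow> real" and h :: "real \<Rightarrow> real"
  assumes s: "sig2 > 0" and h[measurable]: "h \<in> borel_measurable borel"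
    and int1: "integrable lborel (\<lambda>x. normal_density 0 (sqrt sig2) x * h x)"
    and mean0: "(\<integral>x. normal_density 0 (sqrt sig2) x * h x \<partial>lborel) = 0"
    and int2: "integrable lborel (\<lambda>x. normal_density 0 (sqrt sig2) x * (h x)\<^sup>2)"
    and v: "(\<integral>x. normal_density 0 (sqrt sig2) x * (h x)\<^sup>2 \<partial>lborel) = V"
    and t: "t > 0"
  shows "measure (data_dist \<mu> sig2 n)
      {y \<in> space (data_dist \<mu> sig2 n). \<bar>\<Sum>i<n. w i * h (y i - \<mu> n i)\<bar> \<ge> t} \<le> V * (\<Sum>i<n. (w i)\<^sup>2) / t\<^sup>2"
proof -
  define N where "N i = density lborel (normal_density (\<mu> n i) (sqrt sig2))" for i
  interpret N: prob_space "N i" for i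
    unfolding N_def by (rule prob_space_normal_density) (use s in simp)
  have M: "data_dist \<mu> sig2 n = PiM {..<n} N" unfolding data_dist_def N_def ..
  interpret P: product_prob_space N "{..<n}" ..
  interpret F: finite_product_prob_space N "{..<n}" by standard simp
  let ?M = "PiM {..<n} N"
  have setsN[measurable_cong]: "sets (N i) = sets borel" for i unfolding N_def by simp
  define Y where "Y i y = h (y i - \<mu> n i)" for i and y :: "nat \<Rightarrow> real"
  have Ym[measurable]: "Y i \<in> borel_measurable ?M" if "i < n" for i
  proof -
    have "(\<lambda>y. y i) \<in> measurable ?M (N i)" by (rule measurable_component_singleton) (use that in simp)
    then have [measurable]: "(\<lambda>y. y i) \<in> borel_measurable ?M"
      by (simp add: measurable_cong_sets[OF refl setsN])
    show ?thesis unfolding Y_def by measurable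
  qed
  \<comment> \<open>Centring by the mean makes all coordinates share the law of the noise, so one
    set of moment hypotheses serves every \<open>i\<close>.\<close>
  have shift: "integrable (N i) (\<lambda>x. k (x - \<mu> n i)) \<longleftrightarrow> integrable lborel (\<lambda>x. normal_density 0 (sqrt sig2) x * k x)"
    "(\<integral>x. k (x - \<mu> n i) \<partial>N i) = (\<integral>x. normal_density 0 (sqrt sig2) x * k x \<partial>lborel)"
    if [measurable]: "k \<in> borel_measurable borel" for k :: "real \<Rightarrow> real" and i
  proof -
    have e: "normal_density (\<mu> n i) (sqrt sig2) (\<mu> n i + x) = normal_density 0 (sqrt sig2) x" for x
      by (simp add: normal_density_def)
    show "integrable (N i) (\<lambda>x. k (x - \<mu> n i)) \<longleftrightarrow> integrable lborel (\<lambda>x. normal_density 0 (sqrt sig2) x * k x)"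
      unfolding N_def
      using lborel_integrable_real_affine_iff[of 1 "\<lambda>x. normal_density (\<mu> n i) (sqrt sig2) x * k (x - \<mu> n i)" "\<mu> n i"]
      by (subst integrable_density) (auto simp: e)
    show "(\<integral>x. k (x - \<mu> n i) \<partial>N i) = (\<integral>x. normal_density 0 (sqrt sig2) x * k x \<partial>lborel)"
      unfolding N_def
      using lborel_integral_real_affine[of 1 "\<lambda>x. normal_density (\<mu> n i) (sqrt sig2) x * k (x - \<mu> n i)" "\<mu> n i"]
      by (subst integral_density) (auto simp: e)
  qed
  have Y1: "integrable (N i) (\<lambda>x. h (x - \<mu> n i))" "(\<integral>x. h (x - \<mu> n i) \<partial>N i) = 0" for i
    using shift[of h i] int1 mean0 by auto
  have Y2: "integrable (N i) (\<lambda>x. (h (x - \<mu> n i))\<^sup>2)" "(\<integral>x. (h (x - \<mu> n i))\<^sup>2 \<partial>N i) = V" for i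
    using shift[of "\<lambda>x. (h x)\<^sup>2" i] int2 v by auto
  have comp: "integrable ?M (\<lambda>y. k (y i)) \<longleftrightarrow> integrable (N i) k" "(\<integral>y. k (y i) \<partial>?M) = integral\<^sup>L (N i) k"
    if "i < n" "k \<in> borel_measurable borel" for i and k :: "real \<Rightarrow> real"
  proof -
    have d: "distr ?M (N i) (\<lambda>y. y i) = N i" by (rule P.PiM_component) (use that in simp)
    have m: "(\<lambda>y. y i) \<in> measurable ?M (N i)"
      by (rule measurable_component_singleton) (use that in simp)
    have k: "k \<in> borel_measurable (N i)" using that by (simp add: measurable_cong_sets[OF setsN refl])
    show "integrable ?M (\<lambda>y. k (y i)) \<longleftrightarrow> integrable (N i) k"
      using integrable_distr_eq[OF m k] d by simp
    show "(\<integral>y. k (y i) \<partial>?M) = integral\<^sup>L (N i) k"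
      using integral_distr[OF m k] d by simp
  qed
  have E2: "integrable ?M (\<lambda>y. (Y i y)\<^sup>2)" "(\<integral>y. (Y i y)\<^sup>2 \<partial>?M) = V" if "i < n" for i
    unfolding Y_def using comp[OF that, of "\<lambda>x. (h (x - \<mu> n i))\<^sup>2"] Y2[of i] by auto
  have E11: "integrable ?M (\<lambda>y. Y i y * Y j y) \<and> (\<integral>y. Y i y * Y j y \<partial>?M) = 0"
    if ij: "i < n" "j < n" "i \<noteq> j" for i j
  proof -
    \<comment> \<open>The mixed product is written as a product over all coordinates, with 1 off
      \<open>i\<close> and \<open>j\<close>, so that the integral factorises; the factor for
      \<open>i\<close> is a mean and vanishes.\<close>
    define k where "k l x = (if l = i \<or> l = j then h (x - \<mu> n l) else 1)" for l x
    have ik: "integrable (N l) (k l)" for l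
      using Y1(1)[of l] unfolding k_def by (cases "l = i \<or> l = j") auto
    have pr: "(\<Prod>l<n. k l (y l)) = Y i y * Y j y" for y
    proof -
      have "(\<Prod>l<n. k l (y l)) = (\<Prod>l\<in>{i,j}. k l (y l))"
        by (rule prod.mono_neutral_right) (use ij in \<open>auto simp: k_def\<close>)
      then show ?thesis using ij by (simp add: k_def Y_def)
    qed
    have "integrable ?M (\<lambda>y. \<Prod>l<n. k l (y l))"
      by (rule P.product_integrable_prod) (use ik in auto)
    moreover have "(\<integral>y. (\<Prod>l<n. k l (y l)) \<partial>?M) = (\<Prod>l<n. integral\<^sup>L (N l) (k l))"
      by (rule P.product_integral_prod) (use ik in auto)
    moreover have "k i = (\<lambda>x. h (x - \<mu> n i))" by (auto simp: k_def)
    then have "(\<Prod>l<n. integral\<^sup>L (N l) (k l)) = 0"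
      using ij Y1(2)[of i] by (intro prod_zero) (auto intro!: bexI[of _ i])
    ultimately show ?thesis unfolding pr by simp
  qed
  define S where "S y = (\<Sum>i<n. w i * Y i y)" for y
  have Sm[measurable]: "S \<in> borel_measurable ?M" unfolding S_def by measurable
  have S2: "(S y)\<^sup>2 = (\<Sum>i<n. \<Sum>j<n. w i * w j * (Y i y * Y j y))" for y
    unfolding S_def power2_eq_square sum_product by (intro sum.cong refl) simp
  have prod_int: "integrable ?M (\<lambda>y. w i * w j * (Y i y * Y j y))" if "i < n" "j < n" for i j
    using E11[OF that] E2(1)[OF that(1)] by (cases "i = j") (auto simp: power2_eq_square)
  have iS: "integrable ?M (\<lambda>y. (S y)\<^sup>2)"
    unfolding S2 by (intro Bochner_Integration.integrable_sum prod_int) auto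
  have "(\<integral>y. (S y)\<^sup>2 \<partial>?M) = (\<Sum>i<n. \<Sum>j<n. w i * w j * (\<integral>y. Y i y * Y j y \<partial>?M))"
    unfolding S2
    by (subst Bochner_Integration.integral_sum, intro Bochner_Integration.integrable_sum prod_int, simp, simp,
        intro sum.cong refl, subst Bochner_Integration.integral_sum, intro prod_int, simp, simp, simp)
  also have "\<dots> = (\<Sum>i<n. \<Sum>j<n. if j = i then V * (w i)\<^sup>2 else 0)"
    using E11 E2(2) by (intro sum.cong refl) (auto simp: power2_eq_square)
  also have "\<dots> = V * (\<Sum>i<n. (w i)\<^sup>2)"
    by (simp add: sum_distrib_left)
  finally have ES: "(\<integral>y. (S y)\<^sup>2 \<partial>?M) = V * (\<Sum>i<n. (w i)\<^sup>2)" .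
  have "measure ?M {y \<in> space ?M. t \<le> \<bar>S y\<bar>} = measure ?M {y \<in> space ?M. t\<^sup>2 \<le> (S y)\<^sup>2}"
    using t by (intro arg_cong[where f = "measure ?M"] Collect_cong) (auto simp: abs_le_square_iff[symmetric])
  also have "\<dots> \<le> (\<integral>y. (S y)\<^sup>2 \<partial>?M) / t\<^sup>2"
    by (rule integral_Markov_inequality_measure[where A = "{}"]) (use iS t in auto)
  finally show ?thesis unfolding ES unfolding M S_def Y_def .
qed

text \<open>The factors \<open>1/2\<close> and \<open>2\<close> are arbitrary constants below and above \<open>1\<close>.\<close>
definition noise_event ::
    "nat \<Rightarrow> (nat \<Rightarrow> nat \<Rightarrow> nat \<Rightarrow> real) \<Rightarrow> real \<Rightarrow> real \<Rightarrow> nat \<Rightarrow> (nat \<Rightarrow> real) \<Rightarrow> bool" where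
  "noise_event p X sig2 \<eta> n e \<longleftrightarrow>
     \<bar>\<Sum>i<n. e i\<bar> \<le> \<eta> * real n \<and> (\<forall>j<p. \<bar>\<Sum>i<n. X n i j * e i\<bar> \<le> \<eta> * real n) \<and>
     sig2 / 2 * real n \<le> (\<Sum>i<n. (e i)\<^sup>2) \<and> (\<Sum>i<n. (e i)\<^sup>2) \<le> 2 * sig2 * real n"

text \<open>The inputs of \<open>chebyshev_data_dist\<close> for \<open>h x = x\<close> and
  \<open>h x = x\<^sup>2 - sig2\<close>. The last variance enters only through its
  finiteness.\<close>

lemma normal_density_moments:
  assumes "sig2 > 0"
  defines "\<phi> \<equiv> normal_density 0 (sqrt sig2)"
  shows "integrable lborel (\<lambda>x. \<phi> x * x)" "(\<integral>x. \<phi> x * x \<partial>lborel) = 0"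
    "integrable lborel (\<lambda>x. \<phi> x * x\<^sup>2)" "(\<integral>x. \<phi> x * x\<^sup>2 \<partial>lborel) = sig2"
    "integrable lborel (\<lambda>x. \<phi> x * (x\<^sup>2 - sig2))" "(\<integral>x. \<phi> x * (x\<^sup>2 - sig2) \<partial>lborel) = 0"
    "integrable lborel (\<lambda>x. \<phi> x * (x\<^sup>2 - sig2)\<^sup>2)"
proof -
  have i: "integrable lborel (\<lambda>x. \<phi> x * x ^ k)" for k
    unfolding \<phi>_def using integrable_normal_moment[of "sqrt sig2" 0 k] assms by simp
  show 1: "integrable lborel (\<lambda>x. \<phi> x * x)" using i[of 1] by simp
  show "(\<integral>x. \<phi> x * x \<partial>lborel) = 0"
    using integral_normal_moment_nz_1[of "sqrt sig2" 0] assms by simp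
  show 2: "integrable lborel (\<lambda>x. \<phi> x * x\<^sup>2)" by (rule i)
  show 3: "(\<integral>x. \<phi> x * x\<^sup>2 \<partial>lborel) = sig2"
    using integral_normal_moment_even[of "sqrt sig2" 0 1] assms by simp
  have 0: "integrable lborel \<phi>" "(\<integral>x. \<phi> x \<partial>lborel) = 1" unfolding \<phi>_def using assms by simp_all
  have e: "\<phi> x * (x\<^sup>2 - sig2) = \<phi> x * x\<^sup>2 - sig2 * \<phi> x" for x by (simp add: algebra_simps)
  show "integrable lborel (\<lambda>x. \<phi> x * (x\<^sup>2 - sig2))" "(\<integral>x. \<phi> x * (x\<^sup>2 - sig2) \<partial>lborel) = 0"
    unfolding e using 0 2 3 by simp_all
  have e2: "\<phi> x * (x\<^sup>2 - sig2)\<^sup>2 = \<phi> x * x ^ 4 - 2 * sig2 * (\<phi> x * x\<^sup>2) + sig2\<^sup>2 * \<phi> x" for x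
    by (simp add: algebra_simps power2_eq_square power4_eq_xxxx)
  show "integrable lborel (\<lambda>x. \<phi> x * (x\<^sup>2 - sig2)\<^sup>2)"
    unfolding e2 by (intro Bochner_Integration.integrable_add Bochner_Integration.integrable_diff
      integrable_mult_right 0 i)
qed

text \<open>The covering set \<open>A\<close> has the shape demanded by \<open>conv_in_prob\<close>,
  so measurability of the averaged prediction never has to be discussed.\<close>

lemma noise_event_complement:
  assumes s: "sig2 > 0" and \<eta>: "\<eta> > 0" and \<delta>: "\<delta> > 0"
    and lim: "\<And>j. j < p \<Longrightarrow> (\<lambda>n. gram X n j j / real n) \<longlonglongrightarrow> D j j"
  shows "eventually (\<lambda>n. \<exists>A\<in>sets (data_dist \<mu> sig2 n).
      {y \<in> space (data_dist \<mu> sig2 n). \<not> noise_event p X sig2 \<eta> n (\<lambda>i. y i - \<mu> n i)} \<subseteq> A \<and>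
      measure (data_dist \<mu> sig2 n) A < \<delta>) sequentially"
proof -
  let ?\<phi> = "normal_density 0 (sqrt sig2)"
  define V where "V = (\<integral>x. ?\<phi> x * (x\<^sup>2 - sig2)\<^sup>2 \<partial>lborel)"
  note mom = normal_density_moments[OF s]
  have inv: "(\<lambda>n. 1 / real n) \<longlonglongrightarrow> 0" by (rule lim_1_over_n)
  \<comment> \<open>Union bound over \<open>p + 2\<close> exceptional events. Every summand is 1/n
    times a bounded factor, because \<open>gram X n j j / real n\<close> converges.\<close>
  define b where "b n = sig2 * real n / (\<eta> * real n)\<^sup>2 + (\<Sum>j<p. sig2 * gram X n j j / (\<eta> * real n)\<^sup>2)
      + V * real n / (sig2 / 2 * real n)\<^sup>2" for n
  have "b \<longlonglongrightarrow> sig2 / \<eta>\<^sup>2 * 0 + (\<Sum>j<p. sig2 / \<eta>\<^sup>2 * (D j j * 0)) + V / (sig2 / 2)\<^sup>2 * 0"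
  proof (rule Lim_transform_eventually)
    show "(\<lambda>n. sig2 / \<eta>\<^sup>2 * (1 / real n) + (\<Sum>j<p. sig2 / \<eta>\<^sup>2 * ((gram X n j j / real n) * (1 / real n)))
       + V / (sig2 / 2)\<^sup>2 * (1 / real n)) \<longlonglongrightarrow> sig2 / \<eta>\<^sup>2 * 0 + (\<Sum>j<p. sig2 / \<eta>\<^sup>2 * (D j j * 0)) + V / (sig2 / 2)\<^sup>2 * 0"
      by (intro tendsto_intros inv lim) simp
    show "\<forall>\<^sub>F n in sequentially. sig2 / \<eta>\<^sup>2 * (1 / real n)
       + (\<Sum>j<p. sig2 / \<eta>\<^sup>2 * ((gram X n j j / real n) * (1 / real n))) + V / (sig2 / 2)\<^sup>2 * (1 / real n) = b n"
      using eventually_gt_at_top[of 0]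
      by eventually_elim (simp add: b_def power2_eq_square mult_ac)
  qed
  then have "eventually (\<lambda>n. b n < \<delta>) sequentially"
    using \<delta> by (intro order_tendstoD(2)) auto
  then show ?thesis using eventually_gt_at_top[of 0]
  proof eventually_elim
    case (elim n)
    let ?M = "data_dist \<mu> sig2 n"
    interpret M: prob_space ?M by (rule prob_space_data_dist[OF s])
    have [measurable]: "(\<lambda>y. y i) \<in> borel_measurable ?M" if "i < n" for i
      using measurable_component_singleton[of i "{..<n}" "\<lambda>i. density lborel (normal_density (\<mu> n i) (sqrt sig2))"] that
      unfolding data_dist_def by simp
    define B where "B t w h = {y \<in> space ?M. \<bar>\<Sum>i<n. w i * h (y i - \<mu> n i)\<bar> \<ge> t}"
      for t and w :: "nat \<Rightarrow> real" and h :: "real \<Rightarrow> real"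
    have Bs: "B t w h \<in> sets ?M" if [measurable]: "h \<in> borel_measurable borel" for t w h
      unfolding B_def by measurable
    let ?t = "\<eta> * real n"
    let ?Ac = "B ?t (\<lambda>_. 1) (\<lambda>x. x)" and ?Ax = "\<lambda>j. B ?t (\<lambda>i. X n i j) (\<lambda>x. x)"
      and ?Aq = "B (sig2 / 2 * real n) (\<lambda>_. 1) (\<lambda>x. x\<^sup>2 - sig2)"
    let ?A = "?Ac \<union> (\<Union>j<p. ?Ax j) \<union> ?Aq"
    have tp: "?t > 0" "sig2 / 2 * real n > 0" using \<eta> s elim by auto
    have m0: "measure ?M ?Ac \<le> sig2 * real n / ?t\<^sup>2"
      using chebyshev_data_dist[OF s _ mom(1-4) tp(1), of \<mu> n "\<lambda>_. 1"] unfolding B_def by simp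
    have m1: "measure ?M (?Ax j) \<le> sig2 * gram X n j j / ?t\<^sup>2" for j
      using chebyshev_data_dist[OF s _ mom(1-4) tp(1), of \<mu> n "\<lambda>i. X n i j"]
      unfolding B_def gram_def by (simp add: power2_eq_square)
    have m2: "measure ?M ?Aq \<le> V * real n / (sig2 / 2 * real n)\<^sup>2"
      using chebyshev_data_dist[OF s _ mom(5-7) V_def[symmetric] tp(2), of \<mu> n "\<lambda>_. 1"]
      unfolding B_def by simp
    have "measure ?M ?A \<le> measure ?M (?Ac \<union> (\<Union>j<p. ?Ax j)) + measure ?M ?Aq"
      by (intro measure_Un_le sets.Un sets.finite_UN Bs) auto
    also have "measure ?M (?Ac \<union> (\<Union>j<p. ?Ax j)) \<le> measure ?M ?Ac + measure ?M (\<Union>j<p. ?Ax j)"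
      by (intro measure_Un_le sets.finite_UN Bs) auto
    also have "measure ?M (\<Union>j<p. ?Ax j) \<le> (\<Sum>j<p. measure ?M (?Ax j))"
      by (intro measure_UNION_le Bs) auto
    also have "measure ?M ?Ac + (\<Sum>j<p. measure ?M (?Ax j)) + measure ?M ?Aq \<le> b n"
      unfolding b_def by (intro add_mono sum_mono m0 m1 m2)
    finally have "measure ?M ?A < \<delta>" using elim by simp
    moreover have "?A \<in> sets ?M" by (intro sets.Un sets.finite_UN Bs) auto
    moreover have "{y \<in> space ?M. \<not> noise_event p X sig2 \<eta> n (\<lambda>i. y i - \<mu> n i)} \<subseteq> ?A"
    proof
      fix y assume y: "y \<in> {y \<in> space ?M. \<not> noise_event p X sig2 \<eta> n (\<lambda>i. y i - \<mu> n i)}"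
      show "y \<in> ?A"
      proof (rule ccontr)
        assume n: "y \<notin> ?A"
        then have b: "\<bar>\<Sum>i<n. y i - \<mu> n i\<bar> < ?t" "\<And>j. j < p \<Longrightarrow> \<bar>\<Sum>i<n. X n i j * (y i - \<mu> n i)\<bar> < ?t"
          and d: "\<bar>\<Sum>i<n. (y i - \<mu> n i)\<^sup>2 - sig2\<bar> < sig2 / 2 * real n"
          using y unfolding B_def by (auto simp: not_le)
        have "(\<Sum>i<n. (y i - \<mu> n i)\<^sup>2 - sig2) = (\<Sum>i<n. (y i - \<mu> n i)\<^sup>2) - sig2 * real n"
          by (simp add: sum_subtractf)
        with d have "\<bar>(\<Sum>i<n. (y i - \<mu> n i)\<^sup>2) - sig2 * real n\<bar> < sig2 / 2 * real n" by simp
        moreover have "0 \<le> sig2 * real n" using s by simp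
        ultimately have "sig2 / 2 * real n \<le> (\<Sum>i<n. (y i - \<mu> n i)\<^sup>2)"
          "(\<Sum>i<n. (y i - \<mu> n i)\<^sup>2) \<le> 2 * sig2 * real n" by linarith+
        then have "noise_event p X sig2 \<eta> n (\<lambda>i. y i - \<mu> n i)"
          using b unfolding noise_event_def by (auto intro: less_imp_le)
        with y show False by simp
      qed
    qed
    ultimately show ?case by blast
  qed
qed

subsection \<open>Integrals over the parameter space\<close>

text \<open>For positive \<open>m\<close> and \<open>V\<close> this is Gamma(m) times (2 / V) to the
  power m, the normalising constant of an inverse-gamma density with shape \<open>m\<close> and
  scale \<open>V / 2\<close>. Values in \<open>ennreal\<close> allow it to be manipulated before
  finiteness is known.\<close>

definition inv_gamma_int :: "real \<Rightarrow> real \<Rightarrow> ennreal" where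
  "inv_gamma_int m V = (\<integral>\<^sup>+s. ennreal (indicator {0<..} s * (s powr (-m-1) * exp (- V / (2 * s)))) \<partial>lborel)"

text \<open>Substitution of \<open>V * s\<close> for \<open>s\<close>. This step turns a bound on
  the residual sum of squares into a power of that bound.\<close>

lemma inv_gamma_int_scale:
  assumes V: "V > 0"
  shows "inv_gamma_int m V = ennreal (V powr (-m)) * inv_gamma_int m 1"
proof -
  let ?f = "\<lambda>s. ennreal (indicator {0<..} s * (s powr (-m-1) * exp (- V / (2 * s))))"
  have "inv_gamma_int m V = ennreal \<bar>V\<bar> * (\<integral>\<^sup>+s. ?f (0 + V * s) \<partial>lborel)"
    unfolding inv_gamma_int_def by (rule nn_integral_real_affine) (use V in auto)
  also have "\<dots> = ennreal V * (\<integral>\<^sup>+s. ennreal (V powr (-m-1)) * ennreal (indicator {0<..} s * (s powr (-m-1) * exp (- 1 / (2 * s)))) \<partial>lborel)"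
    using V
    by (intro arg_cong2[where f = "(*)"] nn_integral_cong)
       (auto simp: indicator_def zero_less_mult_iff powr_mult mult.assoc simp flip: ennreal_mult)
  also have "\<dots> = ennreal (V * V powr (-m-1)) * inv_gamma_int m 1"
    using V unfolding inv_gamma_int_def
    by (subst nn_integral_cmult) (auto simp: ennreal_mult mult.assoc)
  also have "V * V powr (-m-1) = V powr (-m)"
    using V powr_add[of V 1 "-m-1"] by simp
  finally show ?thesis .
qed

lemma nn_integral_inv_square: "(\<integral>\<^sup>+s. ennreal (1 / s\<^sup>2) * indicator {1..} s \<partial>lborel) = 1"
proof -
  have "(\<integral>\<^sup>+s. ennreal (1 / s\<^sup>2) * indicator {1..} s \<partial>lborel) = ennreal (0 - (- 1 / 1))"
  proof (rule nn_integral_FTC_atLeast[where F = "\<lambda>x. - 1 / x" and T = 0])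
    show "((\<lambda>x::real. - 1 / x) \<longlongrightarrow> 0) at_top"
      by (intro tendsto_divide_0[OF tendsto_const] filterlim_at_top_imp_at_infinity filterlim_ident)
    show "((\<lambda>x. - 1 / x) has_real_derivative 1 / x\<^sup>2) (at x)" if "1 \<le> x" for x :: real
      using that by (auto intro!: derivative_eq_intros simp: power2_eq_square field_simps)
  qed auto
  then show ?thesis by simp
qed

text \<open>On \<open>[1/2, 1]\<close> the power of \<open>s\<close> is at least 1 and the exponent
  at least -1. What matters is that the bound does not depend on \<open>m\<close>.\<close>

lemma inv_gamma_int_ge: "ennreal (exp (-1) / 2) \<le> inv_gamma_int m 1" if "m \<ge> 1"
proof -
  have "ennreal (exp (-1) / 2) = ennreal (exp (-1)) * ennreal (1 - 1/2)"
    by (subst ennreal_mult[symmetric]) auto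
  also have "\<dots> = (\<integral>\<^sup>+s. ennreal (exp (-1)) * indicator {1/2..1::real} s \<partial>lborel)"
    by (subst nn_integral_cmult_indicator) (auto simp del: ennreal_half)
  also have "\<dots> \<le> inv_gamma_int m 1"
    unfolding inv_gamma_int_def
  proof (rule nn_integral_mono)
    fix s :: real
    show "ennreal (exp (-1)) * indicator {1/2..1} s
        \<le> ennreal (indicator {0<..} s * (s powr (-m-1) * exp (- 1 / (2 * s))))"
    proof (cases "s \<in> {1/2..1}")
      case True
      have "1 * exp (-1) \<le> s powr (-m-1) * exp (- 1 / (2 * s))"
        using True that powr_mono'[of "-m-1" 0 s] by (intro mult_mono) (auto simp: field_simps)
      then show ?thesis using True by (auto intro!: ennreal_leI)
    qed auto
  qed
  finally show ?thesis .
qed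

text \<open>Beyond 1 the integrand is below \<open>1 / s\<^sup>2\<close> for every
  \<open>m \<ge> 1\<close>, so the tail contributes at most 1 whatever the shape; only
  \<open>(0, 1]\<close> depends on \<open>m\<close>.\<close>

lemma inv_gamma_int_split:
  assumes "m \<ge> 1" and b: "\<And>s. 0 < s \<Longrightarrow> s \<le> 1 \<Longrightarrow> ennreal (s powr (-m-1) * exp (- 1 / (2 * s))) \<le> f s"
    and [measurable]: "f \<in> borel_measurable borel"
  shows "inv_gamma_int m 1 \<le> (\<integral>\<^sup>+s. f s * indicator {0<..1} s \<partial>lborel) + 1"
proof -
  have "inv_gamma_int m 1 \<le> (\<integral>\<^sup>+s. f s * indicator {0<..1} s + ennreal (1 / s\<^sup>2) * indicator {1..} s \<partial>lborel)"
    unfolding inv_gamma_int_def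
  proof (rule nn_integral_mono)
    fix s :: real
    consider "s \<le> 0" | "0 < s" "s \<le> 1" | "s > 1" by linarith
    then show "ennreal (indicator {0<..} s * (s powr (-m-1) * exp (- 1 / (2 * s))))
        \<le> f s * indicator {0<..1} s + ennreal (1 / s\<^sup>2) * indicator {1..} s"
    proof cases
      case 2
      then show ?thesis using b[of s] by (auto intro: add_increasing2)
    next
      case 3
      have "s powr (-m-1) * exp (- 1 / (2 * s)) \<le> s powr (-2) * 1"
        using 3 assms(1) by (intro mult_mono powr_mono) auto
      also have "\<dots> = 1 / s\<^sup>2" using 3 by (simp add: powr_minus_divide)
      finally show ?thesis using 3 by (auto intro!: ennreal_leI)
    qed auto
  qed
  also have "\<dots> = (\<integral>\<^sup>+s. f s * indicator {0<..1} s \<partial>lborel) + 1"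
    by (subst nn_integral_add) (auto simp: nn_integral_inv_square)
  finally show ?thesis .
qed

lemma power_le_fact_exp: "(x::real) ^ n \<le> fact n * exp x" if "x \<ge> 0"
proof -
  have "x ^ n / fact n = (\<Sum>k\<in>{n}. x ^ k /\<^sub>R fact k)" by (simp add: field_simps)
  also have "\<dots> \<le> (\<Sum>k. x ^ k /\<^sub>R fact k)"
    by (rule sum_le_suminf[OF summable_exp_generic]) (use that in auto)
  also have "\<dots> = exp x" by (simp add: exp_def)
  finally show ?thesis by (simp add: field_simps)
qed

lemma inv_gamma_int_finite: "inv_gamma_int m 1 < \<infinity>" if "m \<ge> 1"
proof -
  \<comment> \<open>As \<open>1 / s \<ge> 1\<close>, the exponent may be rounded up to an integer; a
    single term of the exponential series then dominates the power near 0.\<close>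
  define N where "N = nat \<lceil>m + 1\<rceil>"
  have "inv_gamma_int m 1 \<le> (\<integral>\<^sup>+s. ennreal (2 ^ N * fact N) * indicator {0<..1::real} s \<partial>lborel) + 1"
  proof (rule inv_gamma_int_split[OF that])
    fix s :: real assume s: "0 < s" "s \<le> 1"
    have "s powr (-m-1) = (1 / s) powr (m + 1)"
      using s by (simp add: powr_divide powr_minus_divide[symmetric])
    also have "\<dots> \<le> (1 / s) powr real N"
      using s unfolding N_def by (intro powr_mono real_nat_ceiling_ge) auto
    also have "\<dots> = 2 ^ N * (1 / (2 * s)) ^ N"
      using s by (simp add: powr_realpow power_divide power_mult_distrib)
    also have "\<dots> \<le> 2 ^ N * (fact N * exp (1 / (2 * s)))"
      using s by (intro mult_left_mono power_le_fact_exp) auto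
    finally have "s powr (-m-1) * exp (- 1 / (2 * s)) \<le> 2 ^ N * (fact N * exp (1 / (2 * s))) * exp (- 1 / (2 * s))"
      by (intro mult_right_mono) auto
    also have "\<dots> = 2 ^ N * fact N" by (simp add: exp_minus field_simps)
    finally show "ennreal (s powr (-m-1) * exp (- 1 / (2 * s))) \<le> ennreal (2 ^ N * fact N)"
      by (rule ennreal_leI)
  qed auto
  also have "\<dots> < \<infinity>"
    by (subst nn_integral_cmult_indicator) (auto simp flip: ennreal_mult ennreal_1 ennreal_plus)
  finally show ?thesis .
qed

text \<open>Replaces asymptotics of Gamma quotients. The upper bounds lead to shapes
  \<open>(n - 1) / 2\<close> and \<open>(n - 3) / 2\<close>, the lower bound to
  \<open>(n + card T) / 2\<close>; on \<open>(0, 1]\<close> the integrand increases with the shape,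
  and the tail is absorbed by the uniform lower bound.\<close>

lemma inv_gamma_int_mono:
  assumes "1 \<le> m" "m \<le> m'"
  shows "inv_gamma_int m 1 \<le> ennreal (1 + 2 * exp 1) * inv_gamma_int m' 1"
proof -
  let ?f = "\<lambda>s. ennreal (indicator {0<..} s * (s powr (-m'-1) * exp (- 1 / (2 * s))))"
  have "inv_gamma_int m 1 \<le> (\<integral>\<^sup>+s. ?f s * indicator {0<..1} s \<partial>lborel) + 1"
  proof (rule inv_gamma_int_split[OF assms(1)])
    fix s :: real assume s: "0 < s" "s \<le> 1"
    then show "ennreal (s powr (-m-1) * exp (- 1 / (2 * s))) \<le> ?f s"
      using assms by (auto intro!: ennreal_leI mult_right_mono powr_mono')
  qed auto
  also have "\<dots> \<le> inv_gamma_int m' 1 + ennreal (2 * exp 1) * inv_gamma_int m' 1"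
  proof (rule add_mono)
    show "(\<integral>\<^sup>+s. ?f s * indicator {0<..1} s \<partial>lborel) \<le> inv_gamma_int m' 1"
      unfolding inv_gamma_int_def by (intro nn_integral_mono) (auto simp: indicator_def)
    \<comment> \<open>The tail mass 1 is written as a multiple of the lower bound from
      \<open>inv_gamma_int_ge\<close>; hence the constant \<open>1 + 2 * exp 1\<close>.\<close>
    have "(1::ennreal) = ennreal (2 * exp 1) * ennreal (exp (-1) / 2)"
      by (simp add: exp_minus flip: ennreal_mult)
    also have "\<dots> \<le> ennreal (2 * exp 1) * inv_gamma_int m' 1"
      using assms by (intro mult_left_mono inv_gamma_int_ge) auto
    finally show "1 \<le> ennreal (2 * exp 1) * inv_gamma_int m' 1" .
  qed
  also have "\<dots> = ennreal (1 + 2 * exp 1) * inv_gamma_int m' 1"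
    by (subst ennreal_plus) (auto simp: distrib_right)
  finally show ?thesis .
qed

section \<open>Integrating out the coefficients, the scales g and the intercept\<close>

lemma nn_integral_hyperg_le: "(\<integral>\<^sup>+g. ennreal (hyperg_density a g) \<partial>lborel) \<le> 1" if "a > 2"
proof -
  let ?F = "\<lambda>x. - ((1 + x) powr (1 - a / 2))"
  have "(\<integral>\<^sup>+g. ennreal (hyperg_density a g) \<partial>lborel)
      \<le> (\<integral>\<^sup>+g. ennreal ((a - 2) / 2 * (1 + g) powr (- a / 2)) * indicator {0..} g \<partial>lborel)"
    using that by (intro nn_integral_mono) (auto simp: hyperg_density_def indicator_def)
  also have "\<dots> = ennreal (0 - ?F 0)"
  proof (rule nn_integral_FTC_atLeast[where F = ?F and T = 0])
    show "(?F has_real_derivative (a - 2) / 2 * (1 + x) powr (- a / 2)) (at x)" if "0 \<le> x" for x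
      using that by (auto intro!: derivative_eq_intros simp: field_simps)
    have "((\<lambda>x. (1 + x) powr (- (a / 2 - 1))) \<longlongrightarrow> 0) at_top"
      by (rule tendsto_neg_powr) (use \<open>a > 2\<close> in \<open>auto intro!: filterlim_tendsto_add_at_top filterlim_ident\<close>)
    then show "(?F \<longlongrightarrow> 0) at_top" using tendsto_minus by fastforce
  qed (use that in auto)
  finally show ?thesis by simp
qed

lemma nn_integral_gauss:
  assumes "v > 0"
  shows "(\<integral>\<^sup>+x. ennreal (exp (- (x - \<mu>)\<^sup>2 / (2 * v))) \<partial>lborel) = ennreal (sqrt (2 * pi * v))"
proof -
  have e: "exp (- (x - \<mu>)\<^sup>2 / (2 * v)) = sqrt (2 * pi * v) * normal_density \<mu> (sqrt v) x" for x
    using assms by (simp add: normal_density_def)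
  have "(\<integral>\<^sup>+x. ennreal (normal_density \<mu> (sqrt v) x) \<partial>lborel) = 1"
    using assms by (subst nn_integral_eq_integral) auto
  then show ?thesis
    unfolding e using assms by (simp add: ennreal_mult nn_integral_cmult)
qed

lemma finite_model_blocks [simp]: "finite (model_blocks k blk \<gamma>)"
  unfolding model_blocks_def by simp

lemma measurable_param_space:
  shows measurable_param_alpha: "fst \<in> borel_measurable (param_space k blk \<gamma>)"
    and measurable_param_s: "(\<lambda>\<theta>. fst (snd \<theta>)) \<in> borel_measurable (param_space k blk \<gamma>)"
    and measurable_param_beta: "j \<in> \<gamma> \<Longrightarrow> (\<lambda>\<theta>. fst (snd (snd \<theta>)) j) \<in> borel_measurable (param_space k blk \<gamma>)"
    and measurable_param_g: "b \<in> model_blocks k blk \<gamma> \<Longrightarrow>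
      (\<lambda>\<theta>. snd (snd (snd \<theta>)) b) \<in> borel_measurable (param_space k blk \<gamma>)"
proof -
  show "fst \<in> borel_measurable (param_space k blk \<gamma>)"
    "(\<lambda>\<theta>. fst (snd \<theta>)) \<in> borel_measurable (param_space k blk \<gamma>)"
    unfolding param_space_def by (auto simp: measurable_lborel1[symmetric] simp del: measurable_lborel1)
  have 1: "(\<lambda>\<theta>. fst (snd (snd \<theta>))) \<in> measurable (param_space k blk \<gamma>) (PiM \<gamma> (\<lambda>_. lborel))"
    "(\<lambda>\<theta>. snd (snd (snd \<theta>))) \<in> measurable (param_space k blk \<gamma>) (PiM (model_blocks k blk \<gamma>) (\<lambda>_. lborel))"
    unfolding param_space_def by measurable
  show "(\<lambda>\<theta>. fst (snd (snd \<theta>)) j) \<in> borel_measurable (param_space k blk \<gamma>)" if "j \<in> \<gamma>"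
    using measurable_compose[OF 1(1) measurable_component_singleton[OF that]] by simp
  show "(\<lambda>\<theta>. snd (snd (snd \<theta>)) b) \<in> borel_measurable (param_space k blk \<gamma>)"
    if "b \<in> model_blocks k blk \<gamma>"
    using measurable_compose[OF 1(2) measurable_component_singleton[OF that]] by simp
qed

text \<open>The coefficients are placed inside \<open>g\<close>, opposite to their order in
  \<open>param_space\<close>, because their conditional prior has to be integrated out for fixed
  \<open>g\<close>.\<close>

lemma nn_integral_param_space:
  assumes \<gamma>: "finite \<gamma>" and f: "f \<in> borel_measurable (param_space k blk \<gamma>)"
  shows "(\<integral>\<^sup>+\<theta>. f \<theta> \<partial>param_space k blk \<gamma>) =
    (\<integral>\<^sup>+\<alpha>. \<integral>\<^sup>+s. \<integral>\<^sup>+g. \<integral>\<^sup>+\<beta>. f (\<alpha>, s, \<beta>, g) \<partial>PiM \<gamma> (\<lambda>_. lborel)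
      \<partial>PiM (model_blocks k blk \<gamma>) (\<lambda>_. lborel) \<partial>lborel \<partial>lborel)"
proof -
  let ?PG = "PiM \<gamma> (\<lambda>_. lborel :: real measure)"
  let ?PB = "PiM (model_blocks k blk \<gamma>) (\<lambda>_. lborel :: real measure)"
  interpret P: product_sigma_finite "\<lambda>_::nat. lborel :: real measure" ..
  interpret G: sigma_finite_measure ?PG using \<gamma> by (rule P.sigma_finite)
  interpret B: sigma_finite_measure ?PB by (rule P.sigma_finite) simp
  interpret GB: pair_sigma_finite ?PG ?PB ..
  interpret L: pair_sigma_finite "lborel :: real measure" "?PG \<Otimes>\<^sub>M ?PB" ..
  have sf: "sigma_finite_measure ((lborel :: real measure) \<Otimes>\<^sub>M (?PG \<Otimes>\<^sub>M ?PB))"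
    "sigma_finite_measure (?PG \<Otimes>\<^sub>M ?PB)" by unfold_locales
  have m: "f \<in> borel_measurable (lborel \<Otimes>\<^sub>M (lborel \<Otimes>\<^sub>M (?PG \<Otimes>\<^sub>M ?PB)))"
    using f unfolding param_space_def .
  have m1: "(\<lambda>r. f (\<alpha>, r)) \<in> borel_measurable (lborel \<Otimes>\<^sub>M (?PG \<Otimes>\<^sub>M ?PB))" for \<alpha>
    by (rule measurable_compose[OF _ m]) simp
  have m2: "(\<lambda>r. f (\<alpha>, s, r)) \<in> borel_measurable (?PG \<Otimes>\<^sub>M ?PB)" for \<alpha> s
    by (rule measurable_compose[OF _ m1]) simp
  have "(\<integral>\<^sup>+\<theta>. f \<theta> \<partial>param_space k blk \<gamma>) = (\<integral>\<^sup>+\<alpha>. \<integral>\<^sup>+r. f (\<alpha>, r) \<partial>(lborel \<Otimes>\<^sub>M ?PG \<Otimes>\<^sub>M ?PB) \<partial>lborel)"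
    unfolding param_space_def using m by (rule sigma_finite_measure.nn_integral_fst[OF sf(1), symmetric])
  also have "\<dots> = (\<integral>\<^sup>+\<alpha>. \<integral>\<^sup>+s. \<integral>\<^sup>+r. f (\<alpha>, s, r) \<partial>(?PG \<Otimes>\<^sub>M ?PB) \<partial>lborel \<partial>lborel)"
    by (intro nn_integral_cong sigma_finite_measure.nn_integral_fst[OF sf(2), symmetric] m1)
  also have "\<dots> = (\<integral>\<^sup>+\<alpha>. \<integral>\<^sup>+s. \<integral>\<^sup>+g. \<integral>\<^sup>+\<beta>. f (\<alpha>, s, \<beta>, g) \<partial>?PG \<partial>?PB \<partial>lborel \<partial>lborel)"
    by (intro nn_integral_cong GB.nn_integral_snd[symmetric] m2)
  finally show ?thesis .
qed

lemma blk_mem_model_blocks: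
  assumes "\<gamma> \<subseteq> {..<p}" "\<forall>j<p. blk j < k" "j \<in> \<gamma>"
  shows "blk j \<in> model_blocks k blk \<gamma>"
  using assms unfolding model_blocks_def by auto

text \<open>The factors \<open>1 / r j\<close> are the Jacobian of the rescaling by
  \<open>r\<close>, so the value is independent of \<open>r\<close>, that is, of \<open>g\<close>
  and the variance.\<close>

lemma nn_integral_prod_gauss:
  fixes \<gamma> :: "nat set"
  assumes \<gamma>: "finite \<gamma>" and r: "\<And>j. j \<in> \<gamma> \<Longrightarrow> r j > 0" and \<kappa>: "\<kappa> > 0"
  shows "(\<integral>\<^sup>+\<beta>. ennreal (\<Prod>j\<in>\<gamma>. 1 / r j * exp (- \<kappa> * (\<beta> j / r j)\<^sup>2 / 2)) \<partial>PiM \<gamma> (\<lambda>_. lborel))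
    = ennreal (sqrt (2 * pi / \<kappa>) ^ card \<gamma>)"
proof -
  interpret P: product_sigma_finite "\<lambda>_::nat. lborel :: real measure" ..
  have one: "(\<integral>\<^sup>+x. ennreal (1 / r j * exp (- \<kappa> * (x / r j)\<^sup>2 / 2)) \<partial>lborel) = ennreal (sqrt (2 * pi / \<kappa>))"
    if "j \<in> \<gamma>" for j
  proof -
    have rj: "r j > 0" by (rule r[OF that])
    have "(\<integral>\<^sup>+x. ennreal (1 / r j * exp (- \<kappa> * (x / r j)\<^sup>2 / 2)) \<partial>lborel)
        = (\<integral>\<^sup>+x. ennreal (1 / r j) * ennreal (exp (- (x - 0)\<^sup>2 / (2 * ((r j)\<^sup>2 / \<kappa>)))) \<partial>lborel)"
      using rj \<kappa> by (intro nn_integral_cong) (simp add: power_divide field_simps flip: ennreal_mult)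
    also have "\<dots> = ennreal (1 / r j) * ennreal (sqrt (2 * pi * ((r j)\<^sup>2 / \<kappa>)))"
      using rj \<kappa> by (subst nn_integral_cmult, simp, subst nn_integral_gauss) auto
    also have "\<dots> = ennreal (1 / r j * sqrt (2 * pi * ((r j)\<^sup>2 / \<kappa>)))"
      using rj \<kappa> by (subst ennreal_mult) auto
    also have "1 / r j * sqrt (2 * pi * ((r j)\<^sup>2 / \<kappa>)) = sqrt (2 * pi / \<kappa>)"
      using rj by (simp add: real_sqrt_mult real_sqrt_divide)
    finally show ?thesis .
  qed
  have "(\<integral>\<^sup>+\<beta>. ennreal (\<Prod>j\<in>\<gamma>. 1 / r j * exp (- \<kappa> * (\<beta> j / r j)\<^sup>2 / 2)) \<partial>PiM \<gamma> (\<lambda>_. lborel))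
      = (\<integral>\<^sup>+\<beta>. (\<Prod>j\<in>\<gamma>. ennreal (1 / r j * exp (- \<kappa> * (\<beta> j / r j)\<^sup>2 / 2))) \<partial>PiM \<gamma> (\<lambda>_. lborel))"
    by (intro nn_integral_cong prod_ennreal[symmetric]) (use r in \<open>auto intro!: mult_nonneg_nonneg simp: less_imp_le\<close>)
  also have "\<dots> = (\<Prod>j\<in>\<gamma>. \<integral>\<^sup>+x. ennreal (1 / r j * exp (- \<kappa> * (x / r j)\<^sup>2 / 2)) \<partial>lborel)"
    by (rule P.product_nn_integral_prod[OF \<gamma>]) simp
  also have "\<dots> = ennreal (sqrt (2 * pi / \<kappa>) ^ card \<gamma>)"
    using \<kappa> by (subst prod.cong[OF refl one]) (auto simp: ennreal_power)
  finally show ?thesis .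
qed

lemma nn_integral_prod_hyperg_le:
  fixes B :: "nat set"
  assumes "finite B" "a > 2"
  shows "(\<integral>\<^sup>+g. ennreal (\<Prod>b\<in>B. hyperg_density a (g b)) \<partial>PiM B (\<lambda>_. lborel)) \<le> 1"
proof -
  interpret P: product_sigma_finite "\<lambda>_::nat. lborel :: real measure" ..
  have [measurable]: "hyperg_density a \<in> borel_measurable borel"
    unfolding hyperg_density_def by measurable
  have "(\<integral>\<^sup>+g. ennreal (\<Prod>b\<in>B. hyperg_density a (g b)) \<partial>PiM B (\<lambda>_. lborel))
      = (\<integral>\<^sup>+g. (\<Prod>b\<in>B. ennreal (hyperg_density a (g b))) \<partial>PiM B (\<lambda>_. lborel))"
    using assms by (intro nn_integral_cong prod_ennreal[symmetric]) (auto simp: hyperg_density_def)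
  also have "\<dots> = (\<Prod>b\<in>B. \<integral>\<^sup>+x. ennreal (hyperg_density a x) \<partial>lborel)"
    by (rule P.product_nn_integral_prod[OF assms(1)]) simp
  also have "\<dots> \<le> 1"
    using nn_integral_hyperg_le[OF assms(2)] by (intro prod_le_1) auto
  finally show ?thesis .
qed

text \<open>The majorant separates: the coefficients yield a constant, the hyper-g factors at most
  1, and the intercept a Gaussian integral of variance \<open>s / \<nu>\<close>. Only an integral
  over the variance is left.\<close>

lemma nn_integral_param_le:
  fixes f :: "real \<times> real \<times> (nat \<Rightarrow> real) \<times> (nat \<Rightarrow> real) \<Rightarrow> ennreal"
  assumes \<gamma>: "\<gamma> \<subseteq> {..<p}" and br: "\<forall>j<p. blk j < k" and a: "a > 2"
    and f: "f \<in> borel_measurable (param_space k blk \<gamma>)"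
    and A: "A \<in> borel_measurable borel" "\<And>s. s > 0 \<Longrightarrow> A s \<ge> 0"
    and \<nu>: "\<nu> > 0" and \<kappa>: "\<kappa> > 0"
    and bound: "\<And>\<alpha> s \<beta> g. s > 0 \<Longrightarrow> \<forall>b\<in>model_blocks k blk \<gamma>. g b > 0 \<Longrightarrow>
       f (\<alpha>, s, \<beta>, g) \<le> ennreal (A s * exp (- \<nu> * (\<alpha> - \<alpha>t)\<^sup>2 / (2 * s))
         * (\<Prod>j\<in>\<gamma>. 1 / sqrt (g (blk j) * s) * exp (- \<kappa> * (\<beta> j / sqrt (g (blk j) * s))\<^sup>2 / 2))
         * (\<Prod>b\<in>model_blocks k blk \<gamma>. hyperg_density a (g b)))"
    and zero: "\<And>\<alpha> s \<beta> g. \<not> (s > 0 \<and> (\<forall>b\<in>model_blocks k blk \<gamma>. g b > 0)) \<Longrightarrow> f (\<alpha>, s, \<beta>, g) = 0"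
  shows "(\<integral>\<^sup>+\<theta>. f \<theta> \<partial>param_space k blk \<gamma>)
    \<le> ennreal (sqrt (2 * pi / \<kappa>) ^ card \<gamma>) * (\<integral>\<^sup>+s. ennreal (indicator {0<..} s * (A s * sqrt (2 * pi * s / \<nu>))) \<partial>lborel)"
proof -
  let ?B = "model_blocks k blk \<gamma>"
  let ?PG = "PiM \<gamma> (\<lambda>_. lborel :: real measure)" and ?PB = "PiM ?B (\<lambda>_. lborel :: real measure)"
  let ?C = "sqrt (2 * pi / \<kappa>) ^ card \<gamma>"
  note [measurable] = A(1)
  have C: "?C \<ge> 0" using \<kappa> by simp
  have fin: "finite \<gamma>" using \<gamma> finite_subset by blast
  define R where "R \<alpha> s = indicator {0<..} s * (A s * exp (- \<nu> * (\<alpha> - \<alpha>t)\<^sup>2 / (2 * s)))" for \<alpha> s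
  have R0: "R \<alpha> s \<ge> 0" for \<alpha> s using A(2)[of s] unfolding R_def by (auto simp: indicator_def)
  have H0: "(\<Prod>b\<in>?B. hyperg_density a (g b)) \<ge> 0" for g
    using a by (intro prod_nonneg) (auto simp: hyperg_density_def)
  have inner: "(\<integral>\<^sup>+\<beta>. f (\<alpha>, s, \<beta>, g) \<partial>?PG) \<le> ennreal (R \<alpha> s * ?C) * ennreal (\<Prod>b\<in>?B. hyperg_density a (g b))"
    for \<alpha> s g
  proof (cases "s > 0 \<and> (\<forall>b\<in>?B. g b > 0)")
    case False
    then show ?thesis by (simp add: zero)
  next
    case True
    let ?r = "\<lambda>j. sqrt (g (blk j) * s)"
    let ?G = "\<lambda>\<beta>. (\<Prod>j\<in>\<gamma>. 1 / ?r j * exp (- \<kappa> * (\<beta> j / ?r j)\<^sup>2 / 2))"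
    have r: "?r j > 0" if "j \<in> \<gamma>" for j
      using True blk_mem_model_blocks[OF \<gamma> br that] by auto
    have G0: "?G \<beta> \<ge> 0" for \<beta>
      using r by (intro prod_nonneg mult_nonneg_nonneg) (auto simp: less_imp_le)
    have "(\<integral>\<^sup>+\<beta>. f (\<alpha>, s, \<beta>, g) \<partial>?PG) \<le> (\<integral>\<^sup>+\<beta>. ennreal (R \<alpha> s * (\<Prod>b\<in>?B. hyperg_density a (g b))) * ennreal (?G \<beta>) \<partial>?PG)"
    proof (rule nn_integral_mono)
      fix \<beta>
      have "f (\<alpha>, s, \<beta>, g) \<le> ennreal (R \<alpha> s * (\<Prod>b\<in>?B. hyperg_density a (g b)) * ?G \<beta>)"
        using bound[of s g \<alpha> \<beta>] True by (simp add: R_def mult_ac)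
      then show "f (\<alpha>, s, \<beta>, g) \<le> ennreal (R \<alpha> s * (\<Prod>b\<in>?B. hyperg_density a (g b))) * ennreal (?G \<beta>)"
        using R0 H0 G0 by (subst ennreal_mult[symmetric]) (auto intro: mult_nonneg_nonneg)
    qed
    also have "\<dots> = ennreal (R \<alpha> s * (\<Prod>b\<in>?B. hyperg_density a (g b))) * (\<integral>\<^sup>+\<beta>. ennreal (?G \<beta>) \<partial>?PG)"
      by (rule nn_integral_cmult) measurable
    also have "(\<integral>\<^sup>+\<beta>. ennreal (?G \<beta>) \<partial>?PG) = ennreal ?C"
      by (rule nn_integral_prod_gauss[OF fin r \<kappa>])
    also have "ennreal (R \<alpha> s * (\<Prod>b\<in>?B. hyperg_density a (g b))) * ennreal ?C
        = ennreal (R \<alpha> s * ?C) * ennreal (\<Prod>b\<in>?B. hyperg_density a (g b))"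
      using R0 H0 C by (simp add: mult_ac flip: ennreal_mult)
    finally show ?thesis .
  qed
  have [measurable]: "hyperg_density a \<in> borel_measurable borel"
    unfolding hyperg_density_def by measurable
  have mid: "(\<integral>\<^sup>+g. \<integral>\<^sup>+\<beta>. f (\<alpha>, s, \<beta>, g) \<partial>?PG \<partial>?PB) \<le> ennreal (R \<alpha> s * ?C)" for \<alpha> s
  proof -
    have "(\<integral>\<^sup>+g. \<integral>\<^sup>+\<beta>. f (\<alpha>, s, \<beta>, g) \<partial>?PG \<partial>?PB)
        \<le> (\<integral>\<^sup>+g. ennreal (R \<alpha> s * ?C) * ennreal (\<Prod>b\<in>?B. hyperg_density a (g b)) \<partial>?PB)"
      by (intro nn_integral_mono inner)
    also have "\<dots> = ennreal (R \<alpha> s * ?C) * (\<integral>\<^sup>+g. ennreal (\<Prod>b\<in>?B. hyperg_density a (g b)) \<partial>?PB)"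
      by (rule nn_integral_cmult) measurable
    also have "\<dots> \<le> ennreal (R \<alpha> s * ?C) * 1"
      by (intro mult_left_mono nn_integral_prod_hyperg_le a) auto
    finally show ?thesis by simp
  qed
  have "(\<integral>\<^sup>+\<theta>. f \<theta> \<partial>param_space k blk \<gamma>) \<le> (\<integral>\<^sup>+\<alpha>. \<integral>\<^sup>+s. ennreal (R \<alpha> s * ?C) \<partial>lborel \<partial>lborel)"
    unfolding nn_integral_param_space[OF fin f] by (intro nn_integral_mono mid)
  \<comment> \<open>The spread of the Gaussian in \<open>\<alpha>\<close> depends on
    \<open>s\<close>, so \<open>\<alpha>\<close> must become the inner variable.\<close>
  also have "\<dots> = (\<integral>\<^sup>+s. \<integral>\<^sup>+\<alpha>. ennreal (R \<alpha> s * ?C) \<partial>lborel \<partial>lborel)"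
    by (rule lborel_pair.Fubini'[symmetric]) (simp add: R_def case_prod_beta)
  also have "\<dots> = (\<integral>\<^sup>+s. ennreal ?C * ennreal (indicator {0<..} s * (A s * sqrt (2 * pi * s / \<nu>))) \<partial>lborel)"
  proof (rule nn_integral_cong)
    fix s :: real
    show "(\<integral>\<^sup>+\<alpha>. ennreal (R \<alpha> s * ?C) \<partial>lborel) = ennreal ?C * ennreal (indicator {0<..} s * (A s * sqrt (2 * pi * s / \<nu>)))"
    proof (cases "s > 0")
      case True
      have "(\<integral>\<^sup>+\<alpha>. ennreal (R \<alpha> s * ?C) \<partial>lborel)
          = (\<integral>\<^sup>+\<alpha>. ennreal (A s * ?C) * ennreal (exp (- (\<alpha> - \<alpha>t)\<^sup>2 / (2 * (s / \<nu>)))) \<partial>lborel)"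
        using True A(2)[of s] \<nu> C
        by (intro nn_integral_cong) (simp add: R_def mult_ac flip: ennreal_mult)
      also have "\<dots> = ennreal (A s * ?C) * ennreal (sqrt (2 * pi * (s / \<nu>)))"
        using True \<nu> by (subst nn_integral_cmult, simp, subst nn_integral_gauss) auto
      also have "\<dots> = ennreal ?C * ennreal (A s * sqrt (2 * pi * s / \<nu>))"
        using True A(2)[of s] \<nu> C by (simp add: mult_ac flip: ennreal_mult)
      finally show ?thesis using True by simp
    qed (simp add: R_def)
  qed
  also have "\<dots> = ennreal ?C * (\<integral>\<^sup>+s. ennreal (indicator {0<..} s * (A s * sqrt (2 * pi * s / \<nu>))) \<partial>lborel)"
    by (rule nn_integral_cmult) measurable
  finally show ?thesis .
qed

text \<open>Restriction to a box around the truth, with the variance left free. The intervals for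
  \<open>g\<close> have length 1, so they add no factor; the intercept and the coefficients give the
  power of \<open>2 * d\<close>.\<close>

lemma nn_integral_param_ge:
  fixes f :: "real \<times> real \<times> (nat \<Rightarrow> real) \<times> (nat \<Rightarrow> real) \<Rightarrow> ennreal"
  assumes fin: "finite \<gamma>" and d: "d > 0"
    and f: "f \<in> borel_measurable (param_space k blk \<gamma>)"
    and A[measurable]: "A \<in> borel_measurable borel"
    and bound: "\<And>\<alpha> s \<beta> g. \<bar>\<alpha> - \<alpha>t\<bar> \<le> d \<Longrightarrow> s > 0 \<Longrightarrow> \<forall>j\<in>\<gamma>. \<bar>\<beta> j - \<beta>t j\<bar> \<le> d \<Longrightarrow>
       \<forall>b\<in>model_blocks k blk \<gamma>. L \<le> g b \<and> g b \<le> L + 1 \<Longrightarrow> ennreal (A s) \<le> f (\<alpha>, s, \<beta>, g)"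
  shows "ennreal ((2 * d) ^ Suc (card \<gamma>)) * (\<integral>\<^sup>+s. ennreal (indicator {0<..} s * A s) \<partial>lborel)
    \<le> (\<integral>\<^sup>+\<theta>. f \<theta> \<partial>param_space k blk \<gamma>)"
proof -
  interpret P: product_sigma_finite "\<lambda>_::nat. lborel :: real measure" ..
  let ?B = "model_blocks k blk \<gamma>"
  let ?PG = "PiM \<gamma> (\<lambda>_. lborel :: real measure)" and ?PB = "PiM ?B (\<lambda>_. lborel :: real measure)"
  let ?a = "\<lambda>s. ennreal (indicator {0<..} s * A s)"
  let ?ia = "\<lambda>\<alpha>. indicator {\<alpha>t - d..\<alpha>t + d} \<alpha> :: ennreal"
  let ?ib = "\<lambda>\<beta>. (\<Prod>j\<in>\<gamma>. indicator {\<beta>t j - d..\<beta>t j + d} (\<beta> j)) :: ennreal"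
  let ?ig = "\<lambda>g. (\<Prod>b\<in>?B. indicator {L..L + 1} (g b)) :: ennreal"
  have ib: "(\<integral>\<^sup>+\<beta>. ?ib \<beta> \<partial>?PG) = ennreal ((2 * d) ^ card \<gamma>)"
    using d by (subst P.product_nn_integral_prod[OF fin]) (auto simp: ennreal_power)
  have ig: "(\<integral>\<^sup>+g. ?ig g \<partial>?PB) = 1"
    by (subst P.product_nn_integral_prod) auto
  have ia: "(\<integral>\<^sup>+\<alpha>. ?ia \<alpha> \<partial>lborel) = ennreal (2 * d)"
    using d by simp
  have "ennreal ((2 * d) ^ Suc (card \<gamma>)) * (\<integral>\<^sup>+s. ?a s \<partial>lborel)
      = (\<integral>\<^sup>+\<alpha>. ?ia \<alpha> * (\<integral>\<^sup>+s. ?a s * (\<integral>\<^sup>+g. ?ig g * (\<integral>\<^sup>+\<beta>. ?ib \<beta> \<partial>?PG) \<partial>?PB) \<partial>lborel) \<partial>lborel)"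
  proof -
    have g: "(\<integral>\<^sup>+g. ?ig g * c \<partial>?PB) = c" for c by (subst nn_integral_multc) (auto simp: ig)
    have s: "(\<integral>\<^sup>+s. ?a s * c \<partial>lborel) = (\<integral>\<^sup>+s. ?a s \<partial>lborel) * c" for c
      by (rule nn_integral_multc) measurable
    have \<alpha>: "(\<integral>\<^sup>+\<alpha>. ?ia \<alpha> * c \<partial>lborel) = ennreal (2 * d) * c" for c
      by (subst nn_integral_multc) (auto simp only: ia intro!: borel_measurable_indicator, measurable)
    have e: "ennreal ((2 * d) ^ Suc (card \<gamma>)) = ennreal (2 * d) * ennreal ((2 * d) ^ card \<gamma>)"
      using d unfolding power_Suc by (intro ennreal_mult) auto
    show ?thesis unfolding ib g s \<alpha> e by (simp only: mult_ac)
  qed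
  also have "\<dots> = (\<integral>\<^sup>+\<alpha>. \<integral>\<^sup>+s. \<integral>\<^sup>+g. \<integral>\<^sup>+\<beta>. ?ia \<alpha> * (?a s * (?ig g * ?ib \<beta>)) \<partial>?PG \<partial>?PB \<partial>lborel \<partial>lborel)"
    by (simp add: nn_integral_cmult)
  also have "\<dots> \<le> (\<integral>\<^sup>+\<alpha>. \<integral>\<^sup>+s. \<integral>\<^sup>+g. \<integral>\<^sup>+\<beta>. f (\<alpha>, s, \<beta>, g) \<partial>?PG \<partial>?PB \<partial>lborel \<partial>lborel)"
  proof (intro nn_integral_mono)
    fix \<alpha> s :: real and g \<beta> :: "nat \<Rightarrow> real"
    show "?ia \<alpha> * (?a s * (?ig g * ?ib \<beta>)) \<le> f (\<alpha>, s, \<beta>, g)"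
    proof (cases "\<bar>\<alpha> - \<alpha>t\<bar> \<le> d \<and> s > 0 \<and> (\<forall>j\<in>\<gamma>. \<bar>\<beta> j - \<beta>t j\<bar> \<le> d) \<and> (\<forall>b\<in>?B. L \<le> g b \<and> g b \<le> L + 1)")
      case True
      have "?ia \<alpha> * (?a s * (?ig g * ?ib \<beta>)) \<le> 1 * (ennreal (A s) * (1 * 1))"
        using True by (intro mult_mono prod_le_1) (auto simp: indicator_def)
      also have "\<dots> \<le> f (\<alpha>, s, \<beta>, g)" using bound[of \<alpha> s \<beta> g] True by simp
      finally show ?thesis .
    next
      case False
      have abs_diff_le_iff_Icc: "\<bar>x - y\<bar> \<le> d \<longleftrightarrow> y - d \<le> x \<and> x \<le> y + d" for x y :: real
        by auto
      from False have "?ia \<alpha> = 0 \<or> ?a s = 0 \<or> ?ig g = 0 \<or> ?ib \<beta> = 0"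
        unfolding abs_diff_le_iff_Icc using fin by (auto simp: indicator_def)
      then have "?ia \<alpha> * (?a s * (?ig g * ?ib \<beta>)) = 0"
        by (elim disjE) (simp_all only: mult_zero_left mult_zero_right)
      then show ?thesis by (simp only: zero_le)
    qed
  qed
  also have "\<dots> = (\<integral>\<^sup>+\<theta>. f \<theta> \<partial>param_space k blk \<gamma>)"
    by (rule nn_integral_param_space[OF fin f, symmetric])
  finally show ?thesis .
qed

subsection \<open>The joint density\<close>

definition rss :: "(nat \<Rightarrow> nat \<Rightarrow> nat \<Rightarrow> real) \<Rightarrow> nat \<Rightarrow> nat set \<Rightarrow> (nat \<Rightarrow> real) \<Rightarrow> real \<Rightarrow> (nat \<Rightarrow> real) \<Rightarrow> real" where
  "rss X n \<gamma> y \<alpha> \<beta> = (\<Sum>i<n. (y i - (\<alpha> + (\<Sum>j\<in>\<gamma>. X n i j * \<beta> j)))\<^sup>2)"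

lemma prod_normal_density:
  assumes s: "s > 0"
  shows "(\<Prod>i<n. normal_density (\<mu> i) (sqrt s) (y i))
    = (2 * pi * s) powr (- real n / 2) * exp (- (\<Sum>i<n. (y i - \<mu> i)\<^sup>2) / (2 * s))"
proof -
  have "(\<Prod>i<n. normal_density (\<mu> i) (sqrt s) (y i))
      = (\<Prod>i<n. (2 * pi * s) powr (- 1 / 2) * exp (- (y i - \<mu> i)\<^sup>2 / (2 * s)))"
    using s by (intro prod.cong refl)
      (simp add: normal_density_def powr_minus_divide powr_half_sqrt)
  also have "\<dots> = ((2 * pi * s) powr (- 1 / 2)) ^ n * exp (\<Sum>i<n. - (y i - \<mu> i)\<^sup>2 / (2 * s))"
    by (simp add: prod.distrib exp_sum)
  also have "((2 * pi * s) powr (- 1 / 2)) ^ n = (2 * pi * s) powr (- real n / 2)"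
    using s by (simp add: powr_powr flip: powr_realpow)
  also have "(\<Sum>i<n. - (y i - \<mu> i)\<^sup>2 / (2 * s)) = - (\<Sum>i<n. (y i - \<mu> i)\<^sup>2) / (2 * s)"
    by (simp add: sum_negf flip: sum_divide_distrib)
  finally show ?thesis .
qed

text \<open>Dividing the coordinates by \<open>sqrt (g (blk j) * s)\<close> turns the block prior precision
  into the Gram matrix, because the latter vanishes off the blocks.\<close>
lemma mvn0_prec_density_blockg:
  assumes \<gamma>: "\<gamma> \<subseteq> {..<p}"
    and orth: "\<And>j l. j < p \<Longrightarrow> l < p \<Longrightarrow> blk j \<noteq> blk l \<Longrightarrow> gram X n j l = 0"
    and pos: "s > 0" "\<And>j. j \<in> \<gamma> \<Longrightarrow> g (blk j) > 0"
  defines "r \<equiv> \<lambda>j. sqrt (g (blk j) * s)"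
  shows "mvn0_prec_density \<gamma> (blockg_prec X blk n g s) \<beta>
    = (2 * pi) powr (- real (card \<gamma>) / 2) * sqrt (det_on \<gamma> (gram X n)) * (\<Prod>j\<in>\<gamma>. 1 / r j)
      * exp (- quad \<gamma> (gram X n) (\<lambda>j. \<beta> j / r j) / 2)"
proof -
  have fin: "finite \<gamma>" using \<gamma> finite_subset by blast
  have r: "r j > 0" if "j \<in> \<gamma>" for j unfolding r_def using pos that by simp
  have Q: "blockg_prec X blk n g s j l = gram X n j l / (r j * r l)" if "j \<in> \<gamma>" "l \<in> \<gamma>" for j l
  proof (cases "blk j = blk l")
    case True
    have "g (blk l) * s > 0" using pos that by simp
    with True show ?thesis by (simp add: blockg_prec_def r_def)
  next
    case False
    then show ?thesis using orth[of j l] that \<gamma> by (auto simp: blockg_prec_def)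
  qed
  have "det_on \<gamma> (blockg_prec X blk n g s) = det_on \<gamma> (gram X n) / (\<Prod>j\<in>\<gamma>. r j)\<^sup>2"
    using det_on_cong[of \<gamma> _ "\<lambda>j l. gram X n j l / (r j * r l)"] Q det_on_scale[OF fin] by simp
  moreover have "(\<Prod>j\<in>\<gamma>. r j) > 0" using r by (intro prod_pos) auto
  ultimately have "sqrt (det_on \<gamma> (blockg_prec X blk n g s)) = sqrt (det_on \<gamma> (gram X n)) * (\<Prod>j\<in>\<gamma>. 1 / r j)"
    by (simp add: real_sqrt_divide prod_dividef)
  moreover have "(\<Sum>i\<in>\<gamma>. \<Sum>j\<in>\<gamma>. \<beta> i * blockg_prec X blk n g s i j * \<beta> j)
      = quad \<gamma> (gram X n) (\<lambda>j. \<beta> j / r j)"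
    by (intro sum.cong refl) (simp add: Q)
  ultimately show ?thesis unfolding mvn0_prec_density_def by simp
qed

lemma joint_dens_eq:
  assumes \<gamma>: "\<gamma> \<subseteq> {..<p}" and br: "\<forall>j<p. blk j < k"
    and orth: "\<And>j l. j < p \<Longrightarrow> l < p \<Longrightarrow> blk j \<noteq> blk l \<Longrightarrow> gram X n j l = 0"
    and pos: "s > 0" "\<forall>b\<in>model_blocks k blk \<gamma>. g b > 0"
  defines "r \<equiv> \<lambda>j. sqrt (g (blk j) * s)"
  shows "joint_dens a k blk X n \<gamma> y (\<alpha>, s, \<beta>, g)
    = (2 * pi * s) powr (- real n / 2) * exp (- rss X n \<gamma> y \<alpha> \<beta> / (2 * s)) * (1 / s)
      * ((2 * pi) powr (- real (card \<gamma>) / 2) * sqrt (det_on \<gamma> (gram X n)) * (\<Prod>j\<in>\<gamma>. 1 / r j)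
         * exp (- quad \<gamma> (gram X n) (\<lambda>j. \<beta> j / r j) / 2))
      * (\<Prod>b\<in>model_blocks k blk \<gamma>. hyperg_density a (g b))"
proof -
  have "g (blk j) > 0" if "j \<in> \<gamma>" for j
    using pos(2) blk_mem_model_blocks[OF \<gamma> br that] by auto
  then have "mvn0_prec_density \<gamma> (blockg_prec X blk n g s) \<beta>
    = (2 * pi) powr (- real (card \<gamma>) / 2) * sqrt (det_on \<gamma> (gram X n)) * (\<Prod>j\<in>\<gamma>. 1 / r j)
      * exp (- quad \<gamma> (gram X n) (\<lambda>j. \<beta> j / r j) / 2)"
    unfolding r_def by (intro mvn0_prec_density_blockg[OF \<gamma> orth pos(1)])
  then show ?thesis
    using pos unfolding joint_dens_def rss_def by (simp add: prod_normal_density)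
qed

text \<open>By \<open>joint_dens_eq\<close> the determinant of the parameter-dependent precision
  becomes a constant times a product; the rest is built from finitely many coordinates.\<close>

lemma measurable_joint_dens:
  assumes \<gamma>: "\<gamma> \<subseteq> {..<p}" and br: "\<forall>j<p. blk j < k"
    and orth: "\<And>j l. j < p \<Longrightarrow> l < p \<Longrightarrow> blk j \<noteq> blk l \<Longrightarrow> gram X n j l = 0"
  shows "joint_dens a k blk X n \<gamma> y \<in> borel_measurable (param_space k blk \<gamma>)"
proof -
  let ?M = "param_space k blk \<gamma>" and ?B = "model_blocks k blk \<gamma>"
  let ?s = "\<lambda>\<theta>::real \<times> real \<times> (nat \<Rightarrow> real) \<times> (nat \<Rightarrow> real). fst (snd \<theta>)"
  let ?\<beta> = "\<lambda>\<theta>::real \<times> real \<times> (nat \<Rightarrow> real) \<times> (nat \<Rightarrow> real). fst (snd (snd \<theta>))"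
  let ?g = "\<lambda>\<theta>::real \<times> real \<times> (nat \<Rightarrow> real) \<times> (nat \<Rightarrow> real). snd (snd (snd \<theta>))"
  let ?r = "\<lambda>\<theta> j. sqrt (?g \<theta> (blk j) * ?s \<theta>)"
  note [measurable] = measurable_param_alpha measurable_param_s
  have [measurable]: "(\<lambda>\<theta>. ?\<beta> \<theta> j) \<in> borel_measurable ?M" if "j \<in> \<gamma>" for j
    using that by (rule measurable_param_beta)
  have g[measurable]: "(\<lambda>\<theta>. ?g \<theta> b) \<in> borel_measurable ?M" if "b \<in> ?B" for b
    using that by (rule measurable_param_g)
  have [measurable]: "(\<lambda>\<theta>. ?g \<theta> (blk j)) \<in> borel_measurable ?M" if "j \<in> \<gamma>" for j
    by (rule g[OF blk_mem_model_blocks[OF \<gamma> br that]])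
  have [measurable]: "hyperg_density a \<in> borel_measurable borel"
    unfolding hyperg_density_def by measurable
  have fin: "finite \<gamma>" using \<gamma> finite_subset by blast
  have "joint_dens a k blk X n \<gamma> y = (\<lambda>\<theta>. if ?s \<theta> > 0 \<and> (\<forall>b\<in>?B. ?g \<theta> b > 0) then
      (2 * pi * ?s \<theta>) powr (- real n / 2) * exp (- rss X n \<gamma> y (fst \<theta>) (?\<beta> \<theta>) / (2 * ?s \<theta>)) * (1 / ?s \<theta>)
      * ((2 * pi) powr (- real (card \<gamma>) / 2) * sqrt (det_on \<gamma> (gram X n)) * (\<Prod>j\<in>\<gamma>. 1 / ?r \<theta> j)
         * exp (- quad \<gamma> (gram X n) (\<lambda>j. ?\<beta> \<theta> j / ?r \<theta> j) / 2))
      * (\<Prod>b\<in>?B. hyperg_density a (?g \<theta> b)) else 0)"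
    (is "_ = ?f")
  proof
    fix \<theta> :: "real \<times> real \<times> (nat \<Rightarrow> real) \<times> (nat \<Rightarrow> real)"
    obtain \<alpha> s \<beta> g where \<theta>: "\<theta> = (\<alpha>, s, \<beta>, g)" by (metis prod_cases4)
    show "joint_dens a k blk X n \<gamma> y \<theta> = ?f \<theta>"
    proof (cases "s > 0 \<and> (\<forall>b\<in>?B. g b > 0)")
      case True
      then show ?thesis using joint_dens_eq[OF \<gamma> br orth, of s g] unfolding \<theta> by simp
    next
      case False
      then show ?thesis unfolding \<theta> joint_dens_def by auto
    qed
  qed
  also have "?f \<in> borel_measurable ?M"
  proof (rule measurable_If)
    show "{\<theta> \<in> space ?M. 0 < ?s \<theta> \<and> (\<forall>b\<in>?B. 0 < ?g \<theta> b)} \<in> sets ?M"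
      by (intro sets.sets_Collect_conj sets.sets_Collect_finite_All) (auto intro: borel_measurable_less measurable_param_g measurable_param_s)
  qed (unfold rss_def, measurable)
  finally show ?thesis .
qed

text \<open>\<open>sqrt\<close> of a negative number is negative in HOL, so the sign of the density
  really rests on that of the Gram determinant.\<close>

lemma joint_dens_nonneg:
  assumes \<gamma>: "\<gamma> \<subseteq> {..<p}" and br: "\<forall>j<p. blk j < k" and a: "a > 2"
    and orth: "\<And>j l. j < p \<Longrightarrow> l < p \<Longrightarrow> blk j \<noteq> blk l \<Longrightarrow> gram X n j l = 0"
    and det: "det_on \<gamma> (gram X n) \<ge> 0"
  shows "joint_dens a k blk X n \<gamma> y \<theta> \<ge> 0"
proof -
  obtain \<alpha> s \<beta> g where \<theta>: "\<theta> = (\<alpha>, s, \<beta>, g)" by (metis prod_cases4)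
  show ?thesis
  proof (cases "s > 0 \<and> (\<forall>b\<in>model_blocks k blk \<gamma>. g b > 0)")
    case True
    then have r: "0 \<le> 1 / sqrt (g (blk j) * s)" if "j \<in> \<gamma>" for j
      using blk_mem_model_blocks[OF \<gamma> br that] by (auto intro!: mult_nonneg_nonneg simp: less_imp_le)
    have h: "hyperg_density a x \<ge> 0" for x using a by (auto simp: hyperg_density_def)
    have "0 \<le> (2 * pi * s) powr (- real n / 2) * exp (- rss X n \<gamma> y \<alpha> \<beta> / (2 * s)) * (1 / s)
      * ((2 * pi) powr (- real (card \<gamma>) / 2) * sqrt (det_on \<gamma> (gram X n)) * (\<Prod>j\<in>\<gamma>. 1 / sqrt (g (blk j) * s))
         * exp (- quad \<gamma> (gram X n) (\<lambda>j. \<beta> j / sqrt (g (blk j) * s)) / 2))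
      * (\<Prod>b\<in>model_blocks k blk \<gamma>. hyperg_density a (g b))"
      by (intro mult_nonneg_nonneg prod_nonneg r h) (use det True in auto)
    then show ?thesis
      unfolding \<theta> using True
        joint_dens_eq[where X = X and n = n and blk = blk and p = p, OF \<gamma> br orth, of s g a y \<alpha> \<beta>]
      by simp
  next
    case False
    then show ?thesis unfolding \<theta> joint_dens_def by auto
  qed
qed

section \<open>Residual sum of squares around the truth\<close>

text \<open>The squared distance U. Points of the product space over \<open>\<gamma>\<close> are
  \<open>undefined\<close> outside \<open>\<gamma>\<close>, hence the explicit padding by 0.\<close>

definition sq_dev :: "nat \<Rightarrow> real \<Rightarrow> (nat \<Rightarrow> real) \<Rightarrow> nat set \<Rightarrow> real \<Rightarrow> (nat \<Rightarrow> real) \<Rightarrow> real" where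
  "sq_dev p \<alpha>t \<beta>t \<gamma> \<alpha> \<beta> = (\<alpha> - \<alpha>t)\<^sup>2 + (\<Sum>j<p. ((if j \<in> \<gamma> then \<beta> j else 0) - \<beta>t j)\<^sup>2)"

text \<open>Centred columns remove the product of the intercept error with the fitted part. The form
  runs over all \<open>p\<close> coordinates: a coefficient excluded by \<open>\<gamma>\<close>
  counts as an error of \<open>- \<beta>t j\<close>, so all models are treated alike.\<close>

lemma rss_expand:
  assumes \<gamma>: "\<gamma> \<subseteq> {..<p}" and cen: "\<And>j. j < p \<Longrightarrow> (\<Sum>i<n. X n i j) = 0"
    and e: "\<And>i. e i = y i - (\<alpha>t + (\<Sum>j<p. X n i j * \<beta>t j))"
    and u: "\<And>j. u j = (if j \<in> \<gamma> then \<beta> j else 0) - \<beta>t j"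
  shows "rss X n \<gamma> y \<alpha> \<beta> = (\<Sum>i<n. (e i)\<^sup>2) - 2 * (\<alpha> - \<alpha>t) * (\<Sum>i<n. e i)
     - 2 * (\<Sum>j<p. u j * (\<Sum>i<n. X n i j * e i)) + real n * (\<alpha> - \<alpha>t)\<^sup>2 + quad {..<p} (gram X n) u"
proof -
  let ?d = "\<alpha> - \<alpha>t"
  let ?z = "\<lambda>i. \<Sum>j<p. X n i j * u j"
  have res: "y i - (\<alpha> + (\<Sum>j\<in>\<gamma>. X n i j * \<beta> j)) = e i - ?d - ?z i" for i
  proof -
    have "(\<Sum>j\<in>\<gamma>. X n i j * \<beta> j) = (\<Sum>j<p. X n i j * (if j \<in> \<gamma> then \<beta> j else 0))"
      using \<gamma> by (intro sum.mono_neutral_cong_left) auto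
    then show ?thesis
      by (simp add: e u algebra_simps sum_subtractf)
  qed
  have z0: "(\<Sum>i<n. ?z i) = 0"
    by (subst sum.swap) (simp add: cen flip: sum_distrib_right)
  have ze: "(\<Sum>i<n. e i * ?z i) = (\<Sum>j<p. u j * (\<Sum>i<n. X n i j * e i))"
    unfolding sum_distrib_left by (subst sum.swap) (simp add: mult_ac)
  have zz: "(\<Sum>i<n. (?z i)\<^sup>2) = quad {..<p} (gram X n) u"
  proof -
    have "(\<Sum>i<n. (?z i)\<^sup>2) = (\<Sum>i<n. \<Sum>j<p. \<Sum>l<p. u j * (X n i j * X n i l) * u l)"
      unfolding power2_eq_square sum_product by (intro sum.cong refl) simp
    also have "\<dots> = (\<Sum>j<p. \<Sum>l<p. \<Sum>i<n. u j * (X n i j * X n i l) * u l)"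
      by (subst sum.swap, intro sum.cong refl sum.swap)
    also have "\<dots> = quad {..<p} (gram X n) u"
      unfolding gram_def sum_distrib_left sum_distrib_right by simp
    finally show ?thesis .
  qed
  have "rss X n \<gamma> y \<alpha> \<beta> = (\<Sum>i<n. (e i)\<^sup>2 - 2 * ?d * e i - 2 * (e i * ?z i) + ?d\<^sup>2 + 2 * ?d * ?z i + (?z i)\<^sup>2)"
    unfolding rss_def res by (intro sum.cong refl) (simp add: power2_eq_square algebra_simps)
  also have "\<dots> = (\<Sum>i<n. (e i)\<^sup>2) - 2 * ?d * (\<Sum>i<n. e i) - 2 * (\<Sum>i<n. e i * ?z i) + real n * ?d\<^sup>2
      + 2 * ?d * (\<Sum>i<n. ?z i) + (\<Sum>i<n. (?z i)\<^sup>2)"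
    by (simp add: sum.distrib sum_subtractf flip: sum_distrib_left)
  finally show ?thesis unfolding z0 ze zz by simp
qed

text \<open>The terms linear in the noise are split by Young's inequality into a small multiple of U
  and a multiple of \<open>\<eta>\<^sup>2\<close>. The quadratic part is comparable to
  \<open>real n\<close> times U by the bounds on the Gram matrix.\<close>

lemma rss_bounds:
  assumes \<gamma>: "\<gamma> \<subseteq> {..<p}" and cen: "\<And>j. j < p \<Longrightarrow> (\<Sum>i<n. X n i j) = 0"
    and e: "\<And>i. e i = y i - (\<alpha>t + (\<Sum>j<p. X n i j * \<beta>t j))"
    and n1: "\<bar>\<Sum>i<n. e i\<bar> \<le> \<eta> * real n" and n2: "\<And>j. j < p \<Longrightarrow> \<bar>\<Sum>i<n. X n i j * e i\<bar> \<le> \<eta> * real n"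
    and c: "0 < c" "c \<le> 1" "1 \<le> C"
    and lower: "\<And>v. c * real n * (\<Sum>j<p. (v j)\<^sup>2) \<le> quad {..<p} (gram X n) v"
    and upper: "\<And>v. quad {..<p} (gram X n) v \<le> C * real n * (\<Sum>j<p. (v j)\<^sup>2)"
  defines "E \<equiv> (\<Sum>i<n. (e i)\<^sup>2) / real n"
  shows "real n * (E - 2 * real (Suc p) * \<eta>\<^sup>2 / c + c / 2 * sq_dev p \<alpha>t \<beta>t \<gamma> \<alpha> \<beta>) \<le> rss X n \<gamma> y \<alpha> \<beta>"
    and "rss X n \<gamma> y \<alpha> \<beta> \<le> real n * (E + real (Suc p) * \<eta>\<^sup>2 + 2 * C * sq_dev p \<alpha>t \<beta>t \<gamma> \<alpha> \<beta>)"
proof -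
  define u where "u j = (if j \<in> \<gamma> then \<beta> j else 0) - \<beta>t j" for j
  define d where "d = \<alpha> - \<alpha>t"
  have nE: "(\<Sum>i<n. (e i)\<^sup>2) = real n * E" unfolding E_def by simp
  have sd: "sq_dev p \<alpha>t \<beta>t \<gamma> \<alpha> \<beta> = d\<^sup>2 + (\<Sum>j<p. (u j)\<^sup>2)"
    unfolding sq_dev_def u_def d_def by simp
  have ex: "rss X n \<gamma> y \<alpha> \<beta> = real n * E - 2 * d * (\<Sum>i<n. e i)
     - 2 * (\<Sum>j<p. u j * (\<Sum>i<n. X n i j * e i)) + real n * d\<^sup>2 + quad {..<p} (gram X n) u"
    using rss_expand[where X = X and n = n and y = y and \<alpha>t = \<alpha>t and e = e and \<beta>t = \<beta>t and u = u
        and \<beta> = \<beta> and \<alpha> = \<alpha>, OF \<gamma> cen e u_def]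
    unfolding nE[symmetric] d_def .
  \<comment> \<open>The parameter \<open>t\<close> distributes the cost: \<open>c / 2\<close> in the
    lower bound, 1 in the upper one.\<close>
  have young: "2 * \<bar>x * w\<bar> \<le> real n * (t * x\<^sup>2 + \<eta>\<^sup>2 / t)" if w: "\<bar>w\<bar> \<le> \<eta> * real n" and t: "t > 0" for x w t :: real
  proof -
    have "2 * \<bar>x * w\<bar> \<le> 2 * (\<bar>x\<bar> * (\<eta> * real n))"
      unfolding abs_mult using w by (intro mult_left_mono) auto
    also have "\<dots> = real n * (2 * (sqrt t * \<bar>x\<bar>) * (\<eta> / sqrt t))" using t by simp
    also have "\<dots> \<le> real n * ((sqrt t * \<bar>x\<bar>)\<^sup>2 + (\<eta> / sqrt t)\<^sup>2)"
      by (intro mult_left_mono sum_squares_bound) auto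
    also have "\<dots> = real n * (t * x\<^sup>2 + \<eta>\<^sup>2 / t)"
      using t by (simp add: power_mult_distrib power_divide)
    finally show ?thesis .
  qed
  have cross: "\<bar>2 * d * (\<Sum>i<n. e i) + 2 * (\<Sum>j<p. u j * (\<Sum>i<n. X n i j * e i))\<bar>
     \<le> real n * (t * (d\<^sup>2 + (\<Sum>j<p. (u j)\<^sup>2)) + real (Suc p) * \<eta>\<^sup>2 / t)" if t: "t > 0" for t
  proof -
    have "\<bar>2 * d * (\<Sum>i<n. e i) + 2 * (\<Sum>j<p. u j * (\<Sum>i<n. X n i j * e i))\<bar>
        \<le> 2 * \<bar>d * (\<Sum>i<n. e i)\<bar> + (\<Sum>j<p. 2 * \<bar>u j * (\<Sum>i<n. X n i j * e i)\<bar>)"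
      unfolding sum_distrib_left[symmetric]
      using sum_abs[of "\<lambda>j. u j * (\<Sum>i<n. X n i j * e i)" "{..<p}"] by linarith
    also have "\<dots> \<le> real n * (t * d\<^sup>2 + \<eta>\<^sup>2 / t) + (\<Sum>j<p. real n * (t * (u j)\<^sup>2 + \<eta>\<^sup>2 / t))"
      by (intro add_mono sum_mono young n1 n2 t) auto
    also have "\<dots> = real n * (t * (d\<^sup>2 + (\<Sum>j<p. (u j)\<^sup>2)) + real (Suc p) * \<eta>\<^sup>2 / t)"
      by (simp add: sum.distrib algebra_simps add_divide_distrib flip: sum_distrib_left)
    finally show ?thesis .
  qed
  have Su: "(\<Sum>j<p. (u j)\<^sup>2) \<ge> 0" by (simp add: sum_nonneg)
  \<comment> \<open>With \<open>t = c / 2\<close> the linear terms consume half of the quadratic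
    growth. The intercept has coefficient 1 instead of \<open>c\<close>, which
    \<open>c \<le> 1\<close> makes sufficient.\<close>
  have "real n * (E - 2 * real (Suc p) * \<eta>\<^sup>2 / c + c / 2 * (d\<^sup>2 + (\<Sum>j<p. (u j)\<^sup>2)))
      = real n * E - real n * (c / 2 * (d\<^sup>2 + (\<Sum>j<p. (u j)\<^sup>2)) + real (Suc p) * \<eta>\<^sup>2 / (c / 2))
        + (real n * (c * d\<^sup>2) + c * real n * (\<Sum>j<p. (u j)\<^sup>2))"
    by (simp add: algebra_simps)
  also have "\<dots> \<le> real n * E - \<bar>2 * d * (\<Sum>i<n. e i) + 2 * (\<Sum>j<p. u j * (\<Sum>i<n. X n i j * e i))\<bar>
        + (real n * (1 * d\<^sup>2) + quad {..<p} (gram X n) u)"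
    using c by (intro add_mono diff_mono cross lower mult_left_mono mult_right_mono order_refl) auto
  also have "\<dots> \<le> rss X n \<gamma> y \<alpha> \<beta>" unfolding ex by linarith
  finally show "real n * (E - 2 * real (Suc p) * \<eta>\<^sup>2 / c + c / 2 * sq_dev p \<alpha>t \<beta>t \<gamma> \<alpha> \<beta>) \<le> rss X n \<gamma> y \<alpha> \<beta>"
    unfolding sd .
  have "rss X n \<gamma> y \<alpha> \<beta> \<le> real n * E + \<bar>2 * d * (\<Sum>i<n. e i) + 2 * (\<Sum>j<p. u j * (\<Sum>i<n. X n i j * e i))\<bar>
        + (real n * d\<^sup>2 + quad {..<p} (gram X n) u)"
    unfolding ex by linarith
  also have "\<dots> \<le> real n * E + real n * (1 * (d\<^sup>2 + (\<Sum>j<p. (u j)\<^sup>2)) + real (Suc p) * \<eta>\<^sup>2 / 1)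
        + (real n * d\<^sup>2 + C * real n * (\<Sum>j<p. (u j)\<^sup>2))"
    by (intro add_mono cross upper order_refl) auto
  also have "\<dots> = real n * (E + real (Suc p) * \<eta>\<^sup>2 + (2 * d\<^sup>2 + (1 + C) * (\<Sum>j<p. (u j)\<^sup>2)))"
    by (simp add: algebra_simps)
  \<comment> \<open>By \<open>C \<ge> 1\<close> both 2 and \<open>1 + C\<close> are at most
    \<open>2 * C\<close>.\<close>
  also have "\<dots> \<le> real n * (E + real (Suc p) * \<eta>\<^sup>2 + (2 * C * d\<^sup>2 + 2 * C * (\<Sum>j<p. (u j)\<^sup>2)))"
    using c Su by (intro mult_left_mono add_mono mult_right_mono order_refl) auto
  finally show "rss X n \<gamma> y \<alpha> \<beta> \<le> real n * (E + real (Suc p) * \<eta>\<^sup>2 + 2 * C * sq_dev p \<alpha>t \<beta>t \<gamma> \<alpha> \<beta>)"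
    unfolding sd by (simp add: algebra_simps)
qed

lemma quad_model_ge:
  assumes "\<gamma> \<subseteq> {..<p}" "\<And>v. \<kappa> * (\<Sum>j<p. (v j)\<^sup>2) \<le> quad {..<p} M v"
  shows "\<kappa> * (\<Sum>j\<in>\<gamma>. (v j)\<^sup>2) \<le> quad \<gamma> M v"
proof -
  let ?w = "\<lambda>j. if j \<in> \<gamma> then v j else 0"
  have "(\<Sum>j\<in>\<gamma>. (v j)\<^sup>2) = (\<Sum>j<p. (?w j)\<^sup>2)"
    using assms(1) by (intro sum.mono_neutral_cong_left) auto
  moreover have "quad \<gamma> M v = quad {..<p} M ?w"
    using assms(1) by (intro quad_extend) auto
  ultimately show ?thesis using assms(2)[of ?w] by simp
qed

lemma quad_model_le:
  assumes "\<gamma> \<subseteq> {..<p}" "\<And>v. quad {..<p} M v \<le> \<kappa> * (\<Sum>j<p. (v j)\<^sup>2)"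
  shows "quad \<gamma> M v \<le> \<kappa> * (\<Sum>j\<in>\<gamma>. (v j)\<^sup>2)"
proof -
  let ?w = "\<lambda>j. if j \<in> \<gamma> then v j else 0"
  have "(\<Sum>j\<in>\<gamma>. (v j)\<^sup>2) = (\<Sum>j<p. (?w j)\<^sup>2)"
    using assms(1) by (intro sum.mono_neutral_cong_left) auto
  moreover have "quad \<gamma> M v = quad {..<p} M ?w"
    using assms(1) by (intro quad_extend) auto
  ultimately show ?thesis using assms(2)[of ?w] by simp
qed

section \<open>The integrated joint density from above and from below\<close>

text \<open>Part of the exponential decay in U pays for the weight \<open>1 + U\<close>. In the
  application \<open>1 / x\<close> is proportional to \<open>s / n\<close>, so the price is a
  further power of the variance.\<close>

lemma one_plus_times_exp_le:
  fixes x U :: real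
  assumes "x > 0" "U \<ge> 0"
  shows "(1 + U) * exp (- (x * U)) \<le> 1 + 1 / x"
proof -
  have "x * U \<le> exp (x * U)" using exp_ge_add_one_self[of "x * U"] by linarith
  then have "U * exp (- (x * U)) \<le> 1 / x"
    using assms by (simp add: exp_minus field_simps)
  moreover have "exp (- (x * U)) \<le> 1" using assms by simp
  ultimately show ?thesis unfolding distrib_right by linarith
qed

lemma sq_dev_nonneg: "sq_dev p \<alpha>t \<beta>t \<gamma> \<alpha> \<beta> \<ge> 0"
  unfolding sq_dev_def by (intro add_nonneg_nonneg sum_nonneg) auto

text \<open>Brings the weighted density into the separated form required by
  \<open>nn_integral_param_le\<close>. The coefficients survive only in the prior kernel; the decay
  of the likelihood in U is spent on the weight and on the intercept, whose flat prior provides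
  none.\<close>

lemma joint_dens_upper_bound:
  assumes \<gamma>: "\<gamma> \<subseteq> {..<p}" and br: "\<forall>j<p. blk j < k" and a: "a > 2"
    and orth: "\<And>j l. j < p \<Longrightarrow> l < p \<Longrightarrow> blk j \<noteq> blk l \<Longrightarrow> gram X n j l = 0"
    and det: "det_on \<gamma> (gram X n) \<ge> 0"
    and pos: "s > 0" "\<forall>b\<in>model_blocks k blk \<gamma>. g b > 0" "n > 0"
    and c: "c > 0" "\<And>v. c * real n * (\<Sum>j<p. (v j)\<^sup>2) \<le> quad {..<p} (gram X n) v"
    and \<tau>: "\<tau> > 0"
    and rss: "real n * (W + \<tau> * sq_dev p \<alpha>t \<beta>t \<gamma> \<alpha> \<beta>) \<le> rss X n \<gamma> y \<alpha> \<beta>"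
  shows "(1 + sq_dev p \<alpha>t \<beta>t \<gamma> \<alpha> \<beta>) * joint_dens a k blk X n \<gamma> y (\<alpha>, s, \<beta>, g)
    \<le> ((1 + 4 * s / (real n * \<tau>)) * ((2 * pi) powr (- real n / 2) * s powr (- real n / 2 - 1) * exp (- (real n * W) / (2 * s))
        * ((2 * pi) powr (- real (card \<gamma>) / 2) * sqrt (det_on \<gamma> (gram X n)))))
      * exp (- (real n * \<tau> / 2) * (\<alpha> - \<alpha>t)\<^sup>2 / (2 * s))
      * (\<Prod>j\<in>\<gamma>. 1 / sqrt (g (blk j) * s) * exp (- (c * real n) * (\<beta> j / sqrt (g (blk j) * s))\<^sup>2 / 2))
      * (\<Prod>b\<in>model_blocks k blk \<gamma>. hyperg_density a (g b))"
proof -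
  define U where "U = sq_dev p \<alpha>t \<beta>t \<gamma> \<alpha> \<beta>"
  let ?r = "\<lambda>j. sqrt (g (blk j) * s)"
  let ?H = "\<Prod>b\<in>model_blocks k blk \<gamma>. hyperg_density a (g b)"
  let ?R = "\<Prod>j\<in>\<gamma>. 1 / ?r j"
  let ?D = "(2 * pi) powr (- real (card \<gamma>) / 2) * sqrt (det_on \<gamma> (gram X n))"
  have U0: "U \<ge> 0" unfolding U_def by (rule sq_dev_nonneg)
  have fin: "finite \<gamma>" using \<gamma> finite_subset by blast
  have H0: "?H \<ge> 0" using a by (intro prod_nonneg) (auto simp: hyperg_density_def)
  have r: "?r j > 0" if "j \<in> \<gamma>" for j
    using pos blk_mem_model_blocks[OF \<gamma> br that] by auto
  then have R0: "?R \<ge> 0" by (intro prod_nonneg) (auto simp: less_imp_le)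
  have e1: "(1 + U) * exp (- rss X n \<gamma> y \<alpha> \<beta> / (2 * s))
      \<le> (1 + 4 * s / (real n * \<tau>)) * exp (- (real n * W) / (2 * s)) * exp (- (real n * \<tau> / 2) * (\<alpha> - \<alpha>t)\<^sup>2 / (2 * s))"
  proof -
    let ?x = "real n * \<tau> / (4 * s)"
    have x: "?x > 0" using pos \<tau> by simp
    have "exp (- rss X n \<gamma> y \<alpha> \<beta> / (2 * s)) \<le> exp (- (real n * (W + \<tau> * U)) / (2 * s))"
      using rss pos unfolding U_def by (simp add: divide_right_mono)
    \<comment> \<open>The decay is halved: one exponential absorbs \<open>1 + U\<close>, the other
      becomes a Gaussian in the intercept because U dominates its squared error.\<close>
    also have "- (real n * (W + \<tau> * U)) / (2 * s) = - (real n * W) / (2 * s) + (- (?x * U) + - (?x * U))"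
      using pos by (simp add: field_simps)
    also have "exp \<dots> = exp (- (real n * W) / (2 * s)) * (exp (- (?x * U)) * exp (- (?x * U)))"
      by (simp only: exp_add)
    finally have "(1 + U) * exp (- rss X n \<gamma> y \<alpha> \<beta> / (2 * s))
        \<le> (1 + U) * (exp (- (real n * W) / (2 * s)) * (exp (- (?x * U)) * exp (- (?x * U))))"
      using U0 by (intro mult_left_mono) auto
    also have "\<dots> = exp (- (real n * W) / (2 * s)) * (((1 + U) * exp (- (?x * U))) * exp (- (?x * U)))"
      by (simp only: mult_ac)
    also have "\<dots> \<le> exp (- (real n * W) / (2 * s)) * ((1 + 1 / ?x) * exp (- (?x * (\<alpha> - \<alpha>t)\<^sup>2)))"
    proof (intro mult_left_mono mult_mono one_plus_times_exp_le x U0)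
      have "(\<alpha> - \<alpha>t)\<^sup>2 \<le> U" unfolding U_def sq_dev_def by (simp add: sum_nonneg)
      then show "exp (- (?x * U)) \<le> exp (- (?x * (\<alpha> - \<alpha>t)\<^sup>2))"
        using x by (simp only: exp_le_cancel_iff neg_le_iff_le mult_le_cancel_left_pos)
    qed (use x pos \<tau> U0 in auto)
    also have "\<dots> = (1 + 4 * s / (real n * \<tau>)) * exp (- (real n * W) / (2 * s)) * exp (- (real n * \<tau> / 2) * (\<alpha> - \<alpha>t)\<^sup>2 / (2 * s))"
      by (simp add: mult_ac)
    finally show ?thesis .
  qed
  \<comment> \<open>Bounding the Gram form below by a multiple of the identity makes the prior
    kernel a product over coordinates.\<close>
  have e2: "?R * exp (- quad \<gamma> (gram X n) (\<lambda>j. \<beta> j / ?r j) / 2)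
      \<le> (\<Prod>j\<in>\<gamma>. 1 / ?r j * exp (- (c * real n) * (\<beta> j / ?r j)\<^sup>2 / 2))"
  proof -
    have "c * real n * (\<Sum>j\<in>\<gamma>. (\<beta> j / ?r j)\<^sup>2) \<le> quad \<gamma> (gram X n) (\<lambda>j. \<beta> j / ?r j)"
      using quad_model_ge[OF \<gamma> c(2)] .
    then have "exp (- quad \<gamma> (gram X n) (\<lambda>j. \<beta> j / ?r j) / 2) \<le> exp (\<Sum>j\<in>\<gamma>. - (c * real n) * (\<beta> j / ?r j)\<^sup>2 / 2)"
      unfolding exp_le_cancel_iff sum_divide_distrib[symmetric] sum_distrib_left[symmetric] by simp
    also have "\<dots> = (\<Prod>j\<in>\<gamma>. exp (- (c * real n) * (\<beta> j / ?r j)\<^sup>2 / 2))" using fin by (rule exp_sum)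
    finally show ?thesis unfolding prod.distrib using R0 by (intro mult_left_mono)
  qed
  have F: "(2 * pi * s) powr (- real n / 2) * (1 / s) = (2 * pi) powr (- real n / 2) * s powr (- real n / 2 - 1)"
    using pos by (simp add: powr_mult powr_diff)
  have J: "joint_dens a k blk X n \<gamma> y (\<alpha>, s, \<beta>, g)
      = (2 * pi * s) powr (- real n / 2) * exp (- rss X n \<gamma> y \<alpha> \<beta> / (2 * s)) * (1 / s)
      * (?D * ?R * exp (- quad \<gamma> (gram X n) (\<lambda>j. \<beta> j / ?r j) / 2)) * ?H"
    using pos by (intro joint_dens_eq[where p = p and blk = blk and X = X and n = n, OF \<gamma> br orth]) auto
  have "(1 + U) * joint_dens a k blk X n \<gamma> y (\<alpha>, s, \<beta>, g)
      = ((2 * pi * s) powr (- real n / 2) * (1 / s) * ?D * ?H)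
        * (((1 + U) * exp (- rss X n \<gamma> y \<alpha> \<beta> / (2 * s))) * (?R * exp (- quad \<gamma> (gram X n) (\<lambda>j. \<beta> j / ?r j) / 2)))"
    unfolding J by (simp only: mult_ac)
  also have "\<dots> \<le> ((2 * pi * s) powr (- real n / 2) * (1 / s) * ?D * ?H)
        * (((1 + 4 * s / (real n * \<tau>)) * exp (- (real n * W) / (2 * s)) * exp (- (real n * \<tau> / 2) * (\<alpha> - \<alpha>t)\<^sup>2 / (2 * s)))
           * (\<Prod>j\<in>\<gamma>. 1 / ?r j * exp (- (c * real n) * (\<beta> j / ?r j)\<^sup>2 / 2)))"
  proof (rule mult_left_mono[OF mult_mono[OF e1 e2]])
    show "0 \<le> (2 * pi * s) powr (- real n / 2) * (1 / s) * ?D * ?H"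
      using H0 det pos by (intro mult_nonneg_nonneg) auto
    show "0 \<le> (1 + 4 * s / (real n * \<tau>)) * exp (- (real n * W) / (2 * s)) * exp (- (real n * \<tau> / 2) * (\<alpha> - \<alpha>t)\<^sup>2 / (2 * s))"
      using pos \<tau> by (intro mult_nonneg_nonneg) auto
    show "0 \<le> ?R * exp (- quad \<gamma> (gram X n) (\<lambda>j. \<beta> j / ?r j) / 2)"
      using R0 by (intro mult_nonneg_nonneg) auto
  qed
  finally show ?thesis unfolding F U_def by (simp only: mult_ac)
qed

text \<open>All powers of \<open>n\<close> cancel outside the leading bracket, so the remaining
  factor depends on \<open>W\<close> but not on \<open>n\<close> or \<open>y\<close>. The set
  \<open>S\<close> will be the whole space (for integrability) or the bad region, and
  \<open>q\<close> the size of the true model, so that all models share the inverse-gamma factor of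
  its lower bound. The condition \<open>n \<ge> 5\<close> keeps the smaller shape
  \<open>(n - 3) / 2\<close> at least 1.\<close>

lemma nn_integral_joint_dens_le:
  assumes \<gamma>: "\<gamma> \<subseteq> {..<p}" and br: "\<forall>j<p. blk j < k" and a: "a > 2"
    and orth: "\<And>j l. j < p \<Longrightarrow> l < p \<Longrightarrow> blk j \<noteq> blk l \<Longrightarrow> gram X n j l = 0"
    and n: "n \<ge> 5"
    and c: "c > 0" "\<And>v. c * real n * (\<Sum>j<p. (v j)\<^sup>2) \<le> quad {..<p} (gram X n) v"
    and det: "0 \<le> det_on \<gamma> (gram X n)" "det_on \<gamma> (gram X n) \<le> M * (c * real n) ^ card \<gamma>"
    and \<tau>: "\<tau> > 0" and W: "W > 0" and q: "q \<ge> 0"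
    and S: "S \<in> sets (param_space k blk \<gamma>)"
    and rss: "\<And>\<alpha> s \<beta> g. (\<alpha>, s, \<beta>, g) \<in> S \<Longrightarrow> real n * (W + \<tau> * sq_dev p \<alpha>t \<beta>t \<gamma> \<alpha> \<beta>) \<le> rss X n \<gamma> y \<alpha> \<beta>"
  shows "(\<integral>\<^sup>+\<theta>. ennreal ((1 + sq_dev p \<alpha>t \<beta>t \<gamma> (fst \<theta>) (fst (snd (snd \<theta>)))) * joint_dens a k blk X n \<gamma> y \<theta>)
      * indicator S \<theta> \<partial>param_space k blk \<gamma>)
    \<le> ennreal ((2 * pi * real n * W) powr (- real n / 2)
        * (sqrt M * sqrt (4 * pi / \<tau>) * (1 + 2 * exp 1) * (W powr (1/2) + 4 / \<tau> * W powr (3/2))))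
      * inv_gamma_int ((real n + q) / 2) 1"
proof -
  let ?M = "param_space k blk \<gamma>"
  let ?dt = "det_on \<gamma> (gram X n)"
  let ?N = "real n"
  have n0: "?N > 0" "n > 0" using n by auto
  have fin: "finite \<gamma>" using \<gamma> finite_subset by blast
  define A where "A s = (1 + 4 * s / (?N * \<tau>)) * ((2 * pi) powr (- ?N / 2) * s powr (- ?N / 2 - 1) * exp (- (?N * W) / (2 * s))
        * ((2 * pi) powr (- real (card \<gamma>) / 2) * sqrt ?dt))" for s
  define f where "f \<theta> = ennreal ((1 + sq_dev p \<alpha>t \<beta>t \<gamma> (fst \<theta>) (fst (snd (snd \<theta>)))) * joint_dens a k blk X n \<gamma> y \<theta>)
      * indicator S \<theta>" for \<theta>
  have sd[measurable]: "(\<lambda>\<theta>. sq_dev p \<alpha>t \<beta>t \<gamma> (fst \<theta>) (fst (snd (snd \<theta>)))) \<in> borel_measurable ?M"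
  proof -
    have [measurable]: "(\<lambda>\<theta>. (if j \<in> \<gamma> then fst (snd (snd \<theta>)) j else 0)) \<in> borel_measurable ?M" for j
      by (cases "j \<in> \<gamma>") (auto intro: measurable_param_beta)
    note [measurable] = measurable_param_alpha
    show ?thesis unfolding sq_dev_def by measurable
  qed
  have J[measurable]: "joint_dens a k blk X n \<gamma> y \<in> borel_measurable ?M"
    by (rule measurable_joint_dens[OF \<gamma> br orth])
  have f: "f \<in> borel_measurable ?M" unfolding f_def using S by measurable
  have "(\<integral>\<^sup>+\<theta>. f \<theta> \<partial>?M) \<le> ennreal (sqrt (2 * pi / (c * ?N)) ^ card \<gamma>)
      * (\<integral>\<^sup>+s. ennreal (indicator {0<..} s * (A s * sqrt (2 * pi * s / (?N * \<tau> / 2)))) \<partial>lborel)"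
  proof (rule nn_integral_param_le[where \<alpha>t = \<alpha>t, OF \<gamma> br a f])
    show "A \<in> borel_measurable borel" unfolding A_def by measurable
    show "A s \<ge> 0" if "s > 0" for s unfolding A_def
      using that det(1) \<tau> by (intro mult_nonneg_nonneg) auto
    show "?N * \<tau> / 2 > 0" "c * ?N > 0" using n0 \<tau> c by auto
    fix \<alpha> s :: real and \<beta> g :: "nat \<Rightarrow> real"
    let ?b = "A s * exp (- (?N * \<tau> / 2) * (\<alpha> - \<alpha>t)\<^sup>2 / (2 * s))
      * (\<Prod>j\<in>\<gamma>. 1 / sqrt (g (blk j) * s) * exp (- (c * ?N) * (\<beta> j / sqrt (g (blk j) * s))\<^sup>2 / 2))
      * (\<Prod>b\<in>model_blocks k blk \<gamma>. hyperg_density a (g b))"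
    { assume sg: "s > 0" "\<forall>b\<in>model_blocks k blk \<gamma>. g b > 0"
      show "f (\<alpha>, s, \<beta>, g) \<le> ennreal ?b"
      proof (cases "(\<alpha>, s, \<beta>, g) \<in> S")
        case True
        have "(1 + sq_dev p \<alpha>t \<beta>t \<gamma> \<alpha> \<beta>) * joint_dens a k blk X n \<gamma> y (\<alpha>, s, \<beta>, g) \<le> ?b"
          unfolding A_def
          by (rule joint_dens_upper_bound[OF \<gamma> br a orth det(1) sg n0(2) c \<tau> rss[OF True]])
        then show ?thesis using True unfolding f_def by (simp add: ennreal_leI)
      qed (simp add: f_def) }
    { assume "\<not> (s > 0 \<and> (\<forall>b\<in>model_blocks k blk \<gamma>. g b > 0))"
      then have "joint_dens a k blk X n \<gamma> y (\<alpha>, s, \<beta>, g) = 0" unfolding joint_dens_def by auto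
      then show "f (\<alpha>, s, \<beta>, g) = 0" unfolding f_def by simp }
  qed
  also have "(\<integral>\<^sup>+s. ennreal (indicator {0<..} s * (A s * sqrt (2 * pi * s / (?N * \<tau> / 2)))) \<partial>lborel)
      = ennreal ((2 * pi) powr (- ?N / 2) * ((2 * pi) powr (- real (card \<gamma>) / 2) * sqrt ?dt) * sqrt (4 * pi / (?N * \<tau>)))
        * (inv_gamma_int ((?N - 1) / 2) (?N * W) + ennreal (4 / (?N * \<tau>)) * inv_gamma_int ((?N - 3) / 2) (?N * W))"
    (is "_ = ennreal ?c * _")
  proof -
    have c0: "?c \<ge> 0" using det(1) \<tau> by (intro mult_nonneg_nonneg) auto
    let ?h = "\<lambda>m s. indicator {0<..} s * (s powr (-m-1) * exp (- (?N * W) / (2 * s)))"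
    have hA: "indicator {0<..} s * (A s * sqrt (2 * pi * s / (?N * \<tau> / 2)))
        = ?c * (?h ((?N - 1) / 2) s + 4 / (?N * \<tau>) * ?h ((?N - 3) / 2) s)" for s
    proof (cases "s > 0")
      case True
      have sq: "sqrt (2 * pi * s / (?N * \<tau> / 2)) = sqrt (4 * pi / (?N * \<tau>)) * s powr (1/2)"
        using True by (simp add: powr_half_sqrt flip: real_sqrt_mult)
      \<comment> \<open>The intercept integral contributes \<open>sqrt s\<close> and thus lowers the
        shape from \<open>n / 2\<close> to \<open>(n - 1) / 2\<close>; the price of
        \<open>1 + U\<close> contributes another factor \<open>s\<close>, giving
        \<open>(n - 3) / 2\<close>.\<close>
      have p1: "s powr (- ((?N - 1) / 2) - 1) = s powr (- ?N / 2 - 1) * s powr (1/2)"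
        by (simp add: field_simps flip: powr_add)
      have p2: "s powr (- ((?N - 3) / 2) - 1) = s * s powr (- ?N / 2 - 1) * s powr (1/2)"
      proof -
        have "s * s powr (- ?N / 2 - 1) * s powr (1/2) = s powr 1 * s powr (- ?N / 2 - 1) * s powr (1/2)"
          using True by simp
        also have "\<dots> = s powr (1 + (- ?N / 2 - 1) + 1/2)" by (simp only: powr_add)
        also have "1 + (- ?N / 2 - 1) + 1/2 = - ((?N - 3) / 2) - 1" by (simp add: field_simps)
        finally show ?thesis ..
      qed
      show ?thesis unfolding A_def sq p1 p2 using True by (simp add: algebra_simps)
    qed simp
    have e: "ennreal (x * (y + z * w)) = ennreal x * (ennreal y + ennreal z * ennreal w)"
      if "x \<ge> 0" "y \<ge> 0" "z \<ge> 0" "w \<ge> 0" for x y z w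
      using that by (simp add: ennreal_mult ennreal_plus)
    have h0: "?h m s \<ge> 0" for m s by simp
    have "(\<integral>\<^sup>+s. ennreal (indicator {0<..} s * (A s * sqrt (2 * pi * s / (?N * \<tau> / 2)))) \<partial>lborel)
        = (\<integral>\<^sup>+s. ennreal ?c * (ennreal (?h ((?N - 1) / 2) s) + ennreal (4 / (?N * \<tau>)) * ennreal (?h ((?N - 3) / 2) s)) \<partial>lborel)"
      unfolding hA by (intro nn_integral_cong e c0 h0) (use n0 \<tau> in simp)
    also have "\<dots> = ennreal ?c * (\<integral>\<^sup>+s. (ennreal (?h ((?N - 1) / 2) s) + ennreal (4 / (?N * \<tau>)) * ennreal (?h ((?N - 3) / 2) s)) \<partial>lborel)"
      by (rule nn_integral_cmult) measurable
    also have "(\<integral>\<^sup>+s. (ennreal (?h ((?N - 1) / 2) s) + ennreal (4 / (?N * \<tau>)) * ennreal (?h ((?N - 3) / 2) s)) \<partial>lborel)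
        = (\<integral>\<^sup>+s. ennreal (?h ((?N - 1) / 2) s) \<partial>lborel) + (\<integral>\<^sup>+s. ennreal (4 / (?N * \<tau>)) * ennreal (?h ((?N - 3) / 2) s) \<partial>lborel)"
      by (rule nn_integral_add) measurable
    also have "(\<integral>\<^sup>+s. ennreal (4 / (?N * \<tau>)) * ennreal (?h ((?N - 3) / 2) s) \<partial>lborel)
        = ennreal (4 / (?N * \<tau>)) * (\<integral>\<^sup>+s. ennreal (?h ((?N - 3) / 2) s) \<partial>lborel)"
      by (rule nn_integral_cmult) measurable
    also have "ennreal ?c * ((\<integral>\<^sup>+s. ennreal (?h ((?N - 1) / 2) s) \<partial>lborel) + ennreal (4 / (?N * \<tau>)) * (\<integral>\<^sup>+s. ennreal (?h ((?N - 3) / 2) s) \<partial>lborel))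
      = ennreal ?c * (inv_gamma_int ((?N - 1) / 2) (?N * W) + ennreal (4 / (?N * \<tau>)) * inv_gamma_int ((?N - 3) / 2) (?N * W))"
      unfolding inv_gamma_int_def ..
    finally show ?thesis .
  qed
  \<comment> \<open>Both inverse-gamma integrals are scaled to parameter 1 and raised to the common
    shape \<open>(?N + q) / 2\<close>.\<close>
  also have "\<dots> \<le> ennreal ?c * (ennreal ((?N * W) powr (- ((?N - 1) / 2)) * (1 + 2 * exp 1)) * inv_gamma_int ((?N + q) / 2) 1
      + ennreal (4 / (?N * \<tau>)) * (ennreal ((?N * W) powr (- ((?N - 3) / 2)) * (1 + 2 * exp 1)) * inv_gamma_int ((?N + q) / 2) 1))"
  proof -
    have b: "inv_gamma_int m (?N * W) \<le> ennreal ((?N * W) powr (- m) * (1 + 2 * exp 1)) * inv_gamma_int ((?N + q) / 2) 1"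
      if "1 \<le> m" "m \<le> (?N + q) / 2" for m
    proof -
      have "inv_gamma_int m (?N * W) = ennreal ((?N * W) powr (- m)) * inv_gamma_int m 1"
        using n0 W by (intro inv_gamma_int_scale) auto
      also have "\<dots> \<le> ennreal ((?N * W) powr (- m)) * (ennreal (1 + 2 * exp 1) * inv_gamma_int ((?N + q) / 2) 1)"
        using that by (intro mult_left_mono inv_gamma_int_mono) auto
      finally show ?thesis by (simp add: ennreal_mult mult.assoc)
    qed
    show ?thesis
      by (intro mult_left_mono add_mono b) (use n q in auto)
  qed
  also have "\<dots> = ennreal (?c * (((?N * W) powr (- ((?N - 1) / 2)) + 4 / (?N * \<tau>) * (?N * W) powr (- ((?N - 3) / 2))) * (1 + 2 * exp 1)))
      * inv_gamma_int ((?N + q) / 2) 1"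
  proof -
    have c0: "?c \<ge> 0" using det(1) \<tau> by (intro mult_nonneg_nonneg) auto
    have e: "ennreal x * (ennreal (y * t) * K + ennreal z * (ennreal (w * t) * K)) = ennreal (x * ((y + z * w) * t)) * K"
      if "x \<ge> 0" "y \<ge> 0" "z \<ge> 0" "w \<ge> 0" "t \<ge> 0" for x y z w t K
      using that by (simp add: ennreal_mult ennreal_plus distrib_left distrib_right mult_ac)
    show ?thesis by (rule e) (use c0 \<tau> in auto)
  qed
  finally have "(\<integral>\<^sup>+\<theta>. f \<theta> \<partial>?M) \<le> ennreal (sqrt (2 * pi / (c * ?N)) ^ card \<gamma>) * (ennreal (?c * (((?N * W) powr (- ((?N - 1) / 2))
      + 4 / (?N * \<tau>) * (?N * W) powr (- ((?N - 3) / 2))) * (1 + 2 * exp 1))) * inv_gamma_int ((?N + q) / 2) 1)"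
    by (simp add: mult_left_mono)
  also have "\<dots> = ennreal (sqrt (2 * pi / (c * ?N)) ^ card \<gamma> * (?c * (((?N * W) powr (- ((?N - 1) / 2))
      + 4 / (?N * \<tau>) * (?N * W) powr (- ((?N - 3) / 2))) * (1 + 2 * exp 1)))) * inv_gamma_int ((?N + q) / 2) 1"
    using c n0 by (subst ennreal_mult'') (auto simp: mult.assoc det(1) \<tau> less_imp_le intro!: mult_nonneg_nonneg)
  also have "\<dots> \<le> ennreal ((2 * pi * ?N * W) powr (- ?N / 2)
        * (sqrt M * sqrt (4 * pi / \<tau>) * (1 + 2 * exp 1) * (W powr (1/2) + 4 / \<tau> * W powr (3/2))))
      * inv_gamma_int ((?N + q) / 2) 1"
  proof (intro mult_right_mono ennreal_leI)
    have cn: "c * ?N > 0" using c n0 by simp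
    \<comment> \<open>The powers of \<open>2 * pi\<close> cancel: the prior mass is bounded by the
      square root of the Gram determinant over that of \<open>c * ?N\<close> times the
      identity.\<close>
    have "sqrt (2 * pi / (c * ?N)) ^ card \<gamma> * ((2 * pi) powr (- real (card \<gamma>) / 2) * sqrt ?dt) = sqrt (?dt / (c * ?N) ^ card \<gamma>)"
    proof -
      have "(2 * pi) powr (- real (card \<gamma>) / 2) = 1 / sqrt (2 * pi) ^ card \<gamma>"
        by (simp add: powr_minus_divide powr_half_sqrt[symmetric] powr_powr flip: powr_realpow)
      then show ?thesis using cn by (simp add: real_sqrt_divide real_sqrt_power power_divide)
    qed
    also have "\<dots> \<le> sqrt M" using det(2) cn by (simp add: divide_le_eq)
    finally have D: "sqrt (2 * pi / (c * ?N)) ^ card \<gamma> * ((2 * pi) powr (- real (card \<gamma>) / 2) * sqrt ?dt) \<le> sqrt M" .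
    have sN: "sqrt (4 * pi / (?N * \<tau>)) = sqrt (4 * pi / \<tau>) * ?N powr (- 1/2)"
      using n0 by (simp add: powr_minus_divide powr_half_sqrt real_sqrt_divide real_sqrt_mult)
    have pw: "(?N * W) powr b = (?N * W) powr (- ?N / 2) * (?N powr a * W powr a)" if "b = - ?N / 2 + a" for a b
      using n0 W unfolding that powr_add by (simp add: powr_mult)
    \<comment> \<open>The intercept's factor \<open>?N powr (- 1/2)\<close> cancels the excess power
      of \<open>?N\<close> left by the shape; the next identity does the same with the additional
      \<open>1 / ?N\<close>.\<close>
    have p1: "?N powr (- 1/2) * (?N * W) powr (- ((?N - 1) / 2)) = (?N * W) powr (- ?N / 2) * W powr (1/2)"
    proof -
      have "(?N * W) powr (- ((?N - 1) / 2)) = (?N * W) powr (- ?N / 2) * (?N powr (1/2) * W powr (1/2))"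
        by (rule pw) (simp add: field_simps)
      moreover have "?N powr (- 1/2) * ?N powr (1/2) = 1" using n0 by (simp flip: powr_add)
      ultimately show ?thesis by (simp add: mult_ac)
    qed
    have p2: "?N powr (- 1/2) * (4 / (?N * \<tau>) * (?N * W) powr (- ((?N - 3) / 2))) = (?N * W) powr (- ?N / 2) * (4 / \<tau> * W powr (3/2))"
    proof -
      have "(?N * W) powr (- ((?N - 3) / 2)) = (?N * W) powr (- ?N / 2) * (?N powr (3/2) * W powr (3/2))"
        by (rule pw) (simp add: field_simps)
      moreover have "?N powr (- 1/2) * ?N powr (3/2) = ?N" using n0 by (simp flip: powr_add)
      then have "?N powr (- 1/2) * ?N powr (3/2) / ?N = 1" using n0 by simp
      ultimately show ?thesis by (simp add: mult_ac divide_simps)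
    qed
    have tp: "(2 * pi * ?N * W) powr (- ?N / 2) = (2 * pi) powr (- ?N / 2) * (?N * W) powr (- ?N / 2)"
      using n0 W by (simp add: mult.assoc flip: powr_mult)
    have "sqrt (2 * pi / (c * ?N)) ^ card \<gamma> * (?c * (((?N * W) powr (- ((?N - 1) / 2))
      + 4 / (?N * \<tau>) * (?N * W) powr (- ((?N - 3) / 2))) * (1 + 2 * exp 1)))
      = (sqrt (2 * pi / (c * ?N)) ^ card \<gamma> * ((2 * pi) powr (- real (card \<gamma>) / 2) * sqrt ?dt))
        * ((2 * pi) powr (- ?N / 2) * sqrt (4 * pi / \<tau>) * (1 + 2 * exp 1)
          * (?N powr (- 1/2) * (?N * W) powr (- ((?N - 1) / 2)) + ?N powr (- 1/2) * (4 / (?N * \<tau>) * (?N * W) powr (- ((?N - 3) / 2)))))"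
      unfolding sN by (simp only: distrib_left distrib_right mult_ac)
    also have "\<dots> \<le> sqrt M * ((2 * pi) powr (- ?N / 2) * sqrt (4 * pi / \<tau>) * (1 + 2 * exp 1)
          * (?N powr (- 1/2) * (?N * W) powr (- ((?N - 1) / 2)) + ?N powr (- 1/2) * (4 / (?N * \<tau>) * (?N * W) powr (- ((?N - 3) / 2)))))"
      using \<tau> by (intro mult_right_mono D mult_nonneg_nonneg add_nonneg_nonneg) auto
    also have "\<dots> = (2 * pi * ?N * W) powr (- ?N / 2)
        * (sqrt M * sqrt (4 * pi / \<tau>) * (1 + 2 * exp 1) * (W powr (1/2) + 4 / \<tau> * W powr (3/2)))"
      unfolding p1 p2 tp by (simp only: distrib_left distrib_right mult_ac)
    finally show "sqrt (2 * pi / (c * ?N)) ^ card \<gamma> * (?c * (((?N * W) powr (- ((?N - 1) / 2))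
      + 4 / (?N * \<tau>) * (?N * W) powr (- ((?N - 3) / 2))) * (1 + 2 * exp 1)))
      \<le> (2 * pi * ?N * W) powr (- ?N / 2)
        * (sqrt M * sqrt (4 * pi / \<tau>) * (1 + 2 * exp 1) * (W powr (1/2) + 4 / \<tau> * W powr (3/2)))" .
  qed simp
  finally show ?thesis unfolding f_def .
qed

lemma powr_half_nat: "x powr (real c / 2) = sqrt x ^ c" if "x > 0"
  using that by (simp add: powr_half_sqrt[symmetric] powr_powr flip: powr_realpow)

lemma powr_neg_half_nat: "x powr (- real c / 2) = (1 / sqrt x) ^ c" if "x > 0"
  using powr_half_nat[OF that, of c] that by (simp add: powr_minus_divide power_one_over)

text \<open>On the box the likelihood exponent costs at most \<open>Wl\<close> and the prior
  exponent at most \<open>Wp\<close>, so they merge into one exponential in \<open>Wl + Wp\<close>.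
  The prior normalisation contributes \<open>s\<close> to the power
  \<open>- card \<gamma> / 2\<close>, whence the shape \<open>(n + card \<gamma>) / 2\<close>. The
  constants depend on the box but not on \<open>n\<close>.\<close>

lemma nn_integral_joint_dens_ge:
  assumes \<gamma>: "\<gamma> \<subseteq> {..<p}" and br: "\<forall>j<p. blk j < k" and a: "a > 2"
    and orth: "\<And>j l. j < p \<Longrightarrow> l < p \<Longrightarrow> blk j \<noteq> blk l \<Longrightarrow> gram X n j l = 0"
    and n: "n > 0"
    and C: "\<And>v. quad {..<p} (gram X n) v \<le> C * real n * (\<Sum>j<p. (v j)\<^sup>2)" "C \<ge> 0"
    and det: "m * real n ^ card \<gamma> \<le> det_on \<gamma> (gram X n)" "m \<ge> 0"
    and d: "d > 0" and L: "L > 0" and W: "Wl + Wp > 0"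
    and rss: "\<And>\<alpha> \<beta>. \<bar>\<alpha> - \<alpha>t\<bar> \<le> d \<Longrightarrow> \<forall>j\<in>\<gamma>. \<bar>\<beta> j - \<beta>t j\<bar> \<le> d \<Longrightarrow> rss X n \<gamma> y \<alpha> \<beta> \<le> real n * Wl"
    and prior: "\<And>\<beta>. \<forall>j\<in>\<gamma>. \<bar>\<beta> j - \<beta>t j\<bar> \<le> d \<Longrightarrow> C * (\<Sum>j\<in>\<gamma>. (\<beta> j)\<^sup>2) \<le> L * Wp"
  shows "ennreal ((2 * pi * real n * (Wl + Wp)) powr (- real n / 2)
      * ((2 * d) ^ Suc (card \<gamma>) * (2 * pi) powr (- real (card \<gamma>) / 2) * sqrt m * (L + 1) powr (- real (card \<gamma>) / 2)
        * ((a - 2) / 2 * (L + 2) powr (- a / 2)) ^ card (model_blocks k blk \<gamma>) * (Wl + Wp) powr (- real (card \<gamma>) / 2)))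
      * inv_gamma_int ((real n + real (card \<gamma>)) / 2) 1
    \<le> (\<integral>\<^sup>+\<theta>. ennreal (joint_dens a k blk X n \<gamma> y \<theta>) \<partial>param_space k blk \<gamma>)"
proof -
  let ?B = "model_blocks k blk \<gamma>" and ?N = "real n" and ?q = "real (card \<gamma>)" and ?W = "Wl + Wp"
  let ?h = "(a - 2) / 2 * (L + 2) powr (- a / 2)"
  have fin: "finite \<gamma>" using \<gamma> finite_subset by blast
  have n0: "?N > 0" using n by simp
  have h0: "?h \<ge> 0" using a by simp
  have det0: "det_on \<gamma> (gram X n) \<ge> 0"
    using det n0 by (meson mult_nonneg_nonneg order_trans zero_le_power less_imp_le)
  define c1 where "c1 = (2 * pi) powr (- ?N / 2) * ((2 * pi) powr (- ?q / 2) * (sqrt m * ?N powr (?q / 2))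
    * (L + 1) powr (- ?q / 2)) * ?h ^ card ?B"
  have c10: "c1 \<ge> 0" unfolding c1_def using h0 det(2) by (intro mult_nonneg_nonneg) auto
  define A where "A s = c1 * (s powr (- ((?N + ?q) / 2) - 1) * exp (- (?N * ?W) / (2 * s)))" for s
  have J: "joint_dens a k blk X n \<gamma> y \<in> borel_measurable (param_space k blk \<gamma>)"
    by (rule measurable_joint_dens[OF \<gamma> br orth])
  have "ennreal ((2 * d) ^ Suc (card \<gamma>)) * (\<integral>\<^sup>+s. ennreal (indicator {0<..} s * A s) \<partial>lborel)
    \<le> (\<integral>\<^sup>+\<theta>. ennreal (joint_dens a k blk X n \<gamma> y \<theta>) \<partial>param_space k blk \<gamma>)"
  proof (rule nn_integral_param_ge[where \<alpha>t = \<alpha>t and \<beta>t = \<beta>t and L = L, OF fin d])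
    show "(\<lambda>\<theta>. ennreal (joint_dens a k blk X n \<gamma> y \<theta>)) \<in> borel_measurable (param_space k blk \<gamma>)"
      using J by measurable
    show "A \<in> borel_measurable borel" unfolding A_def by measurable
    fix \<alpha> s :: real and \<beta> g :: "nat \<Rightarrow> real"
    assume al: "\<bar>\<alpha> - \<alpha>t\<bar> \<le> d" and s: "s > 0" and be: "\<forall>j\<in>\<gamma>. \<bar>\<beta> j - \<beta>t j\<bar> \<le> d"
      and g: "\<forall>b\<in>?B. L \<le> g b \<and> g b \<le> L + 1"
    let ?r = "\<lambda>j. sqrt (g (blk j) * s)"
    have g0: "\<forall>b\<in>?B. g b > 0" using g L by force
    have gj: "L \<le> g (blk j)" "g (blk j) \<le> L + 1" if "j \<in> \<gamma>" for j
      using g blk_mem_model_blocks[OF \<gamma> br that] by auto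
    have rj: "0 \<le> 1 / ?r j" if "j \<in> \<gamma>" for j
    proof -
      have "g (blk j) > 0" using gj(1)[OF that] L by linarith
      then show ?thesis using s by simp
    qed
    have b1: "exp (- (?N * Wl) / (2 * s)) \<le> exp (- rss X n \<gamma> y \<alpha> \<beta> / (2 * s))"
      using rss[OF al be] s by (simp add: divide_right_mono)
    \<comment> \<open>Large \<open>g\<close> flattens the prior: the form is of order 1 / (L s), so
      a large \<open>L\<close> makes \<open>Wp\<close> as small as desired.\<close>
    have b2: "exp (- (?N * Wp) / (2 * s)) \<le> exp (- quad \<gamma> (gram X n) (\<lambda>j. \<beta> j / ?r j) / 2)"
    proof -
      have "quad \<gamma> (gram X n) (\<lambda>j. \<beta> j / ?r j) \<le> C * ?N * (\<Sum>j\<in>\<gamma>. (\<beta> j / ?r j)\<^sup>2)"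
        by (rule quad_model_le[OF \<gamma> C(1)])
      also have "\<dots> \<le> C * ?N * (\<Sum>j\<in>\<gamma>. (\<beta> j)\<^sup>2 / (L * s))"
      proof (intro mult_left_mono sum_mono)
        fix j assume j: "j \<in> \<gamma>"
        have "(\<beta> j / ?r j)\<^sup>2 = (\<beta> j)\<^sup>2 / (g (blk j) * s)"
          using gj[OF j] L s by (simp add: power_divide)
        also have "\<dots> \<le> (\<beta> j)\<^sup>2 / (L * s)"
          using gj[OF j] L s by (intro divide_left_mono mult_right_mono mult_pos_pos) auto
        finally show "(\<beta> j / ?r j)\<^sup>2 \<le> (\<beta> j)\<^sup>2 / (L * s)" .
      qed (use C(2) in auto)
      also have "\<dots> = ?N / (L * s) * (C * (\<Sum>j\<in>\<gamma>. (\<beta> j)\<^sup>2))"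
        by (simp add: mult_ac flip: sum_divide_distrib)
      also have "\<dots> \<le> ?N / (L * s) * (L * Wp)"
        using L s by (intro mult_left_mono prior[OF be]) auto
      also have "\<dots> = ?N * Wp / s" using L by simp
      finally show ?thesis using s by (simp add: field_simps)
    qed
    have b3: "(L + 1) powr (- ?q / 2) * s powr (- ?q / 2) \<le> (\<Prod>j\<in>\<gamma>. 1 / ?r j)"
    proof -
      have "(L + 1) powr (- ?q / 2) * s powr (- ?q / 2) = (\<Prod>j\<in>\<gamma>. 1 / sqrt ((L + 1) * s))"
        using L s powr_neg_half_nat[of "(L + 1) * s" "card \<gamma>"] by (simp add: powr_mult)
      also have "\<dots> \<le> (\<Prod>j\<in>\<gamma>. 1 / ?r j)"
      proof (intro prod_mono conjI divide_left_mono)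
        fix j assume j: "j \<in> \<gamma>"
        show "?r j \<le> sqrt ((L + 1) * s)" using gj[OF j] s by simp
        show "0 < sqrt ((L + 1) * s) * ?r j" using gj[OF j] s L by simp
      qed (use L s in auto)
      finally show ?thesis .
    qed
    \<comment> \<open>The hyper-g density decreases, so its smallest value on the box is at
      \<open>g b = L + 1\<close>, where \<open>1 + g b = L + 2\<close>.\<close>
    have b4: "?h ^ card ?B \<le> (\<Prod>b\<in>?B. hyperg_density a (g b))"
    proof -
      have "?h ^ card ?B = (\<Prod>b\<in>?B. ?h)" by simp
      also have "\<dots> \<le> (\<Prod>b\<in>?B. hyperg_density a (g b))"
      proof (intro prod_mono conjI h0)
        fix b assume b: "b \<in> ?B"
        have "(L + 2) powr (- a / 2) \<le> (1 + g b) powr (- a / 2)"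
          using g b g0 a L by (intro powr_mono2') auto
        then show "?h \<le> hyperg_density a (g b)"
          using b g0 a by (simp add: hyperg_density_def mult_left_mono)
      qed
      finally show ?thesis .
    qed
    have b5: "sqrt m * ?N powr (?q / 2) \<le> sqrt (det_on \<gamma> (gram X n))"
    proof -
      have "sqrt m * ?N powr (?q / 2) = sqrt (m * ?N ^ card \<gamma>)"
        using powr_half_nat[OF n0] by (simp add: real_sqrt_mult real_sqrt_power)
      then show ?thesis using det(1) by simp
    qed
    have F: "s powr (- ((?N + ?q) / 2) - 1) = s powr (- ?N / 2) * s powr (- ?q / 2) * (1 / s)"
    proof -
      have "s powr (- ?N / 2) * s powr (- ?q / 2) * s powr (-1) = s powr (- ?N / 2 + - ?q / 2 + -1)"
        by (simp only: powr_add)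
      also have "- ?N / 2 + - ?q / 2 + -1 = - ((?N + ?q) / 2) - 1" by (simp add: field_simps)
      finally show ?thesis using s by (simp add: powr_minus_divide)
    qed
    have G: "exp (- (?N * ?W) / (2 * s)) = exp (- (?N * Wl) / (2 * s)) * exp (- (?N * Wp) / (2 * s))"
      by (simp add: distrib_left add_divide_distrib diff_divide_distrib flip: exp_add)
    have P: "(2 * pi * s) powr (- ?N / 2) = (2 * pi) powr (- ?N / 2) * s powr (- ?N / 2)"
      using s by (simp add: powr_mult)
    have "A s = (2 * pi * s) powr (- ?N / 2) * exp (- (?N * Wl) / (2 * s)) * (1 / s)
      * ((2 * pi) powr (- ?q / 2) * (sqrt m * ?N powr (?q / 2)) * ((L + 1) powr (- ?q / 2) * s powr (- ?q / 2))
         * exp (- (?N * Wp) / (2 * s))) * ?h ^ card ?B"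
      unfolding A_def c1_def F G P by (simp only: mult_ac)
    also have "\<dots> \<le> (2 * pi * s) powr (- ?N / 2) * exp (- rss X n \<gamma> y \<alpha> \<beta> / (2 * s)) * (1 / s)
      * ((2 * pi) powr (- ?q / 2) * sqrt (det_on \<gamma> (gram X n)) * (\<Prod>j\<in>\<gamma>. 1 / ?r j)
         * exp (- quad \<gamma> (gram X n) (\<lambda>j. \<beta> j / ?r j) / 2)) * (\<Prod>b\<in>?B. hyperg_density a (g b))"
    proof (rule mult_mono[OF mult_mono[OF mult_right_mono[OF mult_left_mono[OF b1]] mult_mono[OF mult_mono[OF mult_left_mono[OF b5] b3] b2]] b4])
      have R0: "0 \<le> (\<Prod>j\<in>\<gamma>. 1 / ?r j)" using rj by (intro prod_nonneg) auto
      then show "0 \<le> (2 * pi) powr (- ?q / 2) * sqrt (det_on \<gamma> (gram X n)) * (\<Prod>j\<in>\<gamma>. 1 / ?r j)"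
        using det0 by (intro mult_nonneg_nonneg) auto
      show "0 \<le> (2 * pi * s) powr (- ?N / 2) * exp (- rss X n \<gamma> y \<alpha> \<beta> / (2 * s)) * (1 / s)
      * ((2 * pi) powr (- ?q / 2) * sqrt (det_on \<gamma> (gram X n)) * (\<Prod>j\<in>\<gamma>. 1 / ?r j)
         * exp (- quad \<gamma> (gram X n) (\<lambda>j. \<beta> j / ?r j) / 2))"
        using s det0 R0 by (intro mult_nonneg_nonneg) auto
      show "0 \<le> (2 * pi) powr (- ?q / 2) * (sqrt m * ?N powr (?q / 2)) * ((L + 1) powr (- ?q / 2) * s powr (- ?q / 2))
         * exp (- (?N * Wp) / (2 * s))"
        using det(2) by (intro mult_nonneg_nonneg) auto
    qed (use s det0 h0 in auto)
    also have "\<dots> = joint_dens a k blk X n \<gamma> y (\<alpha>, s, \<beta>, g)"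
      by (rule joint_dens_eq[where p = p and blk = blk and X = X and n = n, OF \<gamma> br orth s g0, symmetric])
    finally show "ennreal (A s) \<le> ennreal (joint_dens a k blk X n \<gamma> y (\<alpha>, s, \<beta>, g))"
      by (rule ennreal_leI)
  qed
  moreover have "(\<integral>\<^sup>+s. ennreal (indicator {0<..} s * A s) \<partial>lborel) = ennreal c1 * inv_gamma_int ((?N + ?q) / 2) (?N * ?W)"
  proof -
    have "(\<integral>\<^sup>+s. ennreal (indicator {0<..} s * A s) \<partial>lborel) = (\<integral>\<^sup>+s. ennreal c1 *
        ennreal (indicator {0<..} s * (s powr (- ((?N + ?q) / 2) - 1) * exp (- (?N * ?W) / (2 * s)))) \<partial>lborel)"
      using c10 by (intro nn_integral_cong) (simp add: A_def mult_ac flip: ennreal_mult')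
    then show ?thesis unfolding inv_gamma_int_def by (simp only:) (rule nn_integral_cmult, measurable)
  qed
  moreover have "inv_gamma_int ((?N + ?q) / 2) (?N * ?W) = ennreal ((?N * ?W) powr (- ((?N + ?q) / 2))) * inv_gamma_int ((?N + ?q) / 2) 1"
    using n0 W by (intro inv_gamma_int_scale) auto
  \<comment> \<open>The determinant supplies \<open>?N\<close> to the power \<open>?q / 2\<close>,
    exactly what the enlarged shape takes away; no polynomial factor in \<open>n\<close>
    survives.\<close>
  moreover have scal: "(2 * d) ^ Suc (card \<gamma>) * (c1 * (?N * ?W) powr (- ((?N + ?q) / 2)))
    = (2 * pi * ?N * ?W) powr (- ?N / 2) * ((2 * d) ^ Suc (card \<gamma>) * (2 * pi) powr (- ?q / 2) * sqrt m * (L + 1) powr (- ?q / 2)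
        * ?h ^ card ?B * ?W powr (- ?q / 2))"
  proof -
    have "(?N * ?W) powr (- ((?N + ?q) / 2)) = (?N * ?W) powr (- ?N / 2 + - ?q / 2)"
      by (rule arg_cong[where f = "\<lambda>x. (?N * ?W) powr x"]) (simp add: field_simps)
    also have "\<dots> = (?N * ?W) powr (- ?N / 2) * (?N powr (- ?q / 2) * ?W powr (- ?q / 2))"
      using n0 W unfolding powr_add by (simp add: powr_mult)
    finally have "?N powr (?q / 2) * (?N * ?W) powr (- ((?N + ?q) / 2))
        = (?N powr (?q / 2) * ?N powr (- ?q / 2)) * ((?N * ?W) powr (- ?N / 2) * ?W powr (- ?q / 2))"
      by (simp only: mult_ac)
    also have "?N powr (?q / 2) * ?N powr (- ?q / 2) = 1" using n0 by (simp flip: powr_add)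
    finally have 1: "?N powr (?q / 2) * (?N * ?W) powr (- ((?N + ?q) / 2)) = (?N * ?W) powr (- ?N / 2) * ?W powr (- ?q / 2)"
      by simp
    have "(2 * d) ^ Suc (card \<gamma>) * (c1 * (?N * ?W) powr (- ((?N + ?q) / 2)))
        = (2 * d) ^ Suc (card \<gamma>) * ((2 * pi) powr (- ?N / 2) * (2 * pi) powr (- ?q / 2) * sqrt m
          * (L + 1) powr (- ?q / 2) * ?h ^ card ?B * (?N powr (?q / 2) * (?N * ?W) powr (- ((?N + ?q) / 2))))"
      unfolding c1_def by (simp only: mult_ac)
    also have "\<dots> = ((2 * pi) powr (- ?N / 2) * (?N * ?W) powr (- ?N / 2)) * ((2 * d) ^ Suc (card \<gamma>) * (2 * pi) powr (- ?q / 2) * sqrt m * (L + 1) powr (- ?q / 2)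
        * ?h ^ card ?B * ?W powr (- ?q / 2))"
      unfolding 1 by (simp only: mult_ac)
    also have "(2 * pi) powr (- ?N / 2) * (?N * ?W) powr (- ?N / 2) = (2 * pi * ?N * ?W) powr (- ?N / 2)"
      using n0 W by (simp add: mult.assoc flip: powr_mult)
    finally show ?thesis .
  qed
  ultimately have "ennreal ((2 * d) ^ Suc (card \<gamma>)) * (ennreal c1 * (ennreal ((?N * ?W) powr (- ((?N + ?q) / 2))) * inv_gamma_int ((?N + ?q) / 2) 1))
    \<le> (\<integral>\<^sup>+\<theta>. ennreal (joint_dens a k blk X n \<gamma> y \<theta>) \<partial>param_space k blk \<gamma>)"
    by (simp only:)
  moreover have "ennreal x * (ennreal z * (ennreal w * K)) = ennreal (x * (z * w)) * K"
    if "x \<ge> 0" "z \<ge> 0" "w \<ge> 0" for x z w K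
    using that by (simp add: ennreal_mult mult.assoc)
  ultimately show ?thesis
    using d c10 unfolding scal[symmetric] by simp
qed

subsection \<open>Posterior concentration\<close>

text \<open>With \<open>p\<close> fixed, entrywise convergence controls the forms uniformly in
  \<open>v\<close> and the determinants of all finitely many submatrices at once.\<close>

lemma gram_asymptotics:
  fixes X :: "nat \<Rightarrow> nat \<Rightarrow> nat \<Rightarrow> real"
  assumes lim: "\<And>j l. j < p \<Longrightarrow> l < p \<Longrightarrow> (\<lambda>n. gram X n j l / real n) \<longlonglongrightarrow> D j l"
    and pd: "\<And>v. (\<exists>j<p. v j \<noteq> 0) \<Longrightarrow> quad {..<p} D v > 0"
  obtains c C :: real and m M :: "nat set \<Rightarrow> real"
  where "0 < c" "c \<le> 1" "1 \<le> C" "\<forall>\<gamma>. \<gamma> \<subseteq> {..<p} \<longrightarrow> m \<gamma> > 0"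
    "eventually (\<lambda>n. (\<forall>v. c * real n * (\<Sum>j<p. (v j)\<^sup>2) \<le> quad {..<p} (gram X n) v) \<and>
       (\<forall>v. quad {..<p} (gram X n) v \<le> C * real n * (\<Sum>j<p. (v j)\<^sup>2)) \<and>
       (\<forall>\<gamma>. \<gamma> \<subseteq> {..<p} \<longrightarrow> m \<gamma> * real n ^ card \<gamma> \<le> det_on \<gamma> (gram X n) \<and>
          det_on \<gamma> (gram X n) \<le> M \<gamma> * (c * real n) ^ card \<gamma>)) sequentially"
proof -
  obtain c' where c': "c' > 0" "\<And>v. quad {..<p} D v \<ge> c' * (\<Sum>j<p. (v j)\<^sup>2)"
    using posdef_coercive[of p D] pd by blast
  \<comment> \<open>Small enough that an entrywise error \<open>\<delta>\<close> costs at most half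
    of the coercivity constant \<open>c'\<close>.\<close>
  define \<delta> where "\<delta> = c' / (2 * (real p + 1))"
  define b where "b = (\<Sum>i<p. \<Sum>j<p. \<bar>D i j\<bar>)"
  \<comment> \<open>The truncations at 1 here and in \<open>C\<close> let the intercept, whose
    coefficient is \<open>real n\<close>, share the constants of the coefficients in
    \<open>rss_bounds\<close>.\<close>
  define c where "c = min (c' / 2) 1"
  define C where "C = max (b * real p + c' / 2) 1"
  have \<delta>: "\<delta> > 0" "\<delta> * real p \<le> c' / 2" using c' unfolding \<delta>_def by (auto simp: field_simps)
  have c: "0 < c" "c \<le> 1" "1 \<le> C" using c' unfolding c_def C_def by auto
  have ev1: "eventually (\<lambda>n. \<forall>i\<in>{..<p}. \<forall>j\<in>{..<p}. \<bar>gram X n i j / real n - D i j\<bar> < \<delta>) sequentially"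
  proof (intro eventually_ball_finite ballI)
    fix i j assume "i \<in> {..<p}" "j \<in> {..<p}"
    then show "eventually (\<lambda>n. \<bar>gram X n i j / real n - D i j\<bar> < \<delta>) sequentially"
      using tendstoD[OF lim \<delta>(1), of i j] by (simp add: dist_real_def)
  qed auto
  have Db: "\<bar>D i j\<bar> \<le> b" if "i < p" "j < p" for i j
  proof -
    have "\<bar>D i j\<bar> \<le> (\<Sum>j<p. \<bar>D i j\<bar>)" using that by (intro member_le_sum) auto
    also have "\<dots> \<le> b" unfolding b_def using that by (intro member_le_sum) (auto simp: sum_nonneg)
    finally show ?thesis .
  qed
  have det_lim: "(\<lambda>n. det_on \<gamma> (gram X n) / real n ^ card \<gamma>) \<longlonglongrightarrow> det_on \<gamma> D" if \<gamma>: "\<gamma> \<subseteq> {..<p}" for \<gamma>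
  proof -
    have fin: "finite \<gamma>" using \<gamma> finite_subset by blast
    have "(\<lambda>n. det_on \<gamma> (\<lambda>i j. gram X n i j / real n)) \<longlonglongrightarrow> det_on \<gamma> D"
      using \<gamma> by (intro det_on_tendsto lim) auto
    moreover have "det_on \<gamma> (\<lambda>i j. gram X n i j / real n) = det_on \<gamma> (gram X n) / real n ^ card \<gamma>" for n
      using det_on_scale[OF fin, of "gram X n" "\<lambda>_. sqrt (real n)"]
      by (simp add: prod_constant flip: power_mult_distrib add: power2_eq_square)
    ultimately show ?thesis by simp
  qed
  have det_pos: "det_on \<gamma> D > 0" if \<gamma>: "\<gamma> \<subseteq> {..<p}" for \<gamma>
  proof (rule det_on_pos)
    show "finite \<gamma>" using \<gamma> finite_subset by blast
    fix v assume v: "\<exists>j\<in>\<gamma>. v j \<noteq> (0::real)"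
    have "quad \<gamma> D v = quad {..<p} D (\<lambda>j. if j \<in> \<gamma> then v j else 0)"
      using \<gamma> by (intro quad_extend) auto
    also have "\<dots> > 0" using v \<gamma> by (intro pd) auto
    finally show "quad \<gamma> D v > 0" .
  qed
  define m where "m \<gamma> = det_on \<gamma> D / 2" for \<gamma>
  \<comment> \<open>Division by \<open>c ^ card \<gamma>\<close> matches the comparison of the
    determinant with \<open>(c * real n) ^ card \<gamma>\<close> in
    \<open>nn_integral_joint_dens_le\<close>.\<close>
  define M where "M \<gamma> = (det_on \<gamma> D + 1) / c ^ card \<gamma>" for \<gamma>
  have ev2: "eventually (\<lambda>n. \<forall>\<gamma>\<in>Pow {..<p}. m \<gamma> < det_on \<gamma> (gram X n) / real n ^ card \<gamma> \<and>
       det_on \<gamma> (gram X n) / real n ^ card \<gamma> < det_on \<gamma> D + 1) sequentially"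
  proof (intro eventually_ball_finite ballI eventually_conj)
    fix \<gamma> assume "\<gamma> \<in> Pow {..<p}"
    then have \<gamma>: "\<gamma> \<subseteq> {..<p}" by simp
    show "eventually (\<lambda>n. m \<gamma> < det_on \<gamma> (gram X n) / real n ^ card \<gamma>) sequentially"
      by (rule order_tendstoD(1)[OF det_lim[OF \<gamma>]]) (use det_pos[OF \<gamma>] in \<open>simp add: m_def\<close>)
    show "eventually (\<lambda>n. det_on \<gamma> (gram X n) / real n ^ card \<gamma> < det_on \<gamma> D + 1) sequentially"
      by (rule order_tendstoD(2)[OF det_lim[OF \<gamma>]]) simp
  qed simp
  show ?thesis
  proof (rule that[of c C m M])
    show "\<forall>\<gamma>. \<gamma> \<subseteq> {..<p} \<longrightarrow> m \<gamma> > 0" using det_pos by (simp add: m_def)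
    show "eventually (\<lambda>n. (\<forall>v. c * real n * (\<Sum>j<p. (v j)\<^sup>2) \<le> quad {..<p} (gram X n) v) \<and>
       (\<forall>v. quad {..<p} (gram X n) v \<le> C * real n * (\<Sum>j<p. (v j)\<^sup>2)) \<and>
       (\<forall>\<gamma>. \<gamma> \<subseteq> {..<p} \<longrightarrow> m \<gamma> * real n ^ card \<gamma> \<le> det_on \<gamma> (gram X n) \<and>
          det_on \<gamma> (gram X n) \<le> M \<gamma> * (c * real n) ^ card \<gamma>)) sequentially"
      using ev1 ev2 eventually_gt_at_top[of 0]
    proof eventually_elim
      case (elim n)
      then have n: "real n > 0" by simp
      let ?E = "\<lambda>i j. gram X n i j / real n - D i j"
      have q: "quad {..<p} (gram X n) v = real n * (quad {..<p} D v + quad {..<p} ?E v)" for v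
        using n unfolding sum.distrib[symmetric] sum_distrib_left
        by (intro sum.cong refl) (simp add: field_simps)
      have E: "\<bar>quad {..<p} ?E v\<bar> \<le> c' / 2 * (\<Sum>j<p. (v j)\<^sup>2)" for v
      proof -
        have "\<bar>quad {..<p} ?E v\<bar> \<le> \<delta> * real p * (\<Sum>j<p. (v j)\<^sup>2)"
        proof (rule quad_diff_bound)
          show "\<bar>?E i j\<bar> \<le> \<delta>" if "i < p" "j < p" for i j
            using elim(1) that by (intro less_imp_le) blast
        qed
        also have "\<dots> \<le> c' / 2 * (\<Sum>j<p. (v j)\<^sup>2)"
          using \<delta> by (intro mult_right_mono) (auto simp: sum_nonneg)
        finally show ?thesis .
      qed
      have "c * real n * (\<Sum>j<p. (v j)\<^sup>2) \<le> quad {..<p} (gram X n) v" for v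
      proof -
        have "c * (\<Sum>j<p. (v j)\<^sup>2) \<le> c' / 2 * (\<Sum>j<p. (v j)\<^sup>2)"
          by (intro mult_right_mono) (auto simp: c_def sum_nonneg)
        also have "\<dots> \<le> quad {..<p} D v + quad {..<p} ?E v"
          using c'(2)[of v] E[of v] by (simp add: abs_le_iff)
        finally show ?thesis unfolding q using n by (simp add: mult.commute mult.left_commute)
      qed
      moreover have "quad {..<p} (gram X n) v \<le> C * real n * (\<Sum>j<p. (v j)\<^sup>2)" for v
      proof -
        have "quad {..<p} D v \<le> b * real p * (\<Sum>j<p. (v j)\<^sup>2)"
          using quad_diff_bound[of p D b v] Db by (auto simp: abs_le_iff)
        then have "quad {..<p} D v + quad {..<p} ?E v \<le> (b * real p + c' / 2) * (\<Sum>j<p. (v j)\<^sup>2)"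
          using E[of v] unfolding distrib_right by linarith
        also have "\<dots> \<le> C * (\<Sum>j<p. (v j)\<^sup>2)"
          by (intro mult_right_mono) (auto simp: C_def sum_nonneg)
        finally show ?thesis unfolding q using n by (simp add: mult.commute mult.left_commute)
      qed
      moreover have "m \<gamma> * real n ^ card \<gamma> \<le> det_on \<gamma> (gram X n) \<and>
          det_on \<gamma> (gram X n) \<le> M \<gamma> * (c * real n) ^ card \<gamma>" if "\<gamma> \<subseteq> {..<p}" for \<gamma>
      proof -
        have "m \<gamma> < det_on \<gamma> (gram X n) / real n ^ card \<gamma>"
          "det_on \<gamma> (gram X n) / real n ^ card \<gamma> < det_on \<gamma> D + 1"
          using elim(2) that by auto
        moreover have "M \<gamma> * (c * real n) ^ card \<gamma> = (det_on \<gamma> D + 1) * real n ^ card \<gamma>"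
          using c unfolding M_def by (simp add: power_mult_distrib)
        ultimately show ?thesis using n by (simp add: pos_less_divide_eq pos_divide_less_eq)
      qed
      ultimately show ?case by blast
    qed
  qed (use c in auto)
qed

locale block_hyperg =
  fixes p k :: nat
    and blk :: "nat \<Rightarrow> nat"
    and X :: "nat \<Rightarrow> nat \<Rightarrow> nat \<Rightarrow> real"
    and D :: "nat \<Rightarrow> nat \<Rightarrow> real"
    and a :: real
    and T :: "nat set"
    and \<alpha>t sig2 :: real
    and \<beta>t :: "nat \<Rightarrow> real"
  assumes blk_range: "\<forall>j<p. blk j < k"
    and X_centered: "\<And>n j. j < p \<Longrightarrow> (\<Sum>i<n. X n i j) = 0"
    and X_orth: "\<And>n j l. j < p \<Longrightarrow> l < p \<Longrightarrow> blk j \<noteq> blk l \<Longrightarrow> gram X n j l = 0"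
    and X_lim: "\<And>j l. j < p \<Longrightarrow> l < p \<Longrightarrow> (\<lambda>n. gram X n j l / real n) \<longlonglongrightarrow> D j l"
    and D_posdef: "\<And>v. (\<exists>j<p. v j \<noteq> 0) \<Longrightarrow> quad {..<p} D v > 0"
    and a_gt: "2 < a"
    and T_sub: "T \<subseteq> {..<p}"
    and \<beta>t_pad: "\<And>j. j \<notin> T \<Longrightarrow> \<beta>t j = 0"
    and sig2_pos: "sig2 > 0"
begin

abbreviation joint :: "nat \<Rightarrow> nat set \<Rightarrow> (nat \<Rightarrow> real) \<Rightarrow> real \<times> real \<times> (nat \<Rightarrow> real) \<times> (nat \<Rightarrow> real) \<Rightarrow> real" where
  "joint n \<gamma> y \<equiv> joint_dens a k blk X n \<gamma> y"

definition dev :: "nat set \<Rightarrow> real \<times> real \<times> (nat \<Rightarrow> real) \<times> (nat \<Rightarrow> real) \<Rightarrow> real" where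
  "dev \<gamma> \<theta> = sq_dev p \<alpha>t \<beta>t \<gamma> (fst \<theta>) (fst (snd (snd \<theta>)))"

lemma dev_nonneg: "dev \<gamma> \<theta> \<ge> 0"
  unfolding dev_def by (rule sq_dev_nonneg)

lemma measurable_coeff: "(\<lambda>\<theta>. if j \<in> \<gamma> then fst (snd (snd \<theta>)) j else 0) \<in> borel_measurable (param_space k blk \<gamma>)"
  by (cases "j \<in> \<gamma>") (auto intro: measurable_param_beta)

lemma measurable_dev: "dev \<gamma> \<in> borel_measurable (param_space k blk \<gamma>)"
proof -
  note [measurable] = measurable_param_alpha measurable_coeff
  show ?thesis unfolding dev_def[abs_def] sq_dev_def by measurable
qed

lemma measurable_joint: "\<gamma> \<subseteq> {..<p} \<Longrightarrow> joint n \<gamma> y \<in> borel_measurable (param_space k blk \<gamma>)"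
  by (rule measurable_joint_dens[OF _ blk_range X_orth])

lemma dev_le_of_close:
  assumes "\<bar>\<alpha> - \<alpha>t\<bar> \<le> d" "\<forall>j\<in>T. \<bar>\<beta> j - \<beta>t j\<bar> \<le> d"
  shows "sq_dev p \<alpha>t \<beta>t T \<alpha> \<beta> \<le> real (Suc p) * d\<^sup>2"
proof -
  have "(\<alpha> - \<alpha>t)\<^sup>2 \<le> d\<^sup>2"
    using power_mono[OF assms(1) abs_ge_zero, of 2] by simp
  moreover have "((if j \<in> T then \<beta> j else 0) - \<beta>t j)\<^sup>2 \<le> d\<^sup>2" for j
  proof (cases "j \<in> T")
    case True
    then show ?thesis using power_mono[OF _ abs_ge_zero, of "\<beta> j - \<beta>t j" d 2] assms(2) by simp
  qed (simp add: \<beta>t_pad)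
  then have "(\<Sum>j<p. ((if j \<in> T then \<beta> j else 0) - \<beta>t j)\<^sup>2) \<le> (\<Sum>j<p. d\<^sup>2)"
    by (intro sum_mono)
  ultimately show ?thesis unfolding sq_dev_def by (simp add: distrib_right)
qed

text \<open>Entirely deterministic on the noise event, and \<open>R\<close> does not depend on
  \<open>y\<close>. Every model is measured against \<open>marg_lik\<close> of \<open>T\<close>
  alone, which bounds the total mass from below up to \<open>prior T\<close>. Integrability is
  stated alongside because the Bochner integral of a non-integrable function is 0 and would make the
  estimate void.\<close>

lemma posterior_concentration:
  assumes \<epsilon>: "\<epsilon> > 0"
  obtains \<eta> :: real and R :: "nat \<Rightarrow> real" where "\<eta> > 0" "R \<longlonglongrightarrow> 0"
    "eventually (\<lambda>n. \<forall>y. noise_event p X sig2 \<eta> n (\<lambda>i. y i - (\<alpha>t + (\<Sum>j\<in>T. X n i j * \<beta>t j))) \<longrightarrow>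
       marg_lik a k blk X n T y > 0 \<and>
       (\<forall>\<gamma>. \<gamma> \<subseteq> {..<p} \<longrightarrow> (\<forall>\<theta>. joint n \<gamma> y \<theta> \<ge> 0) \<and>
         integrable (param_space k blk \<gamma>) (\<lambda>\<theta>. (1 + dev \<gamma> \<theta>) * joint n \<gamma> y \<theta>) \<and>
         (\<integral>\<theta>. (1 + dev \<gamma> \<theta>) * joint n \<gamma> y \<theta> * indicator {\<theta> \<in> space (param_space k blk \<gamma>). dev \<gamma> \<theta> > \<epsilon>} \<theta>
            \<partial>param_space k blk \<gamma>) \<le> R n * marg_lik a k blk X n T y)) sequentially"
proof -
  obtain c C :: real and m M :: "nat set \<Rightarrow> real" where c: "0 < c" "c \<le> 1" "1 \<le> C"
    and m': "\<forall>\<gamma>. \<gamma> \<subseteq> {..<p} \<longrightarrow> m \<gamma> > 0"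
    and ev: "eventually (\<lambda>n. (\<forall>v. c * real n * (\<Sum>j<p. (v j)\<^sup>2) \<le> quad {..<p} (gram X n) v) \<and>
       (\<forall>v. quad {..<p} (gram X n) v \<le> C * real n * (\<Sum>j<p. (v j)\<^sup>2)) \<and>
       (\<forall>\<gamma>. \<gamma> \<subseteq> {..<p} \<longrightarrow> m \<gamma> * real n ^ card \<gamma> \<le> det_on \<gamma> (gram X n) \<and>
          det_on \<gamma> (gram X n) \<le> M \<gamma> * (c * real n) ^ card \<gamma>)) sequentially"
    by (rule gram_asymptotics[OF X_lim D_posdef])
  have m: "m \<gamma> > 0" if "\<gamma> \<subseteq> {..<p}" for \<gamma> using m' that by blast
  let ?q = "real (card T)"
  \<comment> \<open>The residual sum of squares is at least \<open>n (E - \<kappa> + g)\<close> where the deviation exceeds \<open>\<epsilon>\<close>, while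
    likelihood and prior near the truth together cost at most \<open>n (E + 2 \<kappa>)\<close>. Since \<open>\<kappa> \<le> g / 8\<close> and
    \<open>E \<le> 2 sig2\<close>, the quotient of the second by the first is at most \<open>\<rho> < 1\<close>.\<close>
  define g where "g = c * \<epsilon> / 4"
  define \<kappa> where "\<kappa> = min (g / 8) (sig2 / 8)"
  \<comment> \<open>Chosen so that the noise error in the lower residual bound equals
    \<open>\<kappa>\<close>. Below, \<open>d\<close> makes the box cost \<open>\<kappa> / 2\<close>
    in the upper residual bound, the noise taking at most the other half, and \<open>L\<close> makes
    the prior exponent on the box cost at most \<open>\<kappa>\<close>.\<close>
  define \<eta> where "\<eta> = sqrt (c * \<kappa> / (2 * real (Suc p)))"
  define d where "d = sqrt (\<kappa> / (4 * C * real (Suc p)))"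
  define Bq where "Bq = (\<Sum>j\<in>T. (\<bar>\<beta>t j\<bar> + d)\<^sup>2)"
  define L where "L = C * Bq / \<kappa> + 1"
  define Mb where "Mb = (\<Sum>\<gamma>\<in>Pow {..<p}. \<bar>M \<gamma>\<bar>)"
  \<comment> \<open>Common upper bound for the brackets \<open>Wb\<close> (bad region) and
    \<open>W'\<close> (near the truth), since \<open>E \<le> 2 * sig2\<close>.\<close>
  define V where "V = 2 * sig2 + g"
  define \<rho> where "\<rho> = (2 * sig2 + g / 4) / (2 * sig2 + 7 / 8 * g)"
  \<comment> \<open>\<open>K1\<close> and \<open>K2\<close> are the factors of the upper bound (with
    rate \<open>c / 4\<close>) and of the lower bound outside the n-th power. As \<open>K1\<close>
    increases and \<open>K2\<close> decreases in \<open>W\<close>, both may be frozen at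
    \<open>V\<close>, which frees \<open>R\<close> from \<open>y\<close>.\<close>
  define K1 where "K1 W = sqrt Mb * sqrt (4 * pi / (c / 4)) * (1 + 2 * exp 1) * (W powr (1/2) + 4 / (c / 4) * W powr (3/2))" for W
  define K2 where "K2 W = (2 * d) ^ Suc (card T) * (2 * pi) powr (- ?q / 2) * sqrt (m T) * (L + 1) powr (- ?q / 2)
        * ((a - 2) / 2 * (L + 2) powr (- a / 2)) ^ card (model_blocks k blk T) * W powr (- ?q / 2)" for W
  define R where "R n = \<rho> powr (real n / 2) * (K1 V / K2 V)" for n
  have g: "g > 0" using c \<epsilon> unfolding g_def by simp
  have \<kappa>: "\<kappa> > 0" "\<kappa> \<le> g / 8" "\<kappa> \<le> sig2 / 8" using g sig2_pos unfolding \<kappa>_def by auto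
  have \<eta>: "\<eta> > 0" "2 * real (Suc p) * \<eta>\<^sup>2 / c = \<kappa>" using c \<kappa> unfolding \<eta>_def by auto
  have "real (Suc p) * \<eta>\<^sup>2 = c * \<kappa> / 2" using \<eta>(2) c by (simp add: field_simps)
  also have "\<dots> \<le> \<kappa> / 2" using c \<kappa> by simp
  finally have \<eta>2: "real (Suc p) * \<eta>\<^sup>2 \<le> \<kappa> / 2" .
  have d: "d > 0" "2 * C * (real (Suc p) * d\<^sup>2) = \<kappa> / 2" using c \<kappa> unfolding d_def by auto
  have Bq: "Bq \<ge> 0" unfolding Bq_def by (intro sum_nonneg) auto
  have L: "L > 0" "L * \<kappa> = C * Bq + \<kappa>" using c \<kappa> Bq unfolding L_def by (auto simp: field_simps add_pos_nonneg intro!: add_nonneg_pos)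
  have Mb: "M \<gamma> \<le> Mb" if "\<gamma> \<subseteq> {..<p}" for \<gamma>
  proof -
    have "\<bar>M \<gamma>\<bar> \<le> Mb" unfolding Mb_def using that by (intro member_le_sum) auto
    then show ?thesis by linarith
  qed
  have Mb0: "Mb \<ge> 0" unfolding Mb_def by (intro sum_nonneg) auto
  have V: "V > 0" using g sig2_pos unfolding V_def by simp
  have \<rho>: "0 < \<rho>" "\<rho> < 1" using g sig2_pos unfolding \<rho>_def by (auto simp: field_simps intro!: add_pos_pos)
  have K1_mono: "K1 W \<le> K1 V" if "0 < W" "W \<le> V" for W
    unfolding K1_def using that c Mb0
    by (intro mult_left_mono add_mono powr_mono2 mult_nonneg_nonneg) auto
  have K2_pos: "K2 W > 0" if "W > 0" for W
    unfolding K2_def using that d(1) m[OF T_sub] L a_gt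
    by (intro mult_pos_pos zero_less_power) auto
  have K2_anti: "K2 V \<le> K2 W" if "0 < W" "W \<le> V" for W
    unfolding K2_def using that d(1) m[OF T_sub] L a_gt
    by (intro mult_left_mono powr_mono2' mult_nonneg_nonneg zero_le_power) (auto simp: less_imp_le)
  have R: "R \<longlonglongrightarrow> 0"
  proof -
    have "R = (\<lambda>n. (sqrt \<rho>) ^ n * (K1 V / K2 V))"
      unfolding R_def using \<rho> by (intro ext) (simp add: powr_half_nat)
    moreover have "(\<lambda>n. (sqrt \<rho>) ^ n * (K1 V / K2 V)) \<longlonglongrightarrow> 0 * (K1 V / K2 V)"
      by (intro tendsto_mult LIMSEQ_power_zero tendsto_const) (use \<rho> in auto)
    ultimately show ?thesis by simp
  qed
  show ?thesis
  proof (rule that[OF \<eta>(1) R])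
    show "eventually (\<lambda>n. \<forall>y. noise_event p X sig2 \<eta> n (\<lambda>i. y i - (\<alpha>t + (\<Sum>j\<in>T. X n i j * \<beta>t j))) \<longrightarrow>
       marg_lik a k blk X n T y > 0 \<and>
       (\<forall>\<gamma>. \<gamma> \<subseteq> {..<p} \<longrightarrow> (\<forall>\<theta>. joint n \<gamma> y \<theta> \<ge> 0) \<and>
         integrable (param_space k blk \<gamma>) (\<lambda>\<theta>. (1 + dev \<gamma> \<theta>) * joint n \<gamma> y \<theta>) \<and>
         (\<integral>\<theta>. (1 + dev \<gamma> \<theta>) * joint n \<gamma> y \<theta> * indicator {\<theta> \<in> space (param_space k blk \<gamma>). dev \<gamma> \<theta> > \<epsilon>} \<theta>
            \<partial>param_space k blk \<gamma>) \<le> R n * marg_lik a k blk X n T y)) sequentially"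
      using ev eventually_ge_at_top[of 5]
    proof (eventually_elim, intro allI impI)
      fix n y
      assume gram: "(\<forall>v. c * real n * (\<Sum>j<p. (v j)\<^sup>2) \<le> quad {..<p} (gram X n) v) \<and>
         (\<forall>v. quad {..<p} (gram X n) v \<le> C * real n * (\<Sum>j<p. (v j)\<^sup>2)) \<and>
         (\<forall>\<gamma>. \<gamma> \<subseteq> {..<p} \<longrightarrow> m \<gamma> * real n ^ card \<gamma> \<le> det_on \<gamma> (gram X n) \<and>
            det_on \<gamma> (gram X n) \<le> M \<gamma> * (c * real n) ^ card \<gamma>)"
        and n5: "5 \<le> n"
        and event: "noise_event p X sig2 \<eta> n (\<lambda>i. y i - (\<alpha>t + (\<Sum>j\<in>T. X n i j * \<beta>t j)))"
      let ?PS = "param_space k blk"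
      let ?bad = "\<lambda>\<gamma>. {\<theta> \<in> space (?PS \<gamma>). dev \<gamma> \<theta> > \<epsilon>}"
      let ?I = "inv_gamma_int ((real n + ?q) / 2) 1"
      have n: "real n > 0" "n > 0" using n5 by auto
      have low: "\<And>v. c * real n * (\<Sum>j<p. (v j)\<^sup>2) \<le> quad {..<p} (gram X n) v"
        and up: "\<And>v. quad {..<p} (gram X n) v \<le> C * real n * (\<Sum>j<p. (v j)\<^sup>2)"
        using gram by auto
      have det1: "m \<gamma> * real n ^ card \<gamma> \<le> det_on \<gamma> (gram X n)" if "\<gamma> \<subseteq> {..<p}" for \<gamma>
        using gram that by auto
      have det0: "0 \<le> det_on \<gamma> (gram X n)" if "\<gamma> \<subseteq> {..<p}" for \<gamma>
        using det1[OF that] m[OF that] n(1) by (meson less_imp_le mult_pos_pos order_trans zero_less_power)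
      have det2: "det_on \<gamma> (gram X n) \<le> Mb * (c * real n) ^ card \<gamma>" if "\<gamma> \<subseteq> {..<p}" for \<gamma>
      proof -
        have "det_on \<gamma> (gram X n) \<le> M \<gamma> * (c * real n) ^ card \<gamma>" using gram that by auto
        also have "\<dots> \<le> Mb * (c * real n) ^ card \<gamma>"
          using Mb[OF that] c by (intro mult_right_mono) auto
        finally show ?thesis .
      qed
      define e where "e i = y i - (\<alpha>t + (\<Sum>j<p. X n i j * \<beta>t j))" for i
      define E where "E = (\<Sum>i<n. (e i)\<^sup>2) / real n"
      have "(\<Sum>j\<in>T. X n i j * \<beta>t j) = (\<Sum>j<p. X n i j * \<beta>t j)" for i
        using T_sub \<beta>t_pad by (intro sum.mono_neutral_left) auto
      then have "noise_event p X sig2 \<eta> n e"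
        using event by (simp add: e_def[abs_def])
      then have ev1: "\<bar>\<Sum>i<n. e i\<bar> \<le> \<eta> * real n" and ev2: "\<And>j. j < p \<Longrightarrow> \<bar>\<Sum>i<n. X n i j * e i\<bar> \<le> \<eta> * real n"
        and Eb: "sig2 / 2 \<le> E" "E \<le> 2 * sig2"
        using n unfolding noise_event_def E_def by (auto simp: field_simps)
      note rb = rss_bounds[where X = X and n = n and y = y and \<alpha>t = \<alpha>t and \<beta>t = \<beta>t and \<eta> = \<eta> and c = c and C = C and e = e,
          OF _ X_centered e_def ev1 ev2 c low up, folded E_def, unfolded \<eta>(2)]
      define Wb where "Wb = E - \<kappa> + g"
      \<comment> \<open>Here the lower bound \<open>sig2 / 2\<close> on \<open>E\<close> and the cap
        \<open>sig2 / 8\<close> on \<open>\<kappa>\<close> are needed: on the whole space no gap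
        \<open>g\<close> helps to keep the bracket positive.\<close>
      have pos: "E - \<kappa> > 0" using Eb \<kappa> sig2_pos by linarith
      have J0: "joint n \<gamma> y \<theta> \<ge> 0" if "\<gamma> \<subseteq> {..<p}" for \<gamma> \<theta>
        by (rule joint_dens_nonneg[OF that blk_range a_gt X_orth det0[OF that]])
      have I_fin: "?I < \<infinity>" using n5 by (intro inv_gamma_int_finite) auto
      have I_pos: "?I > 0"
      proof -
        have "0 < ennreal (exp (-1) / 2)" by simp
        also have "\<dots> \<le> ?I" using n5 by (intro inv_gamma_int_ge) auto
        finally show ?thesis .
      qed
      obtain I where I: "?I = ennreal I" "I > 0"
        using I_fin I_pos by (cases ?I) auto
      \<comment> \<open>The integral bound on the whole space, with the full rate
        \<open>c / 2\<close>; only its finiteness is used.\<close>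
      have int: "integrable (?PS \<gamma>) (\<lambda>\<theta>. (1 + dev \<gamma> \<theta>) * joint n \<gamma> y \<theta>)" if \<gamma>: "\<gamma> \<subseteq> {..<p}" for \<gamma>
      proof (rule integrableI_nonneg)
        show "(\<lambda>\<theta>. (1 + dev \<gamma> \<theta>) * joint n \<gamma> y \<theta>) \<in> borel_measurable (?PS \<gamma>)"
          using measurable_dev measurable_joint[OF \<gamma>] by measurable
        show "AE \<theta> in ?PS \<gamma>. 0 \<le> (1 + dev \<gamma> \<theta>) * joint n \<gamma> y \<theta>"
          using dev_nonneg J0[OF \<gamma>] by (auto intro!: mult_nonneg_nonneg add_nonneg_nonneg)
        have "(\<integral>\<^sup>+\<theta>. ennreal ((1 + sq_dev p \<alpha>t \<beta>t \<gamma> (fst \<theta>) (fst (snd (snd \<theta>)))) * joint n \<gamma> y \<theta>)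
            * indicator (space (?PS \<gamma>)) \<theta> \<partial>?PS \<gamma>)
          \<le> ennreal ((2 * pi * real n * (E - \<kappa>)) powr (- real n / 2)
            * (sqrt Mb * sqrt (4 * pi / (c / 2)) * (1 + 2 * exp 1) * ((E - \<kappa>) powr (1/2) + 4 / (c / 2) * (E - \<kappa>) powr (3/2)))) * ?I"
          by (rule nn_integral_joint_dens_le[OF \<gamma> blk_range a_gt X_orth n5 c(1) low det0[OF \<gamma>] det2[OF \<gamma>] _ pos _ _ rb(1)[OF \<gamma>]])
            (use c in auto)
        also have "\<dots> < \<infinity>" unfolding I(1) by (simp add: ennreal_mult_less_top)
        also have "(\<integral>\<^sup>+\<theta>. ennreal ((1 + sq_dev p \<alpha>t \<beta>t \<gamma> (fst \<theta>) (fst (snd (snd \<theta>)))) * joint n \<gamma> y \<theta>)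
            * indicator (space (?PS \<gamma>)) \<theta> \<partial>?PS \<gamma>) = (\<integral>\<^sup>+\<theta>. ennreal ((1 + dev \<gamma> \<theta>) * joint n \<gamma> y \<theta>) \<partial>?PS \<gamma>)"
          by (intro nn_integral_cong) (simp add: dev_def)
        finally show "(\<integral>\<^sup>+\<theta>. ennreal ((1 + dev \<gamma> \<theta>) * joint n \<gamma> y \<theta>) \<partial>?PS \<gamma>) < \<infinity>" .
      qed
      have bad: "(\<integral>\<theta>. (1 + dev \<gamma> \<theta>) * joint n \<gamma> y \<theta> * indicator (?bad \<gamma>) \<theta> \<partial>?PS \<gamma>)
          \<le> (2 * pi * real n * Wb) powr (- real n / 2) * K1 Wb * I" if \<gamma>: "\<gamma> \<subseteq> {..<p}" for \<gamma>
      proof -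
        have S: "?bad \<gamma> \<in> sets (?PS \<gamma>)" using measurable_dev[of \<gamma>] by measurable
        have r: "real n * (Wb + c / 4 * sq_dev p \<alpha>t \<beta>t \<gamma> \<alpha> \<beta>) \<le> rss X n \<gamma> y \<alpha> \<beta>"
          if "(\<alpha>, s, \<beta>, gg) \<in> ?bad \<gamma>" for \<alpha> s \<beta> gg
        proof -
          have "sq_dev p \<alpha>t \<beta>t \<gamma> \<alpha> \<beta> > \<epsilon>" using that by (simp add: dev_def)
          then have "c / 4 * \<epsilon> \<le> c / 4 * sq_dev p \<alpha>t \<beta>t \<gamma> \<alpha> \<beta>" using c by (intro mult_left_mono) auto
          \<comment> \<open>Half of the growth in U is converted into the constant gap
            \<open>g = c * \<epsilon> / 4\<close>; the other half remains as the rate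
            \<open>c / 4\<close> that makes the integral converge.\<close>
          then have "Wb + c / 4 * sq_dev p \<alpha>t \<beta>t \<gamma> \<alpha> \<beta> \<le> E - \<kappa> + c / 2 * sq_dev p \<alpha>t \<beta>t \<gamma> \<alpha> \<beta>"
            unfolding Wb_def g_def by (simp add: mult.commute[of c \<epsilon>])
          then have "real n * (Wb + c / 4 * sq_dev p \<alpha>t \<beta>t \<gamma> \<alpha> \<beta>) \<le> real n * (E - \<kappa> + c / 2 * sq_dev p \<alpha>t \<beta>t \<gamma> \<alpha> \<beta>)"
            using n by (intro mult_left_mono) auto
          also have "\<dots> \<le> rss X n \<gamma> y \<alpha> \<beta>" by (rule rb(1)[OF \<gamma>])
          finally show ?thesis .
        qed
        have "ennreal (\<integral>\<theta>. (1 + dev \<gamma> \<theta>) * joint n \<gamma> y \<theta> * indicator (?bad \<gamma>) \<theta> \<partial>?PS \<gamma>)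
            = (\<integral>\<^sup>+\<theta>. ennreal ((1 + dev \<gamma> \<theta>) * joint n \<gamma> y \<theta> * indicator (?bad \<gamma>) \<theta>) \<partial>?PS \<gamma>)"
          using dev_nonneg J0[OF \<gamma>]
          by (intro nn_integral_eq_integral[symmetric] integrable_real_mult_indicator[OF S int[OF \<gamma>]])
             (auto intro!: mult_nonneg_nonneg add_nonneg_nonneg)
        also have "\<dots> = (\<integral>\<^sup>+\<theta>. ennreal ((1 + sq_dev p \<alpha>t \<beta>t \<gamma> (fst \<theta>) (fst (snd (snd \<theta>)))) * joint n \<gamma> y \<theta>)
            * indicator (?bad \<gamma>) \<theta> \<partial>?PS \<gamma>)"
          by (intro nn_integral_cong) (simp add: dev_def indicator_def)
        also have "\<dots> \<le> ennreal ((2 * pi * real n * Wb) powr (- real n / 2) * K1 Wb) * ?I"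
          unfolding K1_def
          by (rule nn_integral_joint_dens_le[OF \<gamma> blk_range a_gt X_orth n5 c(1) low det0[OF \<gamma>] det2[OF \<gamma>] _ _ _ S r])
            (use c pos g in \<open>auto simp: Wb_def\<close>)
        also have "\<dots> = ennreal ((2 * pi * real n * Wb) powr (- real n / 2) * K1 Wb * I)"
          unfolding I(1) using I(2) by (simp add: ennreal_mult'')
        finally show ?thesis
          by (rule ennreal_le_iff[THEN iffD1, rotated])
             (use I Mb0 c in \<open>auto simp: K1_def intro!: mult_nonneg_nonneg add_nonneg_nonneg\<close>)
      qed
      \<comment> \<open>One \<open>\<kappa>\<close> for the likelihood on the box, one for the prior
        exponent.\<close>
      define W' where "W' = E + \<kappa> + \<kappa>"
      have mT: "(2 * pi * real n * W') powr (- real n / 2) * K2 W' * I \<le> marg_lik a k blk X n T y"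
      proof -
        have J1: "integrable (?PS T) (joint n T y)"
        proof (rule Bochner_Integration.integrable_bound[OF int[OF T_sub] measurable_joint[OF T_sub]])
          show "AE \<theta> in ?PS T. norm (joint n T y \<theta>) \<le> norm ((1 + dev T \<theta>) * joint n T y \<theta>)"
          proof (rule AE_I2)
            fix \<theta>
            have "0 \<le> dev T \<theta> * joint n T y \<theta>" by (intro mult_nonneg_nonneg dev_nonneg J0 T_sub)
            then show "norm (joint n T y \<theta>) \<le> norm ((1 + dev T \<theta>) * joint n T y \<theta>)"
              using J0[OF T_sub, of \<theta>] by (simp add: distrib_right)
          qed
        qed
        have r: "rss X n T y \<alpha> \<beta> \<le> real n * (E + \<kappa>)"
          if "\<bar>\<alpha> - \<alpha>t\<bar> \<le> d" "\<forall>j\<in>T. \<bar>\<beta> j - \<beta>t j\<bar> \<le> d" for \<alpha> \<beta>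
        proof -
          have "rss X n T y \<alpha> \<beta> \<le> real n * (E + real (Suc p) * \<eta>\<^sup>2 + 2 * C * sq_dev p \<alpha>t \<beta>t T \<alpha> \<beta>)"
            by (rule rb(2)[OF T_sub])
          also have "\<dots> \<le> real n * (E + \<kappa> / 2 + 2 * C * (real (Suc p) * d\<^sup>2))"
            using c by (intro mult_left_mono add_mono \<eta>2 dev_le_of_close that order_refl) auto
          also have "\<dots> = real n * (E + \<kappa>)" unfolding d(2) by simp
          finally show ?thesis .
        qed
        have pr: "C * (\<Sum>j\<in>T. (\<beta> j)\<^sup>2) \<le> L * \<kappa>" if "\<forall>j\<in>T. \<bar>\<beta> j - \<beta>t j\<bar> \<le> d" for \<beta>
        proof -
          have "(\<beta> j)\<^sup>2 \<le> (\<bar>\<beta>t j\<bar> + d)\<^sup>2" if "j \<in> T" for j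
          proof -
            have "\<bar>\<beta> j\<bar> \<le> \<bar>\<beta>t j\<bar> + d" using \<open>\<forall>j\<in>T. \<bar>\<beta> j - \<beta>t j\<bar> \<le> d\<close> that by fastforce
            then show ?thesis by (metis abs_ge_zero power2_abs power_mono)
          qed
          then have "C * (\<Sum>j\<in>T. (\<beta> j)\<^sup>2) \<le> C * Bq"
            unfolding Bq_def using c by (intro mult_left_mono sum_mono) auto
          then show ?thesis unfolding L(2) using \<kappa> by linarith
        qed
        have "ennreal ((2 * pi * real n * W') powr (- real n / 2) * K2 W') * ?I \<le> (\<integral>\<^sup>+\<theta>. ennreal (joint n T y \<theta>) \<partial>?PS T)"
          unfolding K2_def W'_def
          by (rule nn_integral_joint_dens_ge[OF T_sub blk_range a_gt X_orth n(2) up _ det1[OF T_sub] _ d(1) L(1) _ r pr])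
            (use c m[OF T_sub] pos \<kappa> in auto)
        also have "\<dots> = ennreal (marg_lik a k blk X n T y)"
          unfolding marg_lik_def by (rule nn_integral_eq_integral[OF J1]) (use J0[OF T_sub] in auto)
        finally have "ennreal ((2 * pi * real n * W') powr (- real n / 2) * K2 W' * I) \<le> ennreal (marg_lik a k blk X n T y)"
          unfolding I(1) using I(2) by (simp add: ennreal_mult'')
        then show ?thesis
          by (rule ennreal_le_iff[THEN iffD1, rotated])
             (use J0[OF T_sub] in \<open>auto simp: marg_lik_def intro!: integral_nonneg_AE\<close>)
      qed
      have W': "W' > 0" "W' \<le> V" "Wb > 0" "Wb \<le> V" "W' \<le> \<rho> * Wb"
      proof -
        show "W' > 0" "W' \<le> V" "Wb > 0" "Wb \<le> V"
          using Eb \<kappa> pos g unfolding W'_def Wb_def V_def by linarith+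
        \<comment> \<open>By \<open>\<kappa> \<le> g / 8\<close> the quotient is at most
          \<open>(E + g / 4) / (E + 7 / 8 * g)\<close>. This increases with \<open>E\<close>, so its
          value at \<open>E = 2 * sig2\<close>, which is \<open>\<rho>\<close>, bounds it.\<close>
        have "W' * (2 * sig2 + 7 / 8 * g) \<le> (E + g / 4) * (2 * sig2 + 7 / 8 * g)"
          using \<kappa> g sig2_pos unfolding W'_def by (intro mult_right_mono) auto
        also have "\<dots> \<le> (2 * sig2 + g / 4) * (E + 7 / 8 * g)"
        proof -
          have "(2 * sig2 - E) * g * (5 / 8) \<ge> 0" using Eb g by simp
          moreover have "(2 * sig2 + g / 4) * (E + 7 / 8 * g) - (E + g / 4) * (2 * sig2 + 7 / 8 * g) = (2 * sig2 - E) * g * (5 / 8)"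
            by (simp add: field_simps)
          ultimately show ?thesis by linarith
        qed
        also have "\<dots> \<le> (2 * sig2 + g / 4) * Wb"
          using \<kappa> g sig2_pos unfolding Wb_def by (intro mult_left_mono) auto
        finally show "W' \<le> \<rho> * Wb" using g sig2_pos unfolding \<rho>_def by (simp add: field_simps add_pos_pos)
      qed
      have pT: "marg_lik a k blk X n T y > 0"
      proof -
        have "0 < (2 * pi * real n * W') powr (- real n / 2) * K2 W' * I"
          using K2_pos[OF W'(1)] I(2) n W'(1) by (intro mult_pos_pos) auto
        then show ?thesis using mT by linarith
      qed
      have fin: "(\<integral>\<theta>. (1 + dev \<gamma> \<theta>) * joint n \<gamma> y \<theta> * indicator (?bad \<gamma>) \<theta> \<partial>?PS \<gamma>)
          \<le> R n * marg_lik a k blk X n T y" if \<gamma>: "\<gamma> \<subseteq> {..<p}" for \<gamma>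
      proof -
        \<comment> \<open>The exponent is negative, so \<open>Wb\<close> may be replaced by the
          smaller \<open>W' / \<rho>\<close>. Extracting \<open>\<rho>\<close> leaves the only
          factor of the quotient that varies with \<open>n\<close>, and it decays
          geometrically.\<close>
        have "(2 * pi * real n * Wb) powr (- real n / 2) \<le> (2 * pi * real n * (W' / \<rho>)) powr (- real n / 2)"
          using W' \<rho> n by (intro powr_mono2' mult_left_mono mult_pos_pos) (auto simp: field_simps)
        also have "(2 * pi * real n * (W' / \<rho>)) = (2 * pi * real n * W') * (1 / \<rho>)" by simp
        also have "((2 * pi * real n * W') * (1 / \<rho>)) powr (- real n / 2) = (2 * pi * real n * W') powr (- real n / 2) * (1 / \<rho>) powr (- real n / 2)"
          by (rule powr_mult)
        also have "(1 / \<rho>) powr (- real n / 2) = \<rho> powr (real n / 2)"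
          using \<rho> by (simp add: powr_divide powr_minus_divide)
        finally have pw: "(2 * pi * real n * Wb) powr (- real n / 2) \<le> (2 * pi * real n * W') powr (- real n / 2) * \<rho> powr (real n / 2)" .
        have K1V: "K1 V \<ge> 0" unfolding K1_def using Mb0 c by (intro mult_nonneg_nonneg add_nonneg_nonneg) auto
        have "(\<integral>\<theta>. (1 + dev \<gamma> \<theta>) * joint n \<gamma> y \<theta> * indicator (?bad \<gamma>) \<theta> \<partial>?PS \<gamma>)
          \<le> (2 * pi * real n * Wb) powr (- real n / 2) * K1 Wb * I" by (rule bad[OF \<gamma>])
        also have "\<dots> \<le> ((2 * pi * real n * W') powr (- real n / 2) * \<rho> powr (real n / 2)) * K1 V * I"
          using I(2) K1V by (intro mult_right_mono mult_mono pw K1_mono W' mult_nonneg_nonneg) (auto simp: K1_def Mb0 c less_imp_le intro!: mult_nonneg_nonneg add_nonneg_nonneg)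
        also have "\<dots> = R n * ((2 * pi * real n * W') powr (- real n / 2) * K2 V * I)"
          unfolding R_def using K2_pos[OF V] by simp
        also have "\<dots> \<le> R n * ((2 * pi * real n * W') powr (- real n / 2) * K2 W' * I)"
          using I(2) K1V K2_pos[OF V] by (intro mult_left_mono mult_right_mono K2_anti W') (auto simp: R_def)
        also have "\<dots> \<le> R n * marg_lik a k blk X n T y"
          using K1V K2_pos[OF V] by (intro mult_left_mono mT) (auto simp: R_def)
        finally show ?thesis .
      qed
      show "marg_lik a k blk X n T y > 0 \<and>
       (\<forall>\<gamma>. \<gamma> \<subseteq> {..<p} \<longrightarrow> (\<forall>\<theta>. joint n \<gamma> y \<theta> \<ge> 0) \<and>
         integrable (?PS \<gamma>) (\<lambda>\<theta>. (1 + dev \<gamma> \<theta>) * joint n \<gamma> y \<theta>) \<and>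
         (\<integral>\<theta>. (1 + dev \<gamma> \<theta>) * joint n \<gamma> y \<theta> * indicator (?bad \<gamma>) \<theta> \<partial>?PS \<gamma>) \<le> R n * marg_lik a k blk X n T y)"
        using pT J0 int fin by blast
    qed
  qed
qed


subsection \<open>The averaged prediction\<close>

definition coeff :: "nat set \<Rightarrow> nat \<Rightarrow> real \<times> real \<times> (nat \<Rightarrow> real) \<times> (nat \<Rightarrow> real) \<Rightarrow> real" where
  "coeff \<gamma> j \<theta> = (if j \<in> \<gamma> then fst (snd (snd \<theta>)) j else 0)"

lemma abs_dev_le:
  shows "\<bar>fst \<theta> - \<alpha>t\<bar> \<le> sqrt (dev \<gamma> \<theta>)" "j < p \<Longrightarrow> \<bar>coeff \<gamma> j \<theta> - \<beta>t j\<bar> \<le> sqrt (dev \<gamma> \<theta>)"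
proof -
  have 0: "(\<Sum>j<p. (coeff \<gamma> j \<theta> - \<beta>t j)\<^sup>2) \<ge> 0" by (simp add: sum_nonneg)
  have d: "dev \<gamma> \<theta> = (fst \<theta> - \<alpha>t)\<^sup>2 + (\<Sum>j<p. (coeff \<gamma> j \<theta> - \<beta>t j)\<^sup>2)"
    unfolding dev_def sq_dev_def coeff_def ..
  show "\<bar>fst \<theta> - \<alpha>t\<bar> \<le> sqrt (dev \<gamma> \<theta>)" unfolding d using 0 by (intro real_le_rsqrt) simp
  show "\<bar>coeff \<gamma> j \<theta> - \<beta>t j\<bar> \<le> sqrt (dev \<gamma> \<theta>)" if "j < p"
  proof (rule real_le_rsqrt)
    have "(coeff \<gamma> j \<theta> - \<beta>t j)\<^sup>2 \<le> (\<Sum>j<p. (coeff \<gamma> j \<theta> - \<beta>t j)\<^sup>2)"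
      using that by (intro member_le_sum) auto
    then show "\<bar>coeff \<gamma> j \<theta> - \<beta>t j\<bar>\<^sup>2 \<le> dev \<gamma> \<theta>" unfolding d by (simp add: add_increasing)
  qed
qed

text \<open>Lets the single weight \<open>1 + dev\<close> dominate every error linear in the
  parameters.\<close>

lemma sqrt_dev_le: "sqrt (dev \<gamma> \<theta>) \<le> 1 + dev \<gamma> \<theta>"
proof (rule real_le_lsqrt)
  show "dev \<gamma> \<theta> \<le> (1 + dev \<gamma> \<theta>)\<^sup>2"
    using dev_nonneg[of \<gamma> \<theta>] by (simp add: power2_eq_square algebra_simps)
qed (use dev_nonneg[of \<gamma> \<theta>] in auto)

text \<open>Where \<open>dev\<close> is at most \<open>\<epsilon>\<close> the error is of order
  \<open>sqrt \<epsilon>\<close> relative to the total mass. Elsewhere it is at most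
  \<open>r\<close> times the marginal likelihood of \<open>T\<close>, and the total mass is at least
  \<open>prior T\<close> times that. Since the prior weights sum to 1, the number of models does not
  enter.\<close>

lemma bma_pred_error:
  assumes J0: "\<And>\<gamma> \<theta>. \<gamma> \<subseteq> {..<p} \<Longrightarrow> joint n \<gamma> y \<theta> \<ge> 0"
    and int: "\<And>\<gamma>. \<gamma> \<subseteq> {..<p} \<Longrightarrow> integrable (param_space k blk \<gamma>) (\<lambda>\<theta>. (1 + dev \<gamma> \<theta>) * joint n \<gamma> y \<theta>)"
    and pT: "marg_lik a k blk X n T y > 0"
    and bad: "\<And>\<gamma>. \<gamma> \<subseteq> {..<p} \<Longrightarrow>
      (\<integral>\<theta>. (1 + dev \<gamma> \<theta>) * joint n \<gamma> y \<theta> * indicator {\<theta> \<in> space (param_space k blk \<gamma>). dev \<gamma> \<theta> > \<epsilon>} \<theta>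
            \<partial>param_space k blk \<gamma>) \<le> r * marg_lik a k blk X n T y"
    and prior: "\<And>\<gamma>. \<gamma> \<subseteq> {..<p} \<Longrightarrow> prior \<gamma> > 0" "(\<Sum>\<gamma>\<in>Pow {..<p}. prior \<gamma>) = 1"
    and \<epsilon>: "\<epsilon> > 0"
  shows "\<bar>bma_pred a p k blk X prior xs n y - (\<alpha>t + (\<Sum>j<p. xs j * \<beta>t j))\<bar>
    \<le> (1 + (\<Sum>j<p. \<bar>xs j\<bar>)) * (sqrt \<epsilon> + r / prior T)"
proof -
  let ?PS = "param_space k blk" and ?m = "\<lambda>\<gamma>. marg_lik a k blk X n \<gamma> y"
  let ?bad = "\<lambda>\<gamma>. {\<theta> \<in> space (?PS \<gamma>). dev \<gamma> \<theta> > \<epsilon>}"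
  let ?Lx = "1 + (\<Sum>j<p. \<bar>xs j\<bar>)"
  let ?tgt = "\<alpha>t + (\<Sum>j<p. xs j * \<beta>t j)"
  define Tot where "Tot = (\<Sum>\<gamma>\<in>Pow {..<p}. prior \<gamma> * ?m \<gamma>)"
  define lin where "lin \<gamma> \<theta> = fst \<theta> + (\<Sum>j<p. xs j * coeff \<gamma> j \<theta>)" for \<gamma> \<theta>
  have Lx: "?Lx > 0" by (simp add: add_pos_nonneg sum_nonneg)
  have coeff_m: "coeff \<gamma> j \<in> borel_measurable (?PS \<gamma>)" for \<gamma> j
    unfolding coeff_def[abs_def] by (rule measurable_coeff)
  have dom: "integrable (?PS \<gamma>) (\<lambda>\<theta>. f \<theta> * joint n \<gamma> y \<theta>)"
    if \<gamma>: "\<gamma> \<subseteq> {..<p}" and f: "f \<in> borel_measurable (?PS \<gamma>)" "\<And>\<theta>. \<bar>f \<theta>\<bar> \<le> 1 + dev \<gamma> \<theta>" for \<gamma> f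
  proof (rule Bochner_Integration.integrable_bound[OF int[OF \<gamma>]])
    show "(\<lambda>\<theta>. f \<theta> * joint n \<gamma> y \<theta>) \<in> borel_measurable (?PS \<gamma>)"
      using f(1) measurable_joint[OF \<gamma>] by measurable
    show "AE \<theta> in ?PS \<gamma>. norm (f \<theta> * joint n \<gamma> y \<theta>) \<le> norm ((1 + dev \<gamma> \<theta>) * joint n \<gamma> y \<theta>)"
    proof (rule AE_I2)
      fix \<theta>
      have "\<bar>f \<theta>\<bar> \<le> \<bar>1 + dev \<gamma> \<theta>\<bar>" using f(2)[of \<theta>] by linarith
      then show "norm (f \<theta> * joint n \<gamma> y \<theta>) \<le> norm ((1 + dev \<gamma> \<theta>) * joint n \<gamma> y \<theta>)"
        unfolding real_norm_def abs_mult by (intro mult_right_mono) auto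
    qed
  qed
  have i1: "integrable (?PS \<gamma>) (joint n \<gamma> y)" if \<gamma>: "\<gamma> \<subseteq> {..<p}" for \<gamma>
    using dom[OF \<gamma>, of "\<lambda>_. 1"] dev_nonneg by simp
  have i\<alpha>: "integrable (?PS \<gamma>) (\<lambda>\<theta>. fst \<theta> * joint n \<gamma> y \<theta>)" if \<gamma>: "\<gamma> \<subseteq> {..<p}" for \<gamma>
  proof -
    have "integrable (?PS \<gamma>) (\<lambda>\<theta>. (fst \<theta> - \<alpha>t) * joint n \<gamma> y \<theta>)"
      by (intro dom[OF \<gamma>] borel_measurable_diff measurable_param_alpha borel_measurable_const
        order_trans[OF abs_dev_le(1) sqrt_dev_le])
    from Bochner_Integration.integrable_add[OF this integrable_mult_right[OF i1[OF \<gamma>], of \<alpha>t]]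
    show ?thesis by (simp add: algebra_simps)
  qed
  have i\<beta>: "integrable (?PS \<gamma>) (\<lambda>\<theta>. coeff \<gamma> j \<theta> * joint n \<gamma> y \<theta>)" if \<gamma>: "\<gamma> \<subseteq> {..<p}" and j: "j < p" for \<gamma> j
  proof -
    have "integrable (?PS \<gamma>) (\<lambda>\<theta>. (coeff \<gamma> j \<theta> - \<beta>t j) * joint n \<gamma> y \<theta>)"
      by (intro dom[OF \<gamma>] borel_measurable_diff coeff_m borel_measurable_const
        order_trans[OF abs_dev_le(2)[OF j] sqrt_dev_le])
    from Bochner_Integration.integrable_add[OF this integrable_mult_right[OF i1[OF \<gamma>], of "\<beta>t j"]]
    show ?thesis by (simp add: algebra_simps)
  qed
  have m0: "?m \<gamma> \<ge> 0" if "\<gamma> \<subseteq> {..<p}" for \<gamma>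
    unfolding marg_lik_def using J0[OF that] by (intro integral_nonneg_AE) auto
  have Tot: "prior T * ?m T \<le> Tot"
    unfolding Tot_def using T_sub m0 prior(1)
    by (intro member_le_sum) (auto intro!: mult_nonneg_nonneg simp: less_imp_le)
  moreover have T0: "prior T * ?m T > 0" using prior(1)[OF T_sub] pT by simp
  ultimately have Tot0: "Tot > 0" by linarith
  \<comment> \<open>Covers the junk case \<open>?m \<gamma> = 0\<close>, in which the posterior mean is a division by \<open>0\<close>.\<close>
  have cancel: "prior \<gamma> * ?m \<gamma> / Tot * ((\<integral>\<theta>. f \<theta> * joint n \<gamma> y \<theta> \<partial>?PS \<gamma>) / ?m \<gamma>)
      = prior \<gamma> * (\<integral>\<theta>. f \<theta> * joint n \<gamma> y \<theta> \<partial>?PS \<gamma>) / Tot" if \<gamma>: "\<gamma> \<subseteq> {..<p}" for \<gamma> f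
  proof (cases "?m \<gamma> = 0")
    case True
    then have "AE \<theta> in ?PS \<gamma>. joint n \<gamma> y \<theta> = 0"
      using integral_nonneg_eq_0_iff_AE[OF i1[OF \<gamma>]] J0[OF \<gamma>] by (auto simp: marg_lik_def)
    then have "(\<integral>\<theta>. f \<theta> * joint n \<gamma> y \<theta> \<partial>?PS \<gamma>) = 0"
      by (intro integral_eq_zero_AE) auto
    then show ?thesis by simp
  qed simp
  have lin_int: "(\<integral>\<theta>. lin \<gamma> \<theta> * joint n \<gamma> y \<theta> \<partial>?PS \<gamma>)
      = (\<integral>\<theta>. fst \<theta> * joint n \<gamma> y \<theta> \<partial>?PS \<gamma>) + (\<Sum>j<p. xs j * (\<integral>\<theta>. coeff \<gamma> j \<theta> * joint n \<gamma> y \<theta> \<partial>?PS \<gamma>))"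
    and i_lin: "integrable (?PS \<gamma>) (\<lambda>\<theta>. lin \<gamma> \<theta> * joint n \<gamma> y \<theta>)" if \<gamma>: "\<gamma> \<subseteq> {..<p}" for \<gamma>
  proof -
    have e: "lin \<gamma> \<theta> * joint n \<gamma> y \<theta> = fst \<theta> * joint n \<gamma> y \<theta> + (\<Sum>j<p. xs j * (coeff \<gamma> j \<theta> * joint n \<gamma> y \<theta>))" for \<theta>
      unfolding lin_def by (simp add: distrib_right sum_distrib_right mult.assoc)
    have s: "integrable (?PS \<gamma>) (\<lambda>\<theta>. \<Sum>j<p. xs j * (coeff \<gamma> j \<theta> * joint n \<gamma> y \<theta>))"
      using i\<beta>[OF \<gamma>] by (intro Bochner_Integration.integrable_sum integrable_mult_right) auto
    show "integrable (?PS \<gamma>) (\<lambda>\<theta>. lin \<gamma> \<theta> * joint n \<gamma> y \<theta>)"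
      unfolding e by (intro Bochner_Integration.integrable_add i\<alpha>[OF \<gamma>] s)
    show "(\<integral>\<theta>. lin \<gamma> \<theta> * joint n \<gamma> y \<theta> \<partial>?PS \<gamma>)
      = (\<integral>\<theta>. fst \<theta> * joint n \<gamma> y \<theta> \<partial>?PS \<gamma>) + (\<Sum>j<p. xs j * (\<integral>\<theta>. coeff \<gamma> j \<theta> * joint n \<gamma> y \<theta> \<partial>?PS \<gamma>))"
      unfolding e using i\<beta>[OF \<gamma>]
      by (subst Bochner_Integration.integral_add[OF i\<alpha>[OF \<gamma>] s], subst Bochner_Integration.integral_sum)
         (auto intro!: integrable_mult_right)
  qed
  have mean: "post_mean_beta a k blk X n \<gamma> y j = (\<integral>\<theta>. coeff \<gamma> j \<theta> * joint n \<gamma> y \<theta> \<partial>?PS \<gamma>) / ?m \<gamma>" for \<gamma> j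
    unfolding post_mean_beta_def coeff_def by simp
  \<comment> \<open>The marginal likelihood of \<open>\<gamma>\<close> cancels between its posterior
    probability and its conditional means. The prediction becomes one quotient of sums of
    unnormalised integrals, so no conditional mean needs an estimate of its own.\<close>
  have "bma_pred a p k blk X prior xs n y
      = (\<Sum>\<gamma>\<in>Pow {..<p}. prior \<gamma> * ?m \<gamma> / Tot * ((\<integral>\<theta>. fst \<theta> * joint n \<gamma> y \<theta> \<partial>?PS \<gamma>) / ?m \<gamma>)
         + (\<Sum>j<p. xs j * (prior \<gamma> * ?m \<gamma> / Tot * ((\<integral>\<theta>. coeff \<gamma> j \<theta> * joint n \<gamma> y \<theta> \<partial>?PS \<gamma>) / ?m \<gamma>))))"
  proof -
    have "x * (\<Sum>j<p. xs j * z j) = (\<Sum>j<p. xs j * (x * z j))" for x and z :: "nat \<Rightarrow> real"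
      by (simp add: sum_distrib_left mult.left_commute)
    then show ?thesis
      unfolding bma_pred_def bma_alpha_def post_model_prob_def post_mean_alpha_def mean Tot_def[symmetric] sum.distrib
      by (simp only:)
  qed
  also have "\<dots> = (\<Sum>\<gamma>\<in>Pow {..<p}. prior \<gamma> * (\<integral>\<theta>. fst \<theta> * joint n \<gamma> y \<theta> \<partial>?PS \<gamma>) / Tot
         + (\<Sum>j<p. xs j * (prior \<gamma> * (\<integral>\<theta>. coeff \<gamma> j \<theta> * joint n \<gamma> y \<theta> \<partial>?PS \<gamma>) / Tot)))"
    by (intro sum.cong refl) (simp only: cancel Pow_iff)
  also have "\<dots> = (\<Sum>\<gamma>\<in>Pow {..<p}. prior \<gamma> * (\<integral>\<theta>. lin \<gamma> \<theta> * joint n \<gamma> y \<theta> \<partial>?PS \<gamma>)) / Tot"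
    unfolding sum_divide_distrib
  proof (intro sum.cong refl)
    fix \<gamma> assume "\<gamma> \<in> Pow {..<p}"
    then have \<gamma>: "\<gamma> \<subseteq> {..<p}" by simp
    show "prior \<gamma> * (\<integral>\<theta>. fst \<theta> * joint n \<gamma> y \<theta> \<partial>?PS \<gamma>) / Tot
         + (\<Sum>j<p. xs j * (prior \<gamma> * (\<integral>\<theta>. coeff \<gamma> j \<theta> * joint n \<gamma> y \<theta> \<partial>?PS \<gamma>) / Tot))
       = prior \<gamma> * (\<integral>\<theta>. lin \<gamma> \<theta> * joint n \<gamma> y \<theta> \<partial>?PS \<gamma>) / Tot"
    proof -
      have "x * A / t + (\<Sum>j<p. xs j * (x * B j / t)) = x * (A + (\<Sum>j<p. xs j * B j)) / t"
        for x A t and B :: "nat \<Rightarrow> real"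
        by (simp add: distrib_left add_divide_distrib sum_distrib_left sum_divide_distrib mult.left_commute)
      then show ?thesis unfolding lin_int[OF \<gamma>] .
    qed
  qed
  finally have "bma_pred a p k blk X prior xs n y - ?tgt
      = (\<Sum>\<gamma>\<in>Pow {..<p}. prior \<gamma> * (\<integral>\<theta>. lin \<gamma> \<theta> * joint n \<gamma> y \<theta> \<partial>?PS \<gamma>)) / Tot - ?tgt * Tot / Tot"
    using Tot0 by simp
  also have "\<dots> = (\<Sum>\<gamma>\<in>Pow {..<p}. prior \<gamma> * ((\<integral>\<theta>. lin \<gamma> \<theta> * joint n \<gamma> y \<theta> \<partial>?PS \<gamma>) - ?tgt * ?m \<gamma>)) / Tot"
  proof -
    have "?tgt * Tot = (\<Sum>\<gamma>\<in>Pow {..<p}. prior \<gamma> * (?tgt * ?m \<gamma>))"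
      unfolding Tot_def sum_distrib_left by (intro sum.cong refl mult.left_commute)
    then show ?thesis by (simp only: right_diff_distrib sum_subtractf diff_divide_distrib)
  qed
  finally have err: "bma_pred a p k blk X prior xs n y - ?tgt
      = (\<Sum>\<gamma>\<in>Pow {..<p}. prior \<gamma> * ((\<integral>\<theta>. lin \<gamma> \<theta> * joint n \<gamma> y \<theta> \<partial>?PS \<gamma>) - ?tgt * ?m \<gamma>)) / Tot" .
  have lin_le: "\<bar>lin \<gamma> \<theta> - ?tgt\<bar> \<le> ?Lx * sqrt (dev \<gamma> \<theta>)" for \<gamma> \<theta>
  proof -
    have e: "lin \<gamma> \<theta> - ?tgt = (fst \<theta> - \<alpha>t) + (\<Sum>j<p. xs j * (coeff \<gamma> j \<theta> - \<beta>t j))"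
      unfolding lin_def by (simp add: right_diff_distrib sum_subtractf)
    have s: "\<bar>\<Sum>j<p. xs j * (coeff \<gamma> j \<theta> - \<beta>t j)\<bar> \<le> (\<Sum>j<p. \<bar>xs j\<bar> * \<bar>coeff \<gamma> j \<theta> - \<beta>t j\<bar>)"
      by (rule order_trans[OF sum_abs]) (simp add: abs_mult)
    have "\<bar>lin \<gamma> \<theta> - ?tgt\<bar> \<le> \<bar>fst \<theta> - \<alpha>t\<bar> + (\<Sum>j<p. \<bar>xs j\<bar> * \<bar>coeff \<gamma> j \<theta> - \<beta>t j\<bar>)"
      unfolding e by (rule order_trans[OF abs_triangle_ineq add_left_mono[OF s]])
    also have "\<dots> \<le> sqrt (dev \<gamma> \<theta>) + (\<Sum>j<p. \<bar>xs j\<bar> * sqrt (dev \<gamma> \<theta>))"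
      by (intro add_mono sum_mono mult_left_mono abs_dev_le) auto
    also have "\<dots> = ?Lx * sqrt (dev \<gamma> \<theta>)" by (simp add: distrib_right sum_distrib_right)
    finally show ?thesis .
  qed
  have each: "\<bar>(\<integral>\<theta>. lin \<gamma> \<theta> * joint n \<gamma> y \<theta> \<partial>?PS \<gamma>) - ?tgt * ?m \<gamma>\<bar> \<le> ?Lx * (sqrt \<epsilon> * ?m \<gamma> + r * ?m T)"
    if \<gamma>: "\<gamma> \<subseteq> {..<p}" for \<gamma>
  proof -
    have S: "?bad \<gamma> \<in> sets (?PS \<gamma>)" using measurable_dev[of \<gamma>] by measurable
    have i_bad: "integrable (?PS \<gamma>) (\<lambda>\<theta>. (1 + dev \<gamma> \<theta>) * joint n \<gamma> y \<theta> * indicator (?bad \<gamma>) \<theta>)"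
      by (rule integrable_real_mult_indicator[OF S int[OF \<gamma>]])
    have d: "(\<integral>\<theta>. lin \<gamma> \<theta> * joint n \<gamma> y \<theta> \<partial>?PS \<gamma>) - ?tgt * ?m \<gamma>
        = (\<integral>\<theta>. lin \<gamma> \<theta> * joint n \<gamma> y \<theta> - ?tgt * joint n \<gamma> y \<theta> \<partial>?PS \<gamma>)"
      unfolding marg_lik_def
      by (simp only: Bochner_Integration.integral_diff[OF i_lin[OF \<gamma>] integrable_mult_right[OF i1[OF \<gamma>]]]
        integral_mult_right_zero)
    have "\<bar>(\<integral>\<theta>. lin \<gamma> \<theta> * joint n \<gamma> y \<theta> \<partial>?PS \<gamma>) - ?tgt * ?m \<gamma>\<bar>
        \<le> (\<integral>\<theta>. \<bar>lin \<gamma> \<theta> * joint n \<gamma> y \<theta> - ?tgt * joint n \<gamma> y \<theta>\<bar> \<partial>?PS \<gamma>)"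
      unfolding d by (rule integral_abs_bound)
    also have "\<dots> \<le> (\<integral>\<theta>. ?Lx * (sqrt \<epsilon> * joint n \<gamma> y \<theta> + (1 + dev \<gamma> \<theta>) * joint n \<gamma> y \<theta> * indicator (?bad \<gamma>) \<theta>) \<partial>?PS \<gamma>)"
    proof (rule integral_mono)
      show "integrable (?PS \<gamma>) (\<lambda>\<theta>. \<bar>lin \<gamma> \<theta> * joint n \<gamma> y \<theta> - ?tgt * joint n \<gamma> y \<theta>\<bar>)"
        by (rule integrable_abs[OF Bochner_Integration.integrable_diff[OF i_lin[OF \<gamma>] integrable_mult_right[OF i1[OF \<gamma>]]]])
      show "integrable (?PS \<gamma>) (\<lambda>\<theta>. ?Lx * (sqrt \<epsilon> * joint n \<gamma> y \<theta> + (1 + dev \<gamma> \<theta>) * joint n \<gamma> y \<theta> * indicator (?bad \<gamma>) \<theta>))"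
        by (rule integrable_mult_right[OF Bochner_Integration.integrable_add[OF integrable_mult_right[OF i1[OF \<gamma>]] i_bad]])
      fix \<theta> assume \<theta>: "\<theta> \<in> space (?PS \<gamma>)"
      \<comment> \<open>Outside the bad set the first summand suffices by monotonicity of
        \<open>sqrt\<close>; on it \<open>sqrt_dev_le\<close> does.\<close>
      have "sqrt (dev \<gamma> \<theta>) \<le> sqrt \<epsilon> + (1 + dev \<gamma> \<theta>) * indicator (?bad \<gamma>) \<theta>"
      proof (cases "dev \<gamma> \<theta> > \<epsilon>")
        case True
        then show ?thesis using sqrt_dev_le[of \<gamma> \<theta>] \<theta> \<epsilon> by (simp add: add_increasing)
      qed simp
      then have "\<bar>lin \<gamma> \<theta> - ?tgt\<bar> \<le> ?Lx * (sqrt \<epsilon> + (1 + dev \<gamma> \<theta>) * indicator (?bad \<gamma>) \<theta>)"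
        by (intro order_trans[OF lin_le mult_left_mono] less_imp_le[OF Lx])
      then have "\<bar>lin \<gamma> \<theta> - ?tgt\<bar> * joint n \<gamma> y \<theta> \<le> ?Lx * (sqrt \<epsilon> + (1 + dev \<gamma> \<theta>) * indicator (?bad \<gamma>) \<theta>) * joint n \<gamma> y \<theta>"
        using J0[OF \<gamma>] by (intro mult_right_mono)
      moreover have "\<bar>lin \<gamma> \<theta> * joint n \<gamma> y \<theta> - ?tgt * joint n \<gamma> y \<theta>\<bar> = \<bar>lin \<gamma> \<theta> - ?tgt\<bar> * joint n \<gamma> y \<theta>"
        unfolding left_diff_distrib[symmetric] abs_mult abs_of_nonneg[OF J0[OF \<gamma>]] ..
      ultimately show "\<bar>lin \<gamma> \<theta> * joint n \<gamma> y \<theta> - ?tgt * joint n \<gamma> y \<theta>\<bar>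
          \<le> ?Lx * (sqrt \<epsilon> * joint n \<gamma> y \<theta> + (1 + dev \<gamma> \<theta>) * joint n \<gamma> y \<theta> * indicator (?bad \<gamma>) \<theta>)"
        by (simp only: distrib_left distrib_right mult_ac)
    qed
    also have "\<dots> = ?Lx * (sqrt \<epsilon> * ?m \<gamma> + (\<integral>\<theta>. (1 + dev \<gamma> \<theta>) * joint n \<gamma> y \<theta> * indicator (?bad \<gamma>) \<theta> \<partial>?PS \<gamma>))"
      unfolding marg_lik_def
      by (simp only: Bochner_Integration.integral_add[OF integrable_mult_right[OF i1[OF \<gamma>]] i_bad]
        integral_mult_right_zero)
    also have "\<dots> \<le> ?Lx * (sqrt \<epsilon> * ?m \<gamma> + r * ?m T)"
      using Lx bad[OF \<gamma>] by (intro mult_left_mono add_left_mono) auto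
    finally show ?thesis .
  qed
  \<comment> \<open>The sign comes from the hypothesis on the bad integral in \<open>T\<close>,
    which is nonnegative; it allows \<open>?m T / Tot\<close> to be replaced by
    \<open>1 / prior T\<close> at the end.\<close>
  have r0: "r \<ge> 0"
  proof -
    have "0 \<le> (\<integral>\<theta>. (1 + dev T \<theta>) * joint n T y \<theta> * indicator (?bad T) \<theta> \<partial>?PS T)"
      using J0[OF T_sub] dev_nonneg by (intro integral_nonneg_AE) (auto intro!: mult_nonneg_nonneg add_nonneg_nonneg)
    then have "0 \<le> r * ?m T" using bad[OF T_sub] by linarith
    then show ?thesis using pT by (simp add: zero_le_mult_iff)
  qed
  have "\<bar>bma_pred a p k blk X prior xs n y - ?tgt\<bar>
      = \<bar>\<Sum>\<gamma>\<in>Pow {..<p}. prior \<gamma> * ((\<integral>\<theta>. lin \<gamma> \<theta> * joint n \<gamma> y \<theta> \<partial>?PS \<gamma>) - ?tgt * ?m \<gamma>)\<bar> / Tot"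
    unfolding err abs_divide using Tot0 by simp
  also have "\<dots> \<le> (\<Sum>\<gamma>\<in>Pow {..<p}. prior \<gamma> * (?Lx * (sqrt \<epsilon> * ?m \<gamma> + r * ?m T))) / Tot"
  proof (intro divide_right_mono order_trans[OF sum_abs] sum_mono)
    fix \<gamma> assume "\<gamma> \<in> Pow {..<p}"
    then have \<gamma>: "\<gamma> \<subseteq> {..<p}" by simp
    show "\<bar>prior \<gamma> * ((\<integral>\<theta>. lin \<gamma> \<theta> * joint n \<gamma> y \<theta> \<partial>?PS \<gamma>) - ?tgt * ?m \<gamma>)\<bar> \<le> prior \<gamma> * (?Lx * (sqrt \<epsilon> * ?m \<gamma> + r * ?m T))"
      using each[OF \<gamma>] prior(1)[OF \<gamma>] by (simp add: abs_mult)
  qed (use Tot0 in simp)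
  also have "(\<Sum>\<gamma>\<in>Pow {..<p}. prior \<gamma> * (?Lx * (sqrt \<epsilon> * ?m \<gamma> + r * ?m T))) / Tot
      = ?Lx * (sqrt \<epsilon> * Tot + r * ?m T * (\<Sum>\<gamma>\<in>Pow {..<p}. prior \<gamma>)) / Tot"
  proof -
    have "(\<Sum>\<gamma>\<in>Pow {..<p}. prior \<gamma> * (?Lx * (sqrt \<epsilon> * ?m \<gamma> + r * ?m T)))
        = (\<Sum>\<gamma>\<in>Pow {..<p}. (?Lx * sqrt \<epsilon>) * (prior \<gamma> * ?m \<gamma>) + (?Lx * (r * ?m T)) * prior \<gamma>)"
      by (intro sum.cong refl) (simp only: distrib_left distrib_right mult_ac)
    also have "\<dots> = (?Lx * sqrt \<epsilon>) * Tot + (?Lx * (r * ?m T)) * (\<Sum>\<gamma>\<in>Pow {..<p}. prior \<gamma>)"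
      unfolding Tot_def sum.distrib sum_distrib_left ..
    finally show ?thesis by (simp only: distrib_left mult.assoc)
  qed
  also have "?Lx * (sqrt \<epsilon> * Tot + r * ?m T * (\<Sum>\<gamma>\<in>Pow {..<p}. prior \<gamma>)) / Tot = ?Lx * (sqrt \<epsilon> + r * (?m T / Tot))"
    unfolding prior(2) using Tot0 by (simp add: field_simps)
  also have "\<dots> \<le> ?Lx * (sqrt \<epsilon> + r * (1 / prior T))"
  proof (intro mult_left_mono add_left_mono r0)
    show "?m T / Tot \<le> 1 / prior T"
      using Tot Tot0 prior(1)[OF T_sub] by (simp add: field_simps)
  qed (use Lx in auto)
  finally show ?thesis by simp
qed

text \<open>Probability enters only through the noise event: on it the deterministic error bound
  applies for large \<open>n\<close>, and its complement is covered by a set of measure below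
  \<open>\<delta>\<close>.\<close>

lemma bma_pred_conv_in_prob:
  assumes prior: "\<And>\<gamma>. \<gamma> \<subseteq> {..<p} \<Longrightarrow> prior \<gamma> > 0" "(\<Sum>\<gamma>\<in>Pow {..<p}. prior \<gamma>) = 1"
  shows "conv_in_prob (data_dist (\<lambda>n i. \<alpha>t + (\<Sum>j\<in>T. X n i j * \<beta>t j)) sig2)
    (bma_pred a p k blk X prior xs) (\<alpha>t + (\<Sum>j<p. xs j * \<beta>t j))"
  unfolding conv_in_prob_def
proof (intro allI impI)
  fix \<epsilon> \<delta> :: real assume \<epsilon>: "\<epsilon> > 0" and \<delta>: "\<delta> > 0"
  let ?\<mu> = "\<lambda>n i. \<alpha>t + (\<Sum>j\<in>T. X n i j * \<beta>t j)"
  let ?M = "data_dist ?\<mu> sig2"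
  let ?Lx = "1 + (\<Sum>j<p. \<bar>xs j\<bar>)" and ?tgt = "\<alpha>t + (\<Sum>j<p. xs j * \<beta>t j)"
  have Lx: "?Lx > 0" by (simp add: add_pos_nonneg sum_nonneg)
  \<comment> \<open>The deviation threshold whose contribution \<open>?Lx * sqrt \<epsilon>'\<close>
    is exactly half of the permitted error; the other half is left to the vanishing
    \<open>R n\<close>.\<close>
  define \<epsilon>' where "\<epsilon>' = (\<epsilon> / (2 * ?Lx))\<^sup>2"
  have \<epsilon>': "\<epsilon>' > 0" "?Lx * sqrt \<epsilon>' = \<epsilon> / 2"
  proof -
    have *: "\<epsilon> / (2 * ?Lx) > 0" using \<epsilon> Lx by (intro divide_pos_pos) auto
    then show "\<epsilon>' > 0" unfolding \<epsilon>'_def by (rule zero_less_power)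
    have "?Lx * (\<epsilon> / (2 * ?Lx)) = \<epsilon> / 2" using Lx by (metis less_irrefl mult.commute nonzero_mult_divide_mult_cancel_right times_divide_eq_right)
    then show "?Lx * sqrt \<epsilon>' = \<epsilon> / 2" unfolding \<epsilon>'_def using * by (simp only: real_sqrt_abs abs_of_pos)
  qed
  obtain \<eta> :: real and R :: "nat \<Rightarrow> real" where \<eta>: "\<eta> > 0" and R: "R \<longlonglongrightarrow> 0"
    and conc: "eventually (\<lambda>n. \<forall>y. noise_event p X sig2 \<eta> n (\<lambda>i. y i - ?\<mu> n i) \<longrightarrow>
       marg_lik a k blk X n T y > 0 \<and>
       (\<forall>\<gamma>. \<gamma> \<subseteq> {..<p} \<longrightarrow> (\<forall>\<theta>. joint n \<gamma> y \<theta> \<ge> 0) \<and>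
         integrable (param_space k blk \<gamma>) (\<lambda>\<theta>. (1 + dev \<gamma> \<theta>) * joint n \<gamma> y \<theta>) \<and>
         (\<integral>\<theta>. (1 + dev \<gamma> \<theta>) * joint n \<gamma> y \<theta> * indicator {\<theta> \<in> space (param_space k blk \<gamma>). dev \<gamma> \<theta> > \<epsilon>'} \<theta>
            \<partial>param_space k blk \<gamma>) \<le> R n * marg_lik a k blk X n T y)) sequentially"
    by (rule posterior_concentration[OF \<epsilon>'(1)])
  have "(\<lambda>n. ?Lx * (R n / prior T)) \<longlonglongrightarrow> ?Lx * (0 / prior T)"
    using prior(1)[OF T_sub] by (intro tendsto_intros R) auto
  then have "eventually (\<lambda>n. ?Lx * (R n / prior T) < \<epsilon> / 2) sequentially"
    using \<epsilon> by (intro order_tendstoD(2)) auto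
  moreover have "eventually (\<lambda>n. \<exists>A\<in>sets (?M n).
      {y \<in> space (?M n). \<not> noise_event p X sig2 \<eta> n (\<lambda>i. y i - ?\<mu> n i)} \<subseteq> A \<and> measure (?M n) A < \<delta>) sequentially"
    by (rule noise_event_complement[OF sig2_pos \<eta> \<delta>, where D = D]) (rule X_lim)
  ultimately show "eventually (\<lambda>n. \<exists>A\<in>sets (?M n).
      {y \<in> space (?M n). \<bar>bma_pred a p k blk X prior xs n y - ?tgt\<bar> > \<epsilon>} \<subseteq> A \<and> measure (?M n) A < \<delta>) sequentially"
    using conc
  proof eventually_elim
    case (elim n)
    have "{y \<in> space (?M n). \<bar>bma_pred a p k blk X prior xs n y - ?tgt\<bar> > \<epsilon>}
        \<subseteq> {y \<in> space (?M n). \<not> noise_event p X sig2 \<eta> n (\<lambda>i. y i - ?\<mu> n i)}"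
    proof (intro subsetI CollectI conjI notI)
      fix y assume y: "y \<in> {y \<in> space (?M n). \<bar>bma_pred a p k blk X prior xs n y - ?tgt\<bar> > \<epsilon>}"
      then show "y \<in> space (?M n)" by simp
      assume "noise_event p X sig2 \<eta> n (\<lambda>i. y i - ?\<mu> n i)"
      with elim(3) have *: "marg_lik a k blk X n T y > 0"
        "\<And>\<gamma> \<theta>. \<gamma> \<subseteq> {..<p} \<Longrightarrow> joint n \<gamma> y \<theta> \<ge> 0"
        "\<And>\<gamma>. \<gamma> \<subseteq> {..<p} \<Longrightarrow> integrable (param_space k blk \<gamma>) (\<lambda>\<theta>. (1 + dev \<gamma> \<theta>) * joint n \<gamma> y \<theta>)"
        "\<And>\<gamma>. \<gamma> \<subseteq> {..<p} \<Longrightarrow> (\<integral>\<theta>. (1 + dev \<gamma> \<theta>) * joint n \<gamma> y \<theta> * indicator {\<theta> \<in> space (param_space k blk \<gamma>). dev \<gamma> \<theta> > \<epsilon>'} \<theta>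
            \<partial>param_space k blk \<gamma>) \<le> R n * marg_lik a k blk X n T y"
        by blast+
      have "\<bar>bma_pred a p k blk X prior xs n y - ?tgt\<bar> \<le> ?Lx * (sqrt \<epsilon>' + R n / prior T)"
        by (rule bma_pred_error[OF *(2,3,1,4) prior \<epsilon>'(1)])
      also have "\<dots> = ?Lx * sqrt \<epsilon>' + ?Lx * (R n / prior T)" by (rule distrib_left)
      also have "\<dots> < \<epsilon>" using elim(1) \<epsilon>'(2) by linarith
      finally show False using y by simp
    qed
    with elim(2) show ?case by blast
  qed
qed

end

theorem theorem5p3:
  fixes p k :: nat
    and blk :: "nat \<Rightarrow> nat"
    and X :: "nat \<Rightarrow> nat \<Rightarrow> nat \<Rightarrow> real"
    and D :: "nat \<Rightarrow> nat \<Rightarrow> real"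
    and a :: real
    and prior :: "nat set \<Rightarrow> real"
    and T :: "nat set"
    and \<alpha>T sig2 :: real
    and \<beta>T xs :: "nat \<Rightarrow> real"
  assumes blk_range: "\<forall>j<p. blk j < k"
    and blk_nonempty: "\<forall>b<k. \<exists>j<p. blk j = b"
    and X_centered: "\<forall>n. \<forall>j<p. (\<Sum>i<n. X n i j) = 0"
    and X_orth: "\<forall>n. \<forall>j<p. \<forall>l<p. blk j \<noteq> blk l \<longrightarrow> (\<Sum>i<n. X n i j * X n i l) = 0"
    and X_lim: "\<forall>j<p. \<forall>l<p. (\<lambda>n. (\<Sum>i<n. X n i j * X n i l) / real n) \<longlonglongrightarrow> D j l"
    and D_posdef: "\<forall>v. (\<exists>j<p. v j \<noteq> 0) \<longrightarrow> (\<Sum>j<p. \<Sum>l<p. v j * D j l * v l) > 0"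
    and a_range: "2 < a" "a \<le> 4"
    and prior_pos: "\<forall>\<gamma>. \<gamma> \<subseteq> {..<p} \<longrightarrow> prior \<gamma> > 0"
    and prior_sum: "(\<Sum>\<gamma>\<in>Pow {..<p}. prior \<gamma>) = 1"
    and T_sub: "T \<subseteq> {..<p}"
    and \<beta>T_pad: "\<forall>j. j \<notin> T \<longrightarrow> \<beta>T j = 0"
    and sig2_pos: "sig2 > 0"
    and identif: "\<forall>\<gamma>. \<gamma> \<subseteq> {..<p} \<and> \<not> T \<subseteq> \<gamma> \<longrightarrow>
        (\<exists>L>0. (\<lambda>n. resid_ss X n \<gamma> (\<lambda>i. \<Sum>j\<in>T. X n i j * \<beta>T j) / real n) \<longlonglongrightarrow> L)"
  shows "conv_in_prob
           (data_dist (\<lambda>n i. \<alpha>T + (\<Sum>j\<in>T. X n i j * \<beta>T j)) sig2)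
           (bma_pred a p k blk X prior xs)
           (\<alpha>T + (\<Sum>j<p. xs j * \<beta>T j))"
proof -
  interpret block_hyperg p k blk X D a T \<alpha>T sig2 \<beta>T
    using assms by unfold_locales (auto simp: gram_def)
  show ?thesis using prior_pos prior_sum by (intro bma_pred_conv_in_prob) auto
qed

end
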